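(* For generic $q$ and $w_1,\dots,w_N$ and for $y\in\mathbb C^\times$, let $Z_{\rm AD}(y;w_1,\dots,w_N)=\langle\psi_{\rm AD}|y^M|\psi_{\rm AD}\rangle$, where $\langle\psi_{\rm AD}|$ and $|\psi_{\rm AD}\rangle$ are the special left- and right-eigenvectors of the transfer matrix with anti-diagonal twist. Then $$Z_{\rm AD}(y;w_1,\dots,w_N)=\frac{\prod_{i,j=1}^N[qw_i/w_j]}{\prod_{1\le i<j\le N}[w_i/w_j][w_j/w_i]}\det_{1\le i,j\le N}\left(\frac{y^{-1}}{[qw_i/w_j]}+\frac{y}{[qw_j/w_i]}\right).$$
   Context: Notation: $[z]=z-z^{-1}$; $q\in\mathbb C^\times$; $\mathbb C^2$ has basis $|{\uparrow}\rangle,|{\downarrow}\rangle$ and $\mathbb C^3$ has basis $|{\Uparrow}\rangle,|0\rangle,|{\Downarrow}\rangle$; $M=\sum_js_j^3$ with $s^3=\mathrm{diag}(1,0,-1)$ in this basis. $R(z)$ is the operator on $\mathbb C^2\otimes\mathbb C^3$ with diagonal entries $[q^2z],[qz],[z],[z],[qz],[q^2z]$ on $|{\uparrow\Uparrow}\rangle,|{\uparrow}0\rangle,|{\uparrow\Downarrow}\rangle,|{\downarrow\Uparrow}\rangle,|{\downarrow}0\rangle,|{\downarrow\Downarrow}\rangle$, and whose only non-zero off-diagonal entries are those between $|{\uparrow}0\rangle$ and $|{\downarrow\Uparrow}\rangle$ and between $|{\uparrow\Downarrow}\rangle$ and $|{\downarrow}0\rangle$ (both directions), all equal to $\sqrt{[q][q^2]}$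 (a fixed root). For $w_1,\dots,w_N\in\mathbb C^\times$ and auxiliary space $a\simeq\mathbb C^2$, $$R_{a,N}(q^{-1}z/w_N)\cdots R_{a,1}(q^{-1}z/w_1)=\begin{pmatrix}\mathcal A(z)&\mathcal B(z)\\ \mathcal C(z)&\mathcal D(z)\end{pmatrix}_a .$$ The anti-diagonally twisted transfer matrix is $T^{(1)}(z)=\mathrm i(\mathcal B(z)+\mathcal C(z))$ on $(\mathbb C^3)^{\otimes N}$. For generic parameters, $|\psi_{\rm AD}\rangle$ is the unique vector with $T^{(1)}(z)|\psi_{\rm AD}\rangle=0$ for all $z$ and component $1$ along $|{\Uparrow\cdots\Uparrow}\rangle$, and $\langle\psi_{\rm AD}|$ is the unique covector with $\langle\psi_{\rm AD}|T^{(1)}(z)=0$ for all $z$ and $\langle\psi_{\rm AD}|{\Uparrow\cdots\Uparrow}\rangle=1$. "Generic" means outside a proper Zariski-closed subset of parameter space. *)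

theory Defs
  imports Complex_Main "HOL-Library.FuncSet" "Jordan_Normal_Form.Determinant"
begin

definition br :: "complex \<Rightarrow> complex" where
  "br z = z - inverse z"


section \<open>Generic parameters\<close>

text \<open>
  The \<open>N\<close> sites are numbered \<open>0, \<dots>, N - 1\<close>. A point \<open>(q, w)\<close> of the parameter space has non-zero
  coordinates \<open>q, w 0, \<dots>, w (N - 1)\<close>; \<open>w\<close> is extensional, so that a point is determined by its
  coordinates.
\<close>

definition param_space :: "nat \<Rightarrow> (complex \<times> (nat \<Rightarrow> complex)) set" where
  "param_space N = (UNIV - {0}) \<times> ({..<N} \<rightarrow>\<^sub>E (UNIV - {0}))"

inductive poly_fun :: "nat \<Rightarrow> (complex \<times> (nat \<Rightarrow> complex) \<Rightarrow> complex) \<Rightarrow> bool" for N where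
  poly_fun_const: "poly_fun N (\<lambda>_. c)"
| poly_fun_q: "poly_fun N (\<lambda>x. fst x)"
| poly_fun_w: "i < N \<Longrightarrow> poly_fun N (\<lambda>x. snd x i)"
| poly_fun_add: "poly_fun N f \<Longrightarrow> poly_fun N g \<Longrightarrow> poly_fun N (\<lambda>x. f x + g x)"
| poly_fun_mult: "poly_fun N f \<Longrightarrow> poly_fun N g \<Longrightarrow> poly_fun N (\<lambda>x. f x * g x)"

text \<open>
  Clearing denominators, zero loci of Laurent polynomials on the torus are the same as zero loci of
  polynomials.
\<close>

definition zariski_closed :: "nat \<Rightarrow> (complex \<times> (nat \<Rightarrow> complex)) set \<Rightarrow> bool" where
  "zariski_closed N V \<longleftrightarrow>
    (\<exists>F. (\<forall>f\<in>F. poly_fun N f) \<and> V = {x \<in> param_space N. \<forall>f\<in>F. f x = 0})"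

definition for_generic_params :: "nat \<Rightarrow> (complex \<Rightarrow> (nat \<Rightarrow> complex) \<Rightarrow> bool) \<Rightarrow> bool" where
  "for_generic_params N P \<longleftrightarrow>
    (\<exists>V. zariski_closed N V \<and> V \<subset> param_space N \<and> (\<forall>(q, w) \<in> param_space N - V. P q w))"


section \<open>The R-matrix\<close>

datatype aux = Aux_Up | Aux_Down

datatype spin = Spin_Up | Spin_Zero | Spin_Down

text \<open>
  Operators are given by their matrix elements, the first argument labelling the row (output) and
  the second one the column (input). The argument \<open>r\<close> is the chosen root of \<open>[q][q\<^sup>2]\<close>.
\<close>

fun R_diag :: "complex \<Rightarrow> complex \<Rightarrow> aux \<times> spin \<Rightarrow> complex" where
  "R_diag q z (Aux_Up, Spin_Up) = br (q\<^sup>2 * z)"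
| "R_diag q z (Aux_Up, Spin_Zero) = br (q * z)"
| "R_diag q z (Aux_Up, Spin_Down) = br z"
| "R_diag q z (Aux_Down, Spin_Up) = br z"
| "R_diag q z (Aux_Down, Spin_Zero) = br (q * z)"
| "R_diag q z (Aux_Down, Spin_Down) = br (q\<^sup>2 * z)"

definition R_mat :: "complex \<Rightarrow> complex \<Rightarrow> complex \<Rightarrow> aux \<times> spin \<Rightarrow> aux \<times> spin \<Rightarrow> complex" where
  "R_mat q r z x y =
    (if x = y then R_diag q z x
     else if {x, y} = {(Aux_Up, Spin_Zero), (Aux_Down, Spin_Up)}
           \<or> {x, y} = {(Aux_Up, Spin_Down), (Aux_Down, Spin_Zero)} then r
     else 0)"


section \<open>The transfer matrix with anti-diagonal twist\<close>

text \<open>The spin configurations of length \<open>N\<close> label the standard basis of the \<open>N\<close>-fold tensor power.\<close>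

definition configs :: "nat \<Rightarrow> spin list set" where
  "configs N = {\<sigma>. length \<sigma> = N}"

text \<open>\<open>R\<close> acting on the auxiliary space and site \<open>j\<close>, and as the identity on the other sites.\<close>

definition R_site ::
  "nat \<Rightarrow> complex \<Rightarrow> complex \<Rightarrow> nat \<Rightarrow> complex \<Rightarrow> aux \<times> spin list \<Rightarrow> aux \<times> spin list \<Rightarrow> complex" where
  "R_site N q r j z = (\<lambda>(a, \<sigma>) (b, \<tau>).
    if \<forall>k<N. k \<noteq> j \<longrightarrow> \<sigma> ! k = \<tau> ! k then R_mat q r z (a, \<sigma> ! j) (b, \<tau> ! j) else 0)"

text \<open>The product of the R-matrices of the first \<open>n\<close> sites, later sites standing to the left.\<close>

primrec monodromy_upto ::
  "nat \<Rightarrow> complex \<Rightarrow> complex \<Rightarrow> (nat \<Rightarrow> complex) \<Rightarrow> complex \<Rightarrow> nat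
    \<Rightarrow> aux \<times> spin list \<Rightarrow> aux \<times> spin list \<Rightarrow> complex" where
  "monodromy_upto N q r w z 0 = (\<lambda>x y. if x = y then 1 else 0)"
| "monodromy_upto N q r w z (Suc n) = (\<lambda>x y.
    \<Sum>u \<in> UNIV \<times> configs N.
      R_site N q r n (inverse q * z / w n) x u * monodromy_upto N q r w z n u y)"

definition op_B ::
  "nat \<Rightarrow> complex \<Rightarrow> complex \<Rightarrow> (nat \<Rightarrow> complex) \<Rightarrow> complex \<Rightarrow> spin list \<Rightarrow> spin list \<Rightarrow> complex" where
  "op_B N q r w z \<sigma> \<tau> = monodromy_upto N q r w z N (Aux_Up, \<sigma>) (Aux_Down, \<tau>)"

definition op_C ::
  "nat \<Rightarrow> complex \<Rightarrow> complex \<Rightarrow> (nat \<Rightarrow> complex) \<Rightarrow> complex \<Rightarrow> spin list \<Rightarrow> spin list \<Rightarrow> complex" where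
  "op_C N q r w z \<sigma> \<tau> = monodromy_upto N q r w z N (Aux_Down, \<sigma>) (Aux_Up, \<tau>)"

definition transfer ::
  "nat \<Rightarrow> complex \<Rightarrow> complex \<Rightarrow> (nat \<Rightarrow> complex) \<Rightarrow> complex \<Rightarrow> spin list \<Rightarrow> spin list \<Rightarrow> complex" where
  "transfer N q r w z \<sigma> \<tau> = \<i> * (op_B N q r w z \<sigma> \<tau> + op_C N q r w z \<sigma> \<tau>)"


section \<open>The special eigenvectors and their scalar product\<close>

text \<open>
  Vectors and covectors are given by their components, extended by \<open>0\<close> outside \<open>configs N\<close>. The
  pairing of a covector with a vector is bilinear.
\<close>

definition is_psi_right ::
  "nat \<Rightarrow> complex \<Rightarrow> complex \<Rightarrow> (nat \<Rightarrow> complex) \<Rightarrow> (spin list \<Rightarrow> complex) \<Rightarrow> bool" where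
  "is_psi_right N q r w \<psi> \<longleftrightarrow>
    (\<forall>\<sigma>. \<sigma> \<notin> configs N \<longrightarrow> \<psi> \<sigma> = 0) \<and>
    (\<forall>z. z \<noteq> 0 \<longrightarrow> (\<forall>\<sigma> \<in> configs N. (\<Sum>\<tau> \<in> configs N. transfer N q r w z \<sigma> \<tau> * \<psi> \<tau>) = 0)) \<and>
    \<psi> (replicate N Spin_Up) = 1"

definition is_psi_left ::
  "nat \<Rightarrow> complex \<Rightarrow> complex \<Rightarrow> (nat \<Rightarrow> complex) \<Rightarrow> (spin list \<Rightarrow> complex) \<Rightarrow> bool" where
  "is_psi_left N q r w \<phi> \<longleftrightarrow>
    (\<forall>\<sigma>. \<sigma> \<notin> configs N \<longrightarrow> \<phi> \<sigma> = 0) \<and>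
    (\<forall>z. z \<noteq> 0 \<longrightarrow> (\<forall>\<tau> \<in> configs N. (\<Sum>\<sigma> \<in> configs N. \<phi> \<sigma> * transfer N q r w z \<sigma> \<tau>) = 0)) \<and>
    \<phi> (replicate N Spin_Up) = 1"

definition psi_right :: "nat \<Rightarrow> complex \<Rightarrow> complex \<Rightarrow> (nat \<Rightarrow> complex) \<Rightarrow> spin list \<Rightarrow> complex" where
  "psi_right N q r w = (THE \<psi>. is_psi_right N q r w \<psi>)"

definition psi_left :: "nat \<Rightarrow> complex \<Rightarrow> complex \<Rightarrow> (nat \<Rightarrow> complex) \<Rightarrow> spin list \<Rightarrow> complex" where
  "psi_left N q r w = (THE \<phi>. is_psi_left N q r w \<phi>)"

primrec spin3 :: "spin \<Rightarrow> int" where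
  "spin3 Spin_Up = 1"
| "spin3 Spin_Zero = 0"
| "spin3 Spin_Down = - 1"

text \<open>The eigenvalue of the diagonal operator \<open>M\<close>.\<close>

definition magnetisation :: "spin list \<Rightarrow> int" where
  "magnetisation \<sigma> = (\<Sum>s\<leftarrow>\<sigma>. spin3 s)"

definition Z_AD :: "nat \<Rightarrow> complex \<Rightarrow> complex \<Rightarrow> (nat \<Rightarrow> complex) \<Rightarrow> complex \<Rightarrow> complex" where
  "Z_AD N q r w y =
    (\<Sum>\<sigma> \<in> configs N. psi_left N q r w \<sigma> * y powi magnetisation \<sigma> * psi_right N q r w \<sigma>)"

end

theory Submission
  imports Defs
begin

text \<open>
  Separation of variables. Starting from the all-up state, the operators \<open>B(\<xi>)\<close> at
  \<open>\<xi> = q w\<^sub>j, w\<^sub>j\<close> build joint eigenvectors of \<open>D(z)\<close> labelled by \<open>h \<in> {0, 1, 2}\<^sup>N\<close>, with eigenvalue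
  \<open>\<Prod>\<^sub>j [z / \<xi>\<^sub>j]\<close>, \<open>\<xi>\<^sub>j = q\<^bsup>1 - h\<^sub>j\<^esup> w\<^sub>j\<close>. For generic parameters they form a basis. At \<open>z = \<xi>\<^sub>j\<close> the
  operator \<open>B(z)\<close> raises \<open>h\<^sub>j\<close>, and by the quantum determinant \<open>C(z)\<close> lowers it up to a scalar. As
  \<open>B(z) + C(z)\<close> is a Laurent polynomial with \<open>N\<close> coefficients, Lagrange interpolation at the \<open>\<xi>\<^sub>j\<close>
  turns the equations for the two special vectors into decoupled recurrences in each \<open>h\<^sub>j\<close>: the
  solutions are unique, live on \<open>h \<in> {0, 2}\<^sup>N\<close>, and are products over the sites, apart from one
  Vandermonde-like factor. As the basis vectors have definite magnetisation, the scalar product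
  becomes a sum over subsets of sites, which agrees term by term with the expansion of the
  determinant along rows into Cauchy determinants.
\<close>

section \<open>Linear operators on the chain\<close>

text \<open>Spin 1 gives each site a ladder of three levels. On it the equations for a kernel vector
  form a 3x3 tridiagonal system with zero diagonal; its odd size forces a kernel, which is
  one-dimensional and supported on the two outer levels. Hence the special vectors exist, are unique
  and skip \<open>h_j = 1\<close>. The ladder has to end on both sides. One argument gives both
  ends: a state beyond them would be an eigenvector of \<open>D(z)\<close> whose eigenvalue has a
  zero, at \<open>q^2 w_j\<close> or \<open>q^(-2) w_j\<close>, that no basis state shares, so it is
  0. This needs the basis first. These two extra points are also why powers of \<open>q\<close> up
  to the third are excluded. The two vectors are treated differently: the right one by its
  coefficients in the basis, the left one by its values on the basis, so that their scalar product
  is a single sum and no dual family has to be computed explicitly. In the equations for the values,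
  the Lagrange factor is common to both neighbours and drops out; in those for the coefficients, the
  neighbours carry different Lagrange factors, and their ratio is the origin of the Vandermonde-like
  factor.\<close>

typedef 'i oper = "{F :: ('i \<Rightarrow> complex) \<Rightarrow> 'i \<Rightarrow> complex.
    \<forall>f g c. F (\<lambda>x. f x + c * g x) = (\<lambda>x. F f x + c * F g x)}"
  morphisms app Oper
  by (rule exI[of _ "\<lambda>f. f"]) simp

setup_lifting type_definition_oper

text \<open>A type of operators with a ring structure lets the exchange algebra be done by ring
  identities; \<open>RTT_coproduct\<close> and \<open>quantum_det_coproduct\<close> hold in any ring
  with 1.\<close>

instantiation oper :: (type) ring_1
begin

lift_definition zero_oper :: "'a oper" is "\<lambda>f x. 0" by simp
lift_definition one_oper :: "'a oper" is "\<lambda>f. f" by simp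
lift_definition plus_oper :: "'a oper \<Rightarrow> 'a oper \<Rightarrow> 'a oper" is "\<lambda>F G f x. F f x + G f x"
  by (simp add: algebra_simps)
lift_definition uminus_oper :: "'a oper \<Rightarrow> 'a oper" is "\<lambda>F f x. - F f x"
  by simp
lift_definition minus_oper :: "'a oper \<Rightarrow> 'a oper \<Rightarrow> 'a oper" is "\<lambda>F G f x. F f x - G f x"
  by (simp add: algebra_simps)
lift_definition times_oper :: "'a oper \<Rightarrow> 'a oper \<Rightarrow> 'a oper" is "\<lambda>F G f. F (G f)"
  by simp

lemma app_add_scaled: "app F (\<lambda>x. f x + c * g x) = (\<lambda>x. app F f x + c * app F g x)"
  using app[of F] by simp

instance
proof
  fix a b c :: "'a oper"
  show "(0 :: 'a oper) \<noteq> 1"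
  proof
    assume "(0 :: 'a oper) = 1"
    then have "app 0 (\<lambda>_ :: 'a. 1) = app 1 (\<lambda>_. 1)" by simp
    then show False by (simp add: zero_oper.rep_eq one_oper.rep_eq fun_eq_iff)
  qed
  show "a * (b + c) = a * b + a * c"
    using app_add_scaled[of a _ 1]
    by (simp add: app_inject[symmetric] times_oper.rep_eq plus_oper.rep_eq)
qed (transfer; simp add: algebra_simps; fail)+

end

lemma app_simps [simp]:
  "app 0 f x = 0" "app 1 f = f" "app (F + G) f x = app F f x + app G f x"
  "app (- F) f x = - app F f x" "app (F - G) f x = app F f x - app G f x"
  "app (F * G) f = app F (app G f)"
  by (transfer; simp)+

lemma app_add: "app F (\<lambda>x. f x + g x) = (\<lambda>x. app F f x + app F g x)"
  using app_add_scaled[of F f 1 g] by simp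

lemma app_zero: "app F (\<lambda>_. 0) = (\<lambda>_. 0)"
  using app_add_scaled[of F "\<lambda>_. 0" "-1" "\<lambda>_. 0"] by simp

lemma app_scaled: "app F (\<lambda>x. c * f x) = (\<lambda>x. c * app F f x)"
  using app_add_scaled[of F "\<lambda>_. 0" c f] by (simp add: app_zero)

lemma app_sum: "app F (\<lambda>x. \<Sum>i\<in>I. c i * f i x) = (\<lambda>x. \<Sum>i\<in>I. c i * app F (f i) x)"
  by (induction I rule: infinite_finite_induct)
     (simp_all add: app_zero app_add app_scaled)

lemma app_sum_left: "app (\<Sum>i\<in>I. F i) f x = (\<Sum>i\<in>I. app (F i) f x)"
  by (induction I rule: infinite_finite_induct) auto

lemma oper_eqI: "(\<And>f x. app F f x = app G f x) \<Longrightarrow> F = G"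
  by (rule app_inject[THEN iffD1]) (simp add: fun_eq_iff)

lift_definition scalar :: "complex \<Rightarrow> 'i oper" is "\<lambda>c f x. c * f x"
  by (simp add: algebra_simps)

lemma app_scalar [simp]: "app (scalar c) f x = c * f x"
  by transfer simp

lemma scalar_simps:
  "scalar 0 = 0" "scalar 1 = 1" "scalar (a + b) = scalar a + scalar b"
  "scalar (a - b) = scalar a - scalar b" "scalar (a * b) = scalar a * scalar b"
  by (auto intro!: oper_eqI simp: algebra_simps)

lemma scalar_commute: "X * scalar a = scalar a * X"
proof (rule oper_eqI)
  fix f :: "'a \<Rightarrow> complex" and x
  have "app (scalar a) f = (\<lambda>x. a * f x)" by (simp add: fun_eq_iff)
  then show "app (X * scalar a) f x = app (scalar a * X) f x"
    by (simp add: app_scaled)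
qed

section \<open>Operators on a single site and the monodromy matrix built from them\<close>

lemma UNIV_spin: "UNIV = {Spin_Up, Spin_Zero, Spin_Down}"
  using spin.exhaust by blast

lemma UNIV_aux: "UNIV = {Aux_Up, Aux_Down}"
  using aux.exhaust by blast

instance spin :: finite
  by standard (simp add: UNIV_spin)

instance aux :: finite
  by standard (simp add: UNIV_aux)

lemma sum_UNIV_spin: "(\<Sum>s\<in>UNIV. f s) = f Spin_Up + f Spin_Zero + (f Spin_Down :: 'a::comm_monoid_add)"
  by (simp add: UNIV_spin add.assoc)

lemma sum_UNIV_aux: "(\<Sum>s\<in>UNIV. f s) = f Aux_Up + (f Aux_Down :: 'a::comm_monoid_add)"
  by (simp add: UNIV_aux)

lift_definition site_op :: "nat \<Rightarrow> (spin \<Rightarrow> spin \<Rightarrow> complex) \<Rightarrow> (nat \<Rightarrow> spin) oper" is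
  "\<lambda>n X f \<sigma>. \<Sum>s\<in>UNIV. X (\<sigma> n) s * f (\<sigma>(n := s))"
  by (simp add: algebra_simps sum.distrib sum_distrib_left)

lemma app_site_op: "app (site_op n X) f \<sigma> = (\<Sum>s\<in>UNIV. X (\<sigma> n) s * f (\<sigma>(n := s)))"
  by transfer simp

lemma site_op_mult: "site_op n X * site_op n Y = site_op n (\<lambda>s t. \<Sum>u\<in>UNIV. X s u * Y u t)"
  by (rule oper_eqI) (simp add: app_site_op sum_UNIV_spin algebra_simps)

lemma site_op_add: "site_op n X + site_op n Y = site_op n (\<lambda>s t. X s t + Y s t)"
  by (rule oper_eqI) (simp add: app_site_op sum_UNIV_spin algebra_simps)

lemma site_op_diff: "site_op n X - site_op n Y = site_op n (\<lambda>s t. X s t - Y s t)"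
  by (rule oper_eqI) (simp add: app_site_op sum_UNIV_spin algebra_simps)

lemma site_op_scalar: "scalar c * site_op n X = site_op n (\<lambda>s t. c * X s t)"
  by (rule oper_eqI) (simp add: app_site_op sum_UNIV_spin algebra_simps)

lemma site_op_one: "site_op n (\<lambda>s t. if s = t then c else 0) = scalar c"
proof (rule oper_eqI)
  fix f \<sigma>
  show "app (site_op n (\<lambda>s t. if s = t then c else 0)) f \<sigma> = app (scalar c) f \<sigma>"
    by (cases "\<sigma> n") (simp_all add: app_site_op sum_UNIV_spin fun_upd_idem)
qed

lemma site_op_commute: "m \<noteq> n \<Longrightarrow> site_op m X * site_op n Y = site_op n Y * site_op m X"
  by (rule oper_eqI) (simp add: app_site_op sum_UNIV_spin algebra_simps fun_upd_twist)

definition L_op :: "complex \<Rightarrow> complex \<Rightarrow> nat \<Rightarrow> complex \<Rightarrow> aux \<Rightarrow> aux \<Rightarrow> (nat \<Rightarrow> spin) oper" where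
  "L_op q r n z a b = site_op n (\<lambda>s t. R_mat q r z (a, s) (b, t))"

text \<open>
  The operators act on functions of configurations of infinitely many sites, of which only the first
  \<open>n\<close> are touched; so the relations between them need no conditions on the number of sites.
\<close>

primrec T_op :: "complex \<Rightarrow> complex \<Rightarrow> (nat \<Rightarrow> complex) \<Rightarrow> complex \<Rightarrow> nat \<Rightarrow> aux \<Rightarrow> aux \<Rightarrow> (nat \<Rightarrow> spin) oper" where
  "T_op q r w z 0 = (\<lambda>a b. if a = b then 1 else 0)"
| "T_op q r w z (Suc n) = (\<lambda>a b. \<Sum>c\<in>UNIV. L_op q r n (inverse q * z / w n) a c * T_op q r w z n c b)"

text \<open>The first \<open>n\<close> factors touch only sites below \<open>n\<close>, so they
  commute with everything on later sites.\<close>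

lemma L_T_commute: "n \<le> m \<Longrightarrow> L_op q r m x a b * T_op q r w z n c d = T_op q r w z n c d * L_op q r m x a b"
proof (induction n arbitrary: c)
  case (Suc n)
  have "L_op q r m x a b * (L_op q r n y c e * T_op q r w z n e d)
      = L_op q r n y c e * T_op q r w z n e d * L_op q r m x a b" for y e
  proof -
    have "L_op q r m x a b * L_op q r n y c e = L_op q r n y c e * L_op q r m x a b"
      using Suc.prems by (auto simp: L_op_def intro: site_op_commute)
    then show ?thesis using Suc by (metis mult.assoc Suc_leD)
  qed
  then show ?case by (simp add: sum_distrib_left sum_distrib_right)
qed auto

section \<open>Exchange relations of the monodromy matrix\<close>

definition six_vertex :: "complex \<Rightarrow> complex \<Rightarrow> aux \<Rightarrow> aux \<Rightarrow> aux \<Rightarrow> aux \<Rightarrow> complex" where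
  "six_vertex q x a b c d =
    (if a = b then if c = a \<and> d = a then br (q * x) else 0
     else if c = a \<and> d = b then br x
     else if c = b \<and> d = a then br q else 0)"

text \<open>Entrywise form of \<open>R T_1 T_2 = T_2 T_1 R\<close> on two auxiliary spaces. The
  intended \<open>\<rho>\<close> is \<open>six_vertex\<close>, the spin-1/2 R-matrix with row
  \<open>(a, b)\<close> and column \<open>(c, d)\<close>, embedded as scalars.\<close>

definition RTT :: "(aux \<Rightarrow> aux \<Rightarrow> aux \<Rightarrow> aux \<Rightarrow> 'a::ring_1) \<Rightarrow> (aux \<Rightarrow> aux \<Rightarrow> 'a) \<Rightarrow> (aux \<Rightarrow> aux \<Rightarrow> 'a) \<Rightarrow> bool" where
  "RTT \<rho> T T' \<longleftrightarrow> (\<forall>a b e f.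
    (\<Sum>c\<in>UNIV. \<Sum>d\<in>UNIV. \<rho> a b c d * (T c e * T' d f)) = (\<Sum>c\<in>UNIV. \<Sum>d\<in>UNIV. T' b d * T a c * \<rho> c d e f))"

text \<open>Train argument: as entries on different sites commute, \<open>\<rho>\<close> can be
  pulled first through \<open>L L'\<close> and then through \<open>T T'\<close>.\<close>

lemma RTT_coproduct:
  fixes L L' T T' :: "aux \<Rightarrow> aux \<Rightarrow> 'a::ring_1"
  assumes L: "RTT \<rho> L L'" and T: "RTT \<rho> T T'"
    and comm: "\<And>a b c d. L' a b * T c d = T c d * L' a b" "\<And>a b c d. L a b * T' c d = T' c d * L a b"
  shows "RTT \<rho> (\<lambda>a b. \<Sum>c\<in>UNIV. L a c * T c b) (\<lambda>a b. \<Sum>c\<in>UNIV. L' a c * T' c b)"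
  unfolding RTT_def
proof (intro allI)
  fix a b e f
  have 1: "T x y * (L' c d * z) = L' c d * (T x y * z)" for x y c d z
    by (metis comm(1) mult.assoc)
  have 2: "T' x y * (L c d * z) = L c d * (T' x y * z)" for x y c d z
    by (metis comm(2) mult.assoc)
  have "(\<Sum>c\<in>UNIV. \<Sum>d\<in>UNIV. \<rho> a b c d * ((\<Sum>x\<in>UNIV. L c x * T x e) * (\<Sum>y\<in>UNIV. L' d y * T' y f)))
     = (\<Sum>x\<in>UNIV. \<Sum>y\<in>UNIV. (\<Sum>c\<in>UNIV. \<Sum>d\<in>UNIV. \<rho> a b c d * (L c x * L' d y)) * (T x e * T' y f))"
    unfolding sum_UNIV_aux by (simp add: distrib_left distrib_right mult.assoc 1 add_ac)
  also have "\<dots> = (\<Sum>x\<in>UNIV. \<Sum>y\<in>UNIV. (\<Sum>c\<in>UNIV. \<Sum>d\<in>UNIV. L' b d * L a c * \<rho> c d x y) * (T x e * T' y f))"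
    using L by (simp add: RTT_def)
  also have "\<dots> = (\<Sum>c\<in>UNIV. \<Sum>d\<in>UNIV. L' b d * L a c * (\<Sum>x\<in>UNIV. \<Sum>y\<in>UNIV. \<rho> c d x y * (T x e * T' y f)))"
    unfolding sum_UNIV_aux by (simp add: distrib_left distrib_right mult.assoc add_ac)
  also have "\<dots> = (\<Sum>c\<in>UNIV. \<Sum>d\<in>UNIV. L' b d * L a c * (\<Sum>x\<in>UNIV. \<Sum>y\<in>UNIV. T' d y * T c x * \<rho> x y e f))"
    using T by (simp add: RTT_def)
  also have "\<dots> = (\<Sum>x\<in>UNIV. \<Sum>y\<in>UNIV. (\<Sum>d\<in>UNIV. L' b d * T' d y) * (\<Sum>c\<in>UNIV. L a c * T c x) * \<rho> x y e f)"
    unfolding sum_UNIV_aux by (simp add: distrib_left distrib_right mult.assoc 2 add_ac)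
  finally show "(\<Sum>c\<in>UNIV. \<Sum>d\<in>UNIV. \<rho> a b c d * ((\<Sum>x\<in>UNIV. L c x * T x e) * (\<Sum>y\<in>UNIV. L' d y * T' y f)))
    = (\<Sum>x\<in>UNIV. \<Sum>y\<in>UNIV. (\<Sum>d\<in>UNIV. L' b d * T' d y) * (\<Sum>c\<in>UNIV. L a c * T c x) * \<rho> x y e f)" .
qed

text \<open>The Yang-Baxter equation for two spin-1/2 spaces and one spin-1 space, checked on all
  144 matrix entries. The root \<open>r\<close> is eliminated by \<open>r * r = [q][q^2]\<close>,
  whichever root is chosen.\<close>

lemma L_RTT_aux:
  assumes "q \<noteq> 0" "x \<noteq> 0" "y \<noteq> 0" and r: "r\<^sup>2 = br q * br (q\<^sup>2)"
  shows "(\<Sum>c\<in>UNIV. \<Sum>d\<in>UNIV. six_vertex q (x / y) a b c d *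
            (\<Sum>u\<in>UNIV. R_mat q r x (c, s) (e, u) * R_mat q r y (d, u) (f, t)))
       = (\<Sum>c\<in>UNIV. \<Sum>d\<in>UNIV. six_vertex q (x / y) c d e f *
            (\<Sum>u\<in>UNIV. R_mat q r y (b, s) (d, u) * R_mat q r x (a, u) (c, t)))"
proof -
  have rr: "r * (r * z) = br q * br (q\<^sup>2) * z" "r * r = br q * br (q\<^sup>2)" for z
    using r by (simp_all add: power2_eq_square)
  show ?thesis
    using assms(1-3)
    apply (cases a; cases b; cases e; cases f; cases s; cases t)
    apply (simp_all add: sum_UNIV_aux sum_UNIV_spin six_vertex_def R_mat_def doubleton_eq_iff rr algebra_simps)
    apply (simp_all add: br_def power2_eq_square rr)
    apply (simp_all add: field_simps power2_eq_square)
    done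
qed

lemma L_RTT:
  assumes "q \<noteq> 0" "x \<noteq> 0" "y \<noteq> 0" "r\<^sup>2 = br q * br (q\<^sup>2)"
  shows "RTT (\<lambda>a b c d. scalar (six_vertex q (x / y) a b c d)) (L_op q r n x) (L_op q r n y)"
  unfolding RTT_def
proof (intro allI)
  fix a b e f
  have 1: "X * scalar c = scalar c * X" for c and X :: "'i oper"
    by (rule scalar_commute)
  show "(\<Sum>c\<in>UNIV. \<Sum>d\<in>UNIV. scalar (six_vertex q (x / y) a b c d) * (L_op q r n x c e * L_op q r n y d f))
      = (\<Sum>c\<in>UNIV. \<Sum>d\<in>UNIV. L_op q r n y b d * L_op q r n x a c * scalar (six_vertex q (x / y) c d e f))"
    unfolding 1 L_op_def site_op_mult site_op_scalar sum_UNIV_aux site_op_add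
    using L_RTT_aux[OF assms, of a b _ e f, unfolded sum_UNIV_aux] by simp
qed

text \<open>Only the ratio of the spectral parameters enters the exchange matrix, and the shift by
  \<open>w n\<close> cancels in it, so one matrix serves all sites.\<close>

lemma T_RTT:
  assumes "q \<noteq> 0" "x \<noteq> 0" "y \<noteq> 0" "r\<^sup>2 = br q * br (q\<^sup>2)" "\<And>i. i < n \<Longrightarrow> w i \<noteq> 0"
  shows "RTT (\<lambda>a b c d. scalar (six_vertex q (x / y) a b c d)) (T_op q r w x n) (T_op q r w y n)"
  using assms(5)
proof (induction n)
  case 0
  show ?case
    unfolding RTT_def by (intro allI) (auto simp: sum_UNIV_aux six_vertex_def scalar_simps aux.split split: aux.splits)
next
  case (Suc n)
  have "x / y = (inverse q * x / w n) / (inverse q * y / w n)"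
    using assms Suc.prems[of n] by (simp add: field_simps)
  then have "RTT (\<lambda>a b c d. scalar (six_vertex q (x / y) a b c d))
      (L_op q r n (inverse q * x / w n)) (L_op q r n (inverse q * y / w n))"
    using L_RTT[of q "inverse q * x / w n" "inverse q * y / w n" r n] assms Suc.prems[of n] by simp
  moreover have "RTT (\<lambda>a b c d. scalar (six_vertex q (x / y) a b c d)) (T_op q r w x n) (T_op q r w y n)"
    using Suc by simp
  ultimately show ?case
    unfolding T_op.simps by (rule RTT_coproduct) (simp_all only: L_T_commute order_refl)
qed

text \<open>At the ratio \<open>1/q\<close> of spectral parameters, \<open>six_vertex\<close> has
  rank one and is a multiple of the projector on the singlet, so the antisymmetrised product of two
  monodromy matrices acts there as a scalar. The hypotheses \<open>L\<close> say this for one site: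
  two for equal columns, where the combination vanishes, and two for the two orders of distinct
  columns. A central \<open>\<delta>\<close> then factors out site by site.\<close>

lemma quantum_det_coproduct:
  fixes L L' T T' :: "aux \<Rightarrow> aux \<Rightarrow> 'a::ring_1"
  assumes comm: "\<And>a b c d. L' a b * T c d = T c d * L' a b"
    and central: "\<And>X. X * \<delta> = \<delta> * X"
    and L: "L Aux_Up Aux_Up * L' Aux_Down Aux_Up = L Aux_Down Aux_Up * L' Aux_Up Aux_Up"
      "L Aux_Up Aux_Down * L' Aux_Down Aux_Down = L Aux_Down Aux_Down * L' Aux_Up Aux_Down"
      "L Aux_Up Aux_Up * L' Aux_Down Aux_Down - L Aux_Down Aux_Up * L' Aux_Up Aux_Down = \<delta>"
      "L Aux_Down Aux_Down * L' Aux_Up Aux_Up - L Aux_Up Aux_Down * L' Aux_Down Aux_Up = \<delta>"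
  shows "(\<Sum>c\<in>UNIV. L Aux_Up c * T c Aux_Up) * (\<Sum>c\<in>UNIV. L' Aux_Down c * T' c Aux_Down)
       - (\<Sum>c\<in>UNIV. L Aux_Down c * T c Aux_Up) * (\<Sum>c\<in>UNIV. L' Aux_Up c * T' c Aux_Down)
       = \<delta> * (T Aux_Up Aux_Up * T' Aux_Down Aux_Down - T Aux_Down Aux_Up * T' Aux_Up Aux_Down)"
proof -
  have 1: "T x y * (L' c d * z) = L' c d * (T x y * z)" for x y c d z
    by (metis comm mult.assoc)
  have 2: "L Aux_Up Aux_Up * L' Aux_Down Aux_Down = \<delta> + L Aux_Down Aux_Up * L' Aux_Up Aux_Down"
      "L Aux_Down Aux_Down * L' Aux_Up Aux_Up = \<delta> + L Aux_Up Aux_Down * L' Aux_Down Aux_Up"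
    using L by (auto simp: algebra_simps)
  have 3: "L Aux_Up Aux_Up * (L' Aux_Down Aux_Up * z) = L Aux_Down Aux_Up * (L' Aux_Up Aux_Up * z)"
     "L Aux_Up Aux_Down * (L' Aux_Down Aux_Down * z) = L Aux_Down Aux_Down * (L' Aux_Up Aux_Down * z)"
     "L Aux_Up Aux_Up * (L' Aux_Down Aux_Down * z) = \<delta> * z + L Aux_Down Aux_Up * (L' Aux_Up Aux_Down * z)"
     "L Aux_Down Aux_Down * (L' Aux_Up Aux_Up * z) = \<delta> * z + L Aux_Up Aux_Down * (L' Aux_Down Aux_Up * z)" for z
    using L 2 by (metis mult.assoc distrib_right)+
  show ?thesis
    by (simp add: sum_UNIV_aux distrib_left distrib_right mult.assoc 1 3 right_diff_distrib)
qed

lemma L_quantum_det: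
  fixes q r x :: complex and n :: nat
  assumes "q \<noteq> 0" "x \<noteq> 0" "r\<^sup>2 = br q * br (q\<^sup>2)"
  defines "L \<equiv> L_op q r n (x / q)" and "L' \<equiv> L_op q r n x"
  shows "L Aux_Up Aux_Up * L' Aux_Down Aux_Up = L Aux_Down Aux_Up * L' Aux_Up Aux_Up"
      "L Aux_Up Aux_Down * L' Aux_Down Aux_Down = L Aux_Down Aux_Down * L' Aux_Up Aux_Down"
      "L Aux_Up Aux_Up * L' Aux_Down Aux_Down - L Aux_Down Aux_Up * L' Aux_Up Aux_Down = scalar (br (q\<^sup>2 * x) * br (x / q))"
      "L Aux_Down Aux_Down * L' Aux_Up Aux_Up - L Aux_Up Aux_Down * L' Aux_Down Aux_Up = scalar (br (q\<^sup>2 * x) * br (x / q))"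
proof -
  have rr: "r * (r * z) = br q * br (q\<^sup>2) * z" "r * r = br q * br (q\<^sup>2)" for z
    using assms(3) by (simp_all add: power2_eq_square)
  note defs = L_def L'_def L_op_def site_op_mult site_op_diff site_op_one[of n, symmetric]
  show "L Aux_Up Aux_Up * L' Aux_Down Aux_Up = L Aux_Down Aux_Up * L' Aux_Up Aux_Up"
    unfolding defs
    apply (rule arg_cong[of _ _ "site_op n"], intro ext)
    subgoal for s t
      using assms(1,2)
      by (cases s; cases t) (simp_all add: sum_UNIV_spin R_mat_def doubleton_eq_iff br_def rr field_simps power2_eq_square)
    done
  show "L Aux_Up Aux_Down * L' Aux_Down Aux_Down = L Aux_Down Aux_Down * L' Aux_Up Aux_Down"
    unfolding defs
    apply (rule arg_cong[of _ _ "site_op n"], intro ext)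
    subgoal for s t
      using assms(1,2)
      by (cases s; cases t) (simp_all add: sum_UNIV_spin R_mat_def doubleton_eq_iff br_def rr field_simps power2_eq_square)
    done
  show "L Aux_Up Aux_Up * L' Aux_Down Aux_Down - L Aux_Down Aux_Up * L' Aux_Up Aux_Down = scalar (br (q\<^sup>2 * x) * br (x / q))"
    unfolding defs
    apply (rule arg_cong[of _ _ "site_op n"], intro ext)
    subgoal for s t
      using assms(1,2)
      by (cases s; cases t) (simp_all add: sum_UNIV_spin R_mat_def doubleton_eq_iff br_def rr field_simps power2_eq_square)
    done
  show "L Aux_Down Aux_Down * L' Aux_Up Aux_Up - L Aux_Up Aux_Down * L' Aux_Down Aux_Up = scalar (br (q\<^sup>2 * x) * br (x / q))"
    unfolding defs
    apply (rule arg_cong[of _ _ "site_op n"], intro ext)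
    subgoal for s t
      using assms(1,2)
      by (cases s; cases t) (simp_all add: sum_UNIV_spin R_mat_def doubleton_eq_iff br_def rr field_simps power2_eq_square)
    done
qed

text \<open>The single-site constants \<open>[q^2 x][x / q]\<close> of \<open>L_quantum_det\<close>,
  taken at \<open>x = z / (q w_k)\<close>.\<close>

definition qdet :: "complex \<Rightarrow> (nat \<Rightarrow> complex) \<Rightarrow> nat \<Rightarrow> complex \<Rightarrow> complex" where
  "qdet q w n z = (\<Prod>k<n. br (q * z / w k) * br (z / (q\<^sup>2 * w k)))"

lemma T_quantum_det:
  assumes "q \<noteq> 0" "z \<noteq> 0" "r\<^sup>2 = br q * br (q\<^sup>2)" "\<And>i. i < n \<Longrightarrow> w i \<noteq> 0"
  shows "T_op q r w (z / q) n Aux_Up Aux_Up * T_op q r w z n Aux_Down Aux_Down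
       - T_op q r w (z / q) n Aux_Down Aux_Up * T_op q r w z n Aux_Up Aux_Down = scalar (qdet q w n z)"
  using assms(4)
proof (induction n)
  case 0
  then show ?case by (simp add: qdet_def scalar_simps)
next
  case (Suc n)
  have IH: "T_op q r w (z / q) n Aux_Up Aux_Up * T_op q r w z n Aux_Down Aux_Down
       - T_op q r w (z / q) n Aux_Down Aux_Up * T_op q r w z n Aux_Up Aux_Down = scalar (qdet q w n z)"
    using Suc by simp
  define x where "x = inverse q * z / w n"
  have x: "x \<noteq> 0" "inverse q * (z / q) / w n = x / q"
    using assms Suc.prems[of n] by (simp_all add: x_def field_simps)
  have d: "br (q\<^sup>2 * x) * br (x / q) = br (q * z / w n) * br (z / (q\<^sup>2 * w n))"
  proof -
    have "q\<^sup>2 * x = q * z / w n" "x / q = z / (q\<^sup>2 * w n)"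
      using assms Suc.prems[of n] by (simp_all add: x_def power2_eq_square field_simps)
    then show ?thesis by simp
  qed
  have "T_op q r w (z / q) (Suc n) Aux_Up Aux_Up * T_op q r w z (Suc n) Aux_Down Aux_Down
       - T_op q r w (z / q) (Suc n) Aux_Down Aux_Up * T_op q r w z (Suc n) Aux_Up Aux_Down
      = scalar (br (q\<^sup>2 * x) * br (x / q)) * scalar (qdet q w n z)"
    unfolding T_op.simps x(2) x_def[symmetric] IH[symmetric]
    by (rule quantum_det_coproduct[OF _ _ L_quantum_det[OF assms(1) x(1) assms(3)]])
       (simp_all only: L_T_commute order_refl scalar_commute)
  also have "\<dots> = scalar (qdet q w (Suc n) z)"
    unfolding d by (simp add: qdet_def scalar_simps(5)[symmetric] mult_ac)
  finally show ?case .
qed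

section \<open>Laurent polynomials\<close>

text \<open>Laurent polynomials with exponents \<open>-n, -n + 2, ..., n\<close>: fixed parity and
  \<open>n + 1\<close> coefficients. After multiplication by \<open>z^n\<close> they depend on
  \<open>z^2\<close> only, so zeros are counted by their squares.\<close>

definition laurent :: "nat \<Rightarrow> (complex \<Rightarrow> complex) \<Rightarrow> bool" where
  "laurent n F \<longleftrightarrow> (\<exists>p. degree p \<le> n \<and> (\<forall>z. z \<noteq> 0 \<longrightarrow> z ^ n * F z = poly p (z\<^sup>2)))"

lemma laurent_zero: "laurent n (\<lambda>_. 0)"
  unfolding laurent_def by (rule exI[of _ 0]) simp

lemma laurent_const: "laurent 0 (\<lambda>_. c)"
  unfolding laurent_def by (rule exI[of _ "[:c:]"]) simp

lemma laurent_add: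
  assumes "laurent n F" "laurent n G"
  shows "laurent n (\<lambda>z. F z + G z)"
proof -
  from assms obtain p1 p2 where
    "degree p1 \<le> n" "\<And>z. z \<noteq> 0 \<Longrightarrow> z ^ n * F z = poly p1 (z\<^sup>2)"
    "degree p2 \<le> n" "\<And>z. z \<noteq> 0 \<Longrightarrow> z ^ n * G z = poly p2 (z\<^sup>2)"
    unfolding laurent_def by metis
  then show ?thesis
    unfolding laurent_def by (intro exI[of _ "p1 + p2"]) (simp add: degree_add_le distrib_left)
qed

lemma laurent_scaled:
  assumes "laurent n F"
  shows "laurent n (\<lambda>z. c * F z)"
proof -
  from assms obtain p where
    "degree p \<le> n" "\<And>z. z \<noteq> 0 \<Longrightarrow> z ^ n * F z = poly p (z\<^sup>2)"
    unfolding laurent_def by metis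
  then show ?thesis
    unfolding laurent_def by (intro exI[of _ "smult c p"]) (auto simp: mult.left_commute)
qed

lemma laurent_diff: "laurent n F \<Longrightarrow> laurent n G \<Longrightarrow> laurent n (\<lambda>z. F z - G z)"
  using laurent_add[of n F "\<lambda>z. -1 * G z"] laurent_scaled[of n G "-1"] by simp

lemma laurent_sum: "(\<And>i. i \<in> I \<Longrightarrow> laurent n (F i)) \<Longrightarrow> laurent n (\<lambda>z. \<Sum>i\<in>I. F i z)"
  by (induction I rule: infinite_finite_induct) (auto intro: laurent_zero laurent_add)

lemma laurent_br_mult:
  assumes "laurent n F" "c \<noteq> 0"
  shows "laurent (Suc n) (\<lambda>z. br (c * z) * F z)"
proof -
  from assms obtain p where p:
    "degree p \<le> n" "\<And>z. z \<noteq> 0 \<Longrightarrow> z ^ n * F z = poly p (z\<^sup>2)"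
    unfolding laurent_def by metis
  have "z ^ Suc n * (br (c * z) * F z) = poly ([:- inverse c, c:] * p) (z\<^sup>2)" if "z \<noteq> 0" for z
  proof -
    have "z ^ Suc n * (br (c * z) * F z) = (z * br (c * z)) * (z ^ n * F z)"
      by simp
    also have "z * br (c * z) = - inverse c + z\<^sup>2 * c"
      using that assms(2) by (simp add: br_def field_simps power2_eq_square)
    finally show ?thesis unfolding p(2)[OF that] by (simp add: algebra_simps)
  qed
  moreover have "degree ([:- inverse c, c:] * p) \<le> Suc n"
    using degree_mult_le[of "[:- inverse c, c:]" p] p(1) by (simp add: assms(2))
  ultimately show ?thesis
    unfolding laurent_def by blast
qed

text \<open>Because of the fixed parity the bound can be raised only in steps of two.\<close>

lemma laurent_Suc_Suc:
  assumes "laurent n F"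
  shows "laurent (Suc (Suc n)) F"
proof -
  from assms obtain p where p:
    "degree p \<le> n" "\<And>z. z \<noteq> 0 \<Longrightarrow> z ^ n * F z = poly p (z\<^sup>2)"
    unfolding laurent_def by metis
  then have "z ^ Suc (Suc n) * F z = poly (pCons 0 p) (z\<^sup>2)" if "z \<noteq> 0" for z
    using that p(2)[OF that] by (simp add: power2_eq_square mult_ac)
  moreover have "degree (pCons 0 p) \<le> Suc (Suc n)"
    using degree_pCons_le[of 0 p] p(1) by simp
  ultimately show ?thesis
    unfolding laurent_def by blast
qed

lemma laurent_prod_br:
  "finite I \<Longrightarrow> (\<And>k. k \<in> I \<Longrightarrow> c k \<noteq> 0) \<Longrightarrow> laurent (card I) (\<lambda>z. \<Prod>k\<in>I. br (c k * z))"
  by (induction I rule: finite_induct) (auto simp: laurent_const intro: laurent_br_mult)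

text \<open>The associated polynomial has degree at most \<open>n\<close> but more than
  \<open>n\<close> roots, the squares of the points of \<open>A\<close>. The infinite alternative is
  stated separately because \<open>card\<close> of an infinite set is 0.\<close>

lemma laurent_eq_zero:
  assumes F: "laurent n F" and A: "n < card ((\<lambda>z. z\<^sup>2) ` A) \<or> infinite ((\<lambda>z. z\<^sup>2) ` A)"
    and zero: "\<And>z. z \<in> A \<Longrightarrow> z \<noteq> 0 \<and> F z = 0" and z: "z \<noteq> 0"
  shows "F z = 0"
proof -
  from F obtain p where p: "degree p \<le> n" "\<And>z. z \<noteq> 0 \<Longrightarrow> z ^ n * F z = poly p (z\<^sup>2)"
    unfolding laurent_def by metis
  have sub: "(\<lambda>z. z\<^sup>2) ` A \<subseteq> {x. poly p x = 0}"
  proof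
    fix x assume "x \<in> (\<lambda>z. z\<^sup>2) ` A"
    then obtain z where "z \<in> A" "x = z\<^sup>2" by blast
    then show "x \<in> {x. poly p x = 0}" using p(2)[of z] zero[of z] by simp
  qed
  have "p = 0"
  proof (rule ccontr)
    assume "p \<noteq> 0"
    then have "finite {x. poly p x = 0}" "card {x. poly p x = 0} \<le> degree p"
      by (auto intro: poly_roots_finite card_poly_roots_bound)
    then show False
      using sub A p(1) by (meson card_mono finite_subset le_trans not_le)
  qed
  then show ?thesis using p(2)[OF z] z by simp
qed

lemma R_diag_br: "\<exists>e. \<forall>y. R_diag q y x = br (q ^ e * y)"
proof -
  have "R_diag q y x = br (q ^ (case x of
      (Aux_Up, Spin_Up) \<Rightarrow> 2 | (Aux_Up, Spin_Zero) \<Rightarrow> 1 | (Aux_Up, Spin_Down) \<Rightarrow> 0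
    | (Aux_Down, Spin_Up) \<Rightarrow> 0 | (Aux_Down, Spin_Zero) \<Rightarrow> 1 | (Aux_Down, Spin_Down) \<Rightarrow> 2) * y)" for y
    by (simp split: prod.split aux.split spin.split)
  then show ?thesis by blast
qed

text \<open>Diagonal R-matrix entries have degree one in \<open>z\<close>, off-diagonal ones are
  constant, and an off-diagonal monodromy entry contains an odd number of the latter; this costs one
  degree. For \<open>n = 0\<close> the entry must be known to be zero: degree 0 would have the wrong
  parity in the next step.\<close>

lemma T_laurent_aux:
  assumes "q \<noteq> 0" "\<And>i. i < n \<Longrightarrow> w i \<noteq> 0"
  shows "if a = b then laurent n (\<lambda>z. app (T_op q r w z n a b) f \<sigma>)
    else case n of 0 \<Rightarrow> (\<forall>z. app (T_op q r w z n a b) f \<sigma> = 0)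
        | Suc m \<Rightarrow> laurent m (\<lambda>z. app (T_op q r w z n a b) f \<sigma>)"
  using assms(2)
proof (induction n arbitrary: a b \<sigma>)
  case 0
  show ?case by (simp add: laurent_const)
next
  case (Suc n)
  define x where "x z = inverse q * z / w n" for z
  have wn: "w n \<noteq> 0" using Suc.prems by simp
  have IH1: "laurent n (\<lambda>z. app (T_op q r w z n a a) f \<sigma>)" for a \<sigma>
    using Suc.IH[of a a] Suc.prems by simp
  have IH2: "laurent m (\<lambda>z. app (T_op q r w z n a b) f \<sigma>)" if "n = Suc m" "a \<noteq> b" for a b \<sigma> m
    using Suc.IH[of a b \<sigma>] Suc.prems that by simp
  have same: "laurent (Suc m) (\<lambda>z. R_mat q r (x z) (a, s) (a, t) * F z)"
    if "laurent m F" for m a s t F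
  proof (cases "s = t")
    case True
    obtain e where e: "\<And>y. R_diag q y (a, s) = br (q ^ e * y)"
      using R_diag_br[of q "(a, s)"] by blast
    have eq: "R_mat q r (x z) (a, s) (a, t) = br (q ^ e * inverse q / w n * z)" for z
      by (simp add: R_mat_def True e[unfolded True] x_def mult.assoc)
    have "q ^ e * inverse q / w n \<noteq> 0" using assms(1) wn by simp
    then show ?thesis
      unfolding eq by (rule laurent_br_mult[OF that])
  next
    case False
    then have "R_mat q r (x z) (a, s) (a, t) = 0" for z
      by (auto simp: R_mat_def doubleton_eq_iff)
    then show ?thesis by (simp add: laurent_zero)
  qed
  have off: "laurent m (\<lambda>z. R_mat q r (x z) (a, s) (b, t) * F z)"
    if "laurent m F" "a \<noteq> b" for m a b s t F
    using laurent_scaled[OF that(1)] that(2) by (simp add: R_mat_def laurent_zero)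
  have step: "app (T_op q r w z (Suc n) a b) f \<sigma>
      = (\<Sum>c\<in>UNIV. \<Sum>s\<in>UNIV. R_mat q r (x z) (a, \<sigma> n) (c, s) * app (T_op q r w z n c b) f (\<sigma>(n := s)))" for z
    by (simp add: app_sum_left L_op_def app_site_op x_def)
  show ?case
  proof (cases "a = b")
    case ab: True
    have "laurent (Suc n) (\<lambda>z. R_mat q r (x z) (a, \<sigma> n) (c, s) * app (T_op q r w z n c b) f (\<sigma>(n := s)))" for c s
    proof (cases "c = a")
      case True
      then show ?thesis using same IH1 ab by simp
    next
      case False
      show ?thesis
      proof (cases n)
        case 0
        then show ?thesis using False ab by (simp add: laurent_zero)
      next
        case (Suc m)
        have "laurent m (\<lambda>z. R_mat q r (x z) (a, \<sigma> n) (c, s) * app (T_op q r w z n c b) f (\<sigma>(n := s)))"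
          using False ab Suc by (intro off IH2) auto
        then show ?thesis unfolding Suc by (rule laurent_Suc_Suc)
      qed
    qed
    then have "laurent (Suc n) (\<lambda>z. app (T_op q r w z (Suc n) a b) f \<sigma>)"
      unfolding step by (intro laurent_sum)
    then show ?thesis using ab by simp
  next
    case ab: False
    have "laurent n (\<lambda>z. R_mat q r (x z) (a, \<sigma> n) (c, s) * app (T_op q r w z n c b) f (\<sigma>(n := s)))" for c s
    proof (cases "c = b")
      case True
      then show ?thesis using off[OF IH1] ab by simp
    next
      case False
      show ?thesis
      proof (cases n)
        case 0
        then show ?thesis using False by (simp add: laurent_zero)
      next
        case (Suc m)
        have "c = a" using False ab by (metis aux.exhaust)
        then show ?thesis using same[OF IH2[OF Suc]] False Suc by simp
      qed
    qed
    then have "laurent n (\<lambda>z. app (T_op q r w z (Suc n) a b) f \<sigma>)"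
      unfolding step by (intro laurent_sum)
    then show ?thesis using ab by simp
  qed
qed

lemma T_laurent:
  assumes "q \<noteq> 0" "\<And>i. i < n \<Longrightarrow> w i \<noteq> 0"
  shows "laurent n (\<lambda>z. app (T_op q r w z n a a) f \<sigma>)"
    and "a \<noteq> b \<Longrightarrow> 0 < n \<Longrightarrow> laurent (n - 1) (\<lambda>z. app (T_op q r w z n a b) f \<sigma>)"
  using T_laurent_aux[of q n w a a, OF assms] T_laurent_aux[of q n w a b, OF assms]
  by (cases n; simp)+

section \<open>Eigenvectors of the diagonal monodromy entry\<close>

lemma scalar_commute2: "X * (Y * scalar c) = scalar c * (X * Y)"
  using scalar_commute[of "X * Y" c] by (simp add: mult.assoc)

lemma br_eq_0_iff: "x \<noteq> 0 \<Longrightarrow> br x = 0 \<longleftrightarrow> x\<^sup>2 = 1"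
  by (simp add: br_def field_simps power2_eq_square)

lemma br_inverse: "br (inverse x) = - br x"
  by (simp add: br_def)

locale chain =
  fixes N :: nat and q r :: complex and w :: "nat \<Rightarrow> complex"
  assumes q: "q \<noteq> 0" and w: "\<And>i. i < N \<Longrightarrow> w i \<noteq> 0"
    and r: "r\<^sup>2 = br q * br (q\<^sup>2)" and brq2: "br (q\<^sup>2) \<noteq> 0"
begin

abbreviation "opB z \<equiv> T_op q r w z N Aux_Up Aux_Down"
abbreviation "opC z \<equiv> T_op q r w z N Aux_Down Aux_Up"
abbreviation "opD z \<equiv> T_op q r w z N Aux_Down Aux_Down"

lemma exchange:
  assumes "x \<noteq> 0" "y \<noteq> 0"
  shows "(\<Sum>c\<in>UNIV. \<Sum>d\<in>UNIV. scalar (six_vertex q (x / y) a b c d) * (T_op q r w x N c e * T_op q r w y N d f))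
    = (\<Sum>c\<in>UNIV. \<Sum>d\<in>UNIV. T_op q r w y N b d * T_op q r w x N a c * scalar (six_vertex q (x / y) c d e f))"
  using T_RTT[OF q assms r, of N w] w unfolding RTT_def by blast

text \<open>The exchange relation gives this times \<open>[q x / y]\<close>. If that factor
  vanishes, the relation with \<open>x\<close> and \<open>y\<close> swapped is used: both factors
  vanishing would give \<open>q^4 = 1\<close>, against \<open>brq2\<close>.\<close>

lemma opB_commute:
  assumes "x \<noteq> 0" "y \<noteq> 0"
  shows "opB x * opB y = opB y * opB x"
proof -
  have *: "opB x * opB y = opB y * opB x" if "x \<noteq> 0" "y \<noteq> 0" "br (q * (x / y)) \<noteq> 0" for x y
  proof -
    have "scalar (br (q * (x / y))) * (opB x * opB y) = scalar (br (q * (x / y))) * (opB y * opB x)"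
      using exchange[OF that(1,2), of Aux_Up Aux_Up Aux_Down Aux_Down]
      by (simp add: sum_UNIV_aux six_vertex_def scalar_simps scalar_commute[of "opB y * opB x"])
    then have "scalar (inverse (br (q * (x / y)))) * (scalar (br (q * (x / y))) * (opB x * opB y))
        = scalar (inverse (br (q * (x / y)))) * (scalar (br (q * (x / y))) * (opB y * opB x))"
      by simp
    then have "scalar (inverse (br (q * (x / y))) * br (q * (x / y))) * (opB x * opB y)
        = scalar (inverse (br (q * (x / y))) * br (q * (x / y))) * (opB y * opB x)"
      by (simp only: scalar_simps(5) mult.assoc)
    moreover have "inverse (br (q * (x / y))) * br (q * (x / y)) = 1"
      using that(3) by simp
    ultimately show ?thesis by (simp only: scalar_simps mult_1)
  qed
  show ?thesis
  proof (cases "br (q * (x / y)) = 0")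
    case False
    then show ?thesis using * assms by blast
  next
    case True
    have "br (q * (y / x)) \<noteq> 0"
    proof
      assume "br (q * (y / x)) = 0"
      then have "(q * (y / x))\<^sup>2 * (q * (x / y))\<^sup>2 = 1"
        using True assms q by (simp add: br_eq_0_iff)
      then have "(q\<^sup>2)\<^sup>2 = 1" using assms by (simp add: power2_eq_square field_simps)
      then show False using brq2 q by (simp add: br_eq_0_iff)
    qed
    then show ?thesis using *[of y x] assms by simp
  qed
qed

text \<open>The first term on the right moves \<open>D\<close> past \<open>B\<close>. The second,
  with the arguments exchanged, disappears on vectors killed by \<open>D(u)\<close>, which is how
  \<open>u\<close> will be chosen.\<close>

lemma opD_opB:
  assumes "x \<noteq> 0" "u \<noteq> 0"
  shows "scalar (br (x / u)) * (opD x * opB u) =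
    scalar (br (q * (x / u))) * (opB u * opD x) - scalar (br q) * (opB x * opD u)"
  using exchange[OF assms, of Aux_Down Aux_Up Aux_Down Aux_Down]
  by (simp add: sum_UNIV_aux six_vertex_def scalar_simps scalar_commute2 algebra_simps)

lemma opD_opC:
  assumes "x \<noteq> 0" "u \<noteq> 0"
  shows "scalar (br (x / u)) * (opD u * opC x) =
    scalar (br (q * (x / u))) * (opC x * opD u) - scalar (br q) * (opC u * opD x)"
  using exchange[OF assms, of Aux_Down Aux_Down Aux_Up Aux_Down]
  by (simp add: sum_UNIV_aux six_vertex_def scalar_simps scalar_commute2 algebra_simps)

definition eigenvector :: "(nat \<Rightarrow> complex) \<Rightarrow> ((nat \<Rightarrow> spin) \<Rightarrow> complex) \<Rightarrow> bool" where
  "eigenvector \<xi> v \<longleftrightarrow> (\<forall>z. z \<noteq> 0 \<longrightarrow> app (opD z) v = (\<lambda>\<sigma>. (\<Prod>k<N. br (z / \<xi> k)) * v \<sigma>))"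

text \<open>
  The exchange relations carry a factor \<open>[z / u]\<close>, so that they yield the eigenvalue equation only for
  \<open>z \<noteq> \<plusminus>u\<close>.
\<close>

lemma eigenvector_extend:
  assumes "u \<noteq> 0" "\<And>k. k < N \<Longrightarrow> \<xi> k \<noteq> 0"
    and *: "\<And>z. z \<noteq> 0 \<Longrightarrow> br (z / u) \<noteq> 0 \<Longrightarrow> app (opD z) v = (\<lambda>\<sigma>. (\<Prod>k<N. br (z / \<xi> k)) * v \<sigma>)"
  shows "eigenvector \<xi> v"
proof -
  have "app (opD z) v \<sigma> - v \<sigma> * (\<Prod>k<N. br (inverse (\<xi> k) * z)) = 0" if "z \<noteq> 0" for z \<sigma>
  proof (rule laurent_eq_zero[where A = "{z. z \<noteq> 0 \<and> br (z / u) \<noteq> 0}" and n = N and z = z])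
    show "laurent N (\<lambda>z. app (opD z) v \<sigma> - v \<sigma> * (\<Prod>k<N. br (inverse (\<xi> k) * z)))"
      using laurent_prod_br[of "{..<N}" "\<lambda>k. inverse (\<xi> k)"] q w assms(2)
      by (intro laurent_diff laurent_scaled T_laurent) auto
    \<comment> \<open>Every integer from 2 on, except possibly \<open>u^2\<close>, is the square of
      an admissible point.\<close>
    have "infinite (of_nat ` {2..} :: complex set)"
      by (subst finite_image_iff) (auto simp: inj_on_def infinite_Ici)
    moreover have "(of_nat ` {2..} :: complex set) \<subseteq> insert (u\<^sup>2) ((\<lambda>z. z\<^sup>2) ` {z. z \<noteq> 0 \<and> br (z / u) \<noteq> 0})"
    proof
      fix x :: complex assume "x \<in> of_nat ` {2..}"
      then have x: "x \<noteq> 0" by auto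
      have "br (csqrt x / u) \<noteq> 0" if "x \<noteq> u\<^sup>2"
        using that x assms(1) by (simp add: br_eq_0_iff power_divide)
      then show "x \<in> insert (u\<^sup>2) ((\<lambda>z. z\<^sup>2) ` {z. z \<noteq> 0 \<and> br (z / u) \<noteq> 0})"
        using x by (auto intro!: image_eqI[of _ _ "csqrt x"])
    qed
    ultimately show "N < card ((\<lambda>z. z\<^sup>2) ` {z. z \<noteq> 0 \<and> br (z / u) \<noteq> 0})
        \<or> infinite ((\<lambda>z. z\<^sup>2) ` {z. z \<noteq> 0 \<and> br (z / u) \<noteq> 0})"
      by (meson finite_insert finite_subset)
  qed (use that * in \<open>auto simp: field_simps\<close>)
  then show ?thesis
    unfolding eigenvector_def by (auto simp: field_simps fun_eq_iff)
qed

text \<open>Cross-multiplied, as \<open>g (\<xi> j)\<close> may vanish.\<close>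

lemma prod_update:
  fixes g :: "complex \<Rightarrow> complex"
  assumes "j < N"
  shows "(\<Prod>k<N. g ((\<xi>(j := u)) k)) * g (\<xi> j) = (\<Prod>k<N. g (\<xi> k)) * g u"
proof -
  have "(\<Prod>k<N. g ((\<xi>(j := u)) k)) = g u * (\<Prod>k\<in>{..<N} - {j}. g (\<xi> k))"
    using assms by (subst prod.remove[of _ j]) (auto intro!: prod.cong)
  moreover have "(\<Prod>k<N. g (\<xi> k)) = g (\<xi> j) * (\<Prod>k\<in>{..<N} - {j}. g (\<xi> k))"
    using assms by (subst prod.remove[of _ j]) auto
  ultimately show ?thesis by simp
qed

lemma eigenvector_zero:
  assumes "eigenvector \<xi> v" "j < N" "\<xi> j \<noteq> 0"
  shows "app (opD (\<xi> j)) v = (\<lambda>_. 0)"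
proof -
  have "(\<Prod>k<N. br (\<xi> j / \<xi> k)) = 0"
    using assms(2,3) by (intro prod_zero bexI[of _ j]) (auto simp: br_def)
  moreover have "app (opD (\<xi> j)) v = (\<lambda>\<sigma>. (\<Prod>k<N. br (\<xi> j / \<xi> k)) * v \<sigma>)"
    using assms unfolding eigenvector_def by blast
  ultimately show ?thesis by (simp only: mult_zero_left)
qed

text \<open>\<open>D(\<xi> j)\<close> kills \<open>v\<close>, so only the wanted term of the
  exchange relation survives. Its factor \<open>[q z / \<xi> j] / [z / \<xi> j]\<close> replaces the
  zero \<open>\<xi> j\<close> of the eigenvalue by \<open>\<xi> j / q\<close>.\<close>

lemma eigenvector_opB:
  assumes v: "eigenvector \<xi> v" and j: "j < N" and \<xi>: "\<And>k. k < N \<Longrightarrow> \<xi> k \<noteq> 0"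
  shows "eigenvector (\<xi>(j := \<xi> j / q)) (app (opB (\<xi> j)) v)"
proof (rule eigenvector_extend[of "\<xi> j"])
  fix z assume z: "z \<noteq> 0" "br (z / \<xi> j) \<noteq> 0"
  show "app (opD z) (app (opB (\<xi> j)) v) = (\<lambda>\<sigma>. (\<Prod>k<N. br (z / (\<xi>(j := \<xi> j / q)) k)) * app (opB (\<xi> j)) v \<sigma>)"
  proof
    fix \<sigma>
    have "app (scalar (br (z / \<xi> j)) * (opD z * opB (\<xi> j))) v \<sigma>
        = app (scalar (br (q * (z / \<xi> j))) * (opB (\<xi> j) * opD z) - scalar (br q) * (opB z * opD (\<xi> j))) v \<sigma>"
      using z \<xi> j by (subst opD_opB) auto
    then have "br (z / \<xi> j) * app (opD z) (app (opB (\<xi> j)) v) \<sigma>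
        = br (q * (z / \<xi> j)) * ((\<Prod>k<N. br (z / \<xi> k)) * app (opB (\<xi> j)) v \<sigma>)"
      using v z eigenvector_zero[OF v j \<xi>[OF j]] by (simp add: eigenvector_def app_scaled app_zero)
    also have "\<dots> = br (z / \<xi> j) * ((\<Prod>k<N. br (z / (\<xi>(j := \<xi> j / q)) k)) * app (opB (\<xi> j)) v \<sigma>)"
      using prod_update[OF j, of "\<lambda>x. br (z / x)" \<xi> "\<xi> j / q"] by (simp add: mult_ac)
    finally show "app (opD z) (app (opB (\<xi> j)) v) \<sigma> = (\<Prod>k<N. br (z / (\<xi>(j := \<xi> j / q)) k)) * app (opB (\<xi> j)) v \<sigma>"
      using z by simp
  qed
qed (use q \<xi> j in auto)

text \<open>Mirror image of \<open>eigenvector_opB\<close>: the factor is now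
  \<open>[z / (q \<xi> j)] / [z / \<xi> j]\<close>, and the zero moves in the opposite
  direction.\<close>

lemma eigenvector_opC:
  assumes v: "eigenvector \<xi> v" and j: "j < N" and \<xi>: "\<And>k. k < N \<Longrightarrow> \<xi> k \<noteq> 0"
  shows "eigenvector (\<xi>(j := q * \<xi> j)) (app (opC (\<xi> j)) v)"
proof (rule eigenvector_extend[of "\<xi> j"])
  fix z assume z: "z \<noteq> 0" "br (z / \<xi> j) \<noteq> 0"
  have z': "br (\<xi> j / z) = - br (z / \<xi> j)"
    by (simp add: br_def)
  show "app (opD z) (app (opC (\<xi> j)) v) = (\<lambda>\<sigma>. (\<Prod>k<N. br (z / (\<xi>(j := q * \<xi> j)) k)) * app (opC (\<xi> j)) v \<sigma>)"
  proof
    fix \<sigma>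
    have "app (scalar (br (\<xi> j / z)) * (opD z * opC (\<xi> j))) v \<sigma>
        = app (scalar (br (q * (\<xi> j / z))) * (opC (\<xi> j) * opD z) - scalar (br q) * (opC z * opD (\<xi> j))) v \<sigma>"
      using z \<xi> j by (subst opD_opC) auto
    then have "br (\<xi> j / z) * app (opD z) (app (opC (\<xi> j)) v) \<sigma>
        = br (q * (\<xi> j / z)) * ((\<Prod>k<N. br (z / \<xi> k)) * app (opC (\<xi> j)) v \<sigma>)"
      using v z eigenvector_zero[OF v j \<xi>[OF j]] by (simp add: eigenvector_def app_scaled app_zero)
    also have "br (q * (\<xi> j / z)) = - br (z / (q * \<xi> j))"
      using br_inverse[of "z / (q * \<xi> j)"] by (simp add: field_simps)
    also have "- br (z / (q * \<xi> j)) * ((\<Prod>k<N. br (z / \<xi> k)) * app (opC (\<xi> j)) v \<sigma>)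
        = br (\<xi> j / z) * ((\<Prod>k<N. br (z / (\<xi>(j := q * \<xi> j)) k)) * app (opC (\<xi> j)) v \<sigma>)"
      unfolding z' using prod_update[OF j, of "\<lambda>x. br (z / x)" \<xi> "q * \<xi> j"] by (simp add: mult_ac)
    finally show "app (opD z) (app (opC (\<xi> j)) v) \<sigma> = (\<Prod>k<N. br (z / (\<xi>(j := q * \<xi> j)) k)) * app (opC (\<xi> j)) v \<sigma>"
      using z z' by simp
  qed
qed (use q \<xi> j in auto)

text \<open>The quantum determinant at \<open>z = \<xi> j\<close>, where its summand
  \<open>A(z / q) D(z)\<close> vanishes on \<open>v\<close>.\<close>

lemma opC_opB:
  assumes "eigenvector \<xi> v" "j < N" "\<xi> j \<noteq> 0"
  shows "app (opC (\<xi> j / q)) (app (opB (\<xi> j)) v) = (\<lambda>\<sigma>. - qdet q w N (\<xi> j) * v \<sigma>)"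
proof
  fix \<sigma>
  have "app (T_op q r w (\<xi> j / q) N Aux_Up Aux_Up * opD (\<xi> j) - opC (\<xi> j / q) * opB (\<xi> j)) v \<sigma>
      = app (scalar (qdet q w N (\<xi> j))) v \<sigma>"
    by (subst T_quantum_det[OF q assms(3) r w]) auto
  then show "app (opC (\<xi> j / q)) (app (opB (\<xi> j)) v) \<sigma> = - qdet q w N (\<xi> j) * v \<sigma>"
    using eigenvector_zero[OF assms] by (simp add: app_zero algebra_simps minus_equation_iff)
qed

definition vac :: "(nat \<Rightarrow> spin) \<Rightarrow> complex" where
  "vac \<sigma> = (if \<forall>i<N. \<sigma> i = Spin_Up then 1 else 0)"

lemma vac_upd: "i < N \<Longrightarrow> s \<noteq> Spin_Up \<Longrightarrow> vac (\<sigma>(i := s)) = 0"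
  by (auto simp: vac_def)

lemma eigenvector_vac: "eigenvector (\<lambda>k. q * w k) vac"
proof -
  have "app (T_op q r w z n Aux_Down Aux_Down) vac = (\<lambda>\<sigma>. (\<Prod>k<n. br (z / (q * w k))) * vac \<sigma>)"
    if "n \<le> N" for n z
    using that
  proof (induction n)
    case (Suc n)
    define x where "x = inverse q * z / w n"
    have C: "app (L_op q r n x Aux_Down Aux_Up) vac = (\<lambda>_. 0)"
      using Suc.prems
      by (intro ext) (simp add: L_op_def app_site_op sum_UNIV_spin vac_upd R_mat_def doubleton_eq_iff)
    have D: "app (L_op q r n x Aux_Down Aux_Down) vac = (\<lambda>\<sigma>. br x * vac \<sigma>)"
    proof
      fix \<sigma> :: "nat \<Rightarrow> spin"
      have "\<sigma> n \<noteq> Spin_Up \<Longrightarrow> vac \<sigma> = 0" using Suc.prems by (auto simp: vac_def intro: exI[of _ n])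
      then show "app (L_op q r n x Aux_Down Aux_Down) vac \<sigma> = br x * vac \<sigma>"
        using Suc.prems
        by (cases "\<sigma> n") (simp_all add: L_op_def app_site_op sum_UNIV_spin vac_upd R_mat_def doubleton_eq_iff fun_upd_idem)
    qed
    have "app (T_op q r w z (Suc n) Aux_Down Aux_Down) vac
       = (\<lambda>\<sigma>. app (L_op q r n x Aux_Down Aux_Up * T_op q r w z n Aux_Up Aux_Down) vac \<sigma>
          + app (L_op q r n x Aux_Down Aux_Down * T_op q r w z n Aux_Down Aux_Down) vac \<sigma>)"
      by (intro ext) (simp add: sum_UNIV_aux x_def)
    \<comment> \<open>The factor of site \<open>n\<close> commutes with those of the earlier sites
      and so can act on \<open>vac\<close> first, where its \<open>Down, Up\<close> entry gives
      0.\<close>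
    also have "\<dots> = (\<lambda>\<sigma>. br x * ((\<Prod>k<n. br (z / (q * w k))) * vac \<sigma>))"
      using Suc by (simp add: L_T_commute C D app_zero app_scaled)
    also have "x = z / (q * w n)" using q by (simp add: x_def field_simps)
    finally show ?case by (simp add: mult_ac)
  qed simp
  then show ?thesis by (simp add: eigenvector_def)
qed

section \<open>The separated states and the action of B and C on them\<close>

definition xi :: "nat \<Rightarrow> nat \<Rightarrow> complex" where
  "xi j m = q * w j / q ^ m"

lemma xi_0: "xi j 0 = q * w j"
  by (simp add: xi_def)

lemma xi_Suc: "xi j (Suc m) = xi j m / q"
  by (simp add: xi_def)

lemma xi_nonzero: "j < N \<Longrightarrow> xi j m \<noteq> 0"
  using q w by (simp add: xi_def)

primrec raise :: "nat \<Rightarrow> nat \<Rightarrow> (nat \<Rightarrow> spin) oper" where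
  "raise j 0 = 1"
| "raise j (Suc m) = opB (xi j m) * raise j m"

primrec raise_upto :: "(nat \<Rightarrow> nat) \<Rightarrow> nat \<Rightarrow> (nat \<Rightarrow> spin) oper" where
  "raise_upto h 0 = 1"
| "raise_upto h (Suc n) = raise n (h n) * raise_upto h n"

definition sov :: "(nat \<Rightarrow> nat) \<Rightarrow> (nat \<Rightarrow> spin) \<Rightarrow> complex" where
  "sov h = app (raise_upto h N) vac"

lemma raise_opB_commute: "j < N \<Longrightarrow> u \<noteq> 0 \<Longrightarrow> raise j m * opB u = opB u * raise j m"
proof (induction m)
  case (Suc m)
  have "raise j (Suc m) * opB u = opB (xi j m) * (opB u * raise j m)"
    using Suc by (simp add: mult.assoc)
  also have "\<dots> = opB u * raise j (Suc m)"
    using opB_commute[of "xi j m" u] xi_nonzero[of j m] Suc.prems by (simp add: mult.assoc[symmetric])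
  finally show ?case .
qed simp

lemma raise_upto_cong: "(\<And>k. k < n \<Longrightarrow> h k = h' k) \<Longrightarrow> raise_upto h n = raise_upto h' n"
  by (induction n) auto

text \<open>The new factor arises inside the block of site \<open>j\<close>; commutativity of the
  \<open>opB\<close> brings it to the front.\<close>

lemma raise_upto_upd:
  "n \<le> N \<Longrightarrow> j < n \<Longrightarrow> raise_upto (h(j := Suc (h j))) n = opB (xi j (h j)) * raise_upto h n"
proof (induction n)
  case (Suc n)
  show ?case
  proof (cases "j = n")
    case True
    have "raise_upto (h(n := Suc (h n))) n = raise_upto h n"
      by (rule raise_upto_cong) simp
    then show ?thesis unfolding True by (simp only: raise_upto.simps raise.simps fun_upd_same mult.assoc)
  next
    case False
    have IH: "raise_upto (h(j := Suc (h j))) n = opB (xi j (h j)) * raise_upto h n"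
      using Suc.prems False by (intro Suc.IH) auto
    have "raise_upto (h(j := Suc (h j))) (Suc n) = raise n (h n) * opB (xi j (h j)) * raise_upto h n"
      unfolding raise_upto.simps IH using False by (simp add: mult.assoc)
    also have "raise n (h n) * opB (xi j (h j)) = opB (xi j (h j)) * raise n (h n)"
      using Suc.prems xi_nonzero by (intro raise_opB_commute) auto
    finally show ?thesis by (simp add: mult.assoc)
  qed
qed simp

lemma sov_cong: "(\<And>k. k < N \<Longrightarrow> h k = h' k) \<Longrightarrow> sov h = sov h'"
  unfolding sov_def using raise_upto_cong[of N h h'] by simp

lemma sov_zero: "(\<And>k. k < N \<Longrightarrow> h k = 0) \<Longrightarrow> sov h = vac"
proof -
  assume "\<And>k. k < N \<Longrightarrow> h k = 0"
  then have "sov h = sov (\<lambda>_. 0)" by (rule sov_cong)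
  moreover have "raise_upto (\<lambda>_. 0) n = 1" for n by (induction n) auto
  ultimately show "sov h = vac" by (simp add: sov_def)
qed

lemma opB_sov: "j < N \<Longrightarrow> app (opB (xi j (h j))) (sov h) = sov (h(j := Suc (h j)))"
  by (simp add: sov_def raise_upto_upd)

lemma level_induct [case_names zero Suc]:
  assumes "\<And>h. (\<And>k. k < N \<Longrightarrow> h k = 0) \<Longrightarrow> P h"
    and "\<And>h j. j < N \<Longrightarrow> P h \<Longrightarrow> P (h(j := Suc (h j)))"
  shows "P (h :: nat \<Rightarrow> nat)"
proof (induction "\<Sum>k<N. h k" arbitrary: h)
  case 0
  then show ?case using assms(1) by simp
next
  case (Suc m)
  then obtain j where j: "j < N" "h j \<noteq> 0"
    by (metis lessThan_iff nat.distinct(1) sum.neutral)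
  define h' where "h' = h(j := h j - 1)"
  have h: "h = h'(j := Suc (h' j))" using j by (simp add: h'_def)
  have "(\<Sum>k<N. h k) = Suc (\<Sum>k<N. h' k)"
    using j by (simp add: h'_def sum.remove[of "{..<N}" j])
  then have "P h'" using Suc by simp
  then show ?case using assms(2)[OF j(1)] h by metis
qed

lemma eigenvector_cong:
  "eigenvector \<xi> v \<Longrightarrow> (\<And>k. k < N \<Longrightarrow> \<xi> k = \<xi>' k) \<Longrightarrow> eigenvector \<xi>' v"
  by (simp add: eigenvector_def)

lemma eigenvector_sov: "eigenvector (\<lambda>k. xi k (h k)) (sov h)"
proof (induction h rule: level_induct)
  case (zero h)
  then show ?case using eigenvector_cong[OF eigenvector_vac] by (simp add: sov_zero xi_0)
next
  case (Suc h j)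
  have "eigenvector ((\<lambda>k. xi k (h k))(j := xi j (h j) / q)) (app (opB (xi j (h j))) (sov h))"
    by (rule eigenvector_opB[OF Suc(2,1)]) (rule xi_nonzero)
  then show ?case
    unfolding opB_sov[OF Suc(1)] by (rule eigenvector_cong) (simp add: xi_Suc)
qed

text \<open>This is \<open>opC_opB\<close> applied one level lower: the zero there is
  \<open>xi j m\<close>, and \<open>xi j m / q\<close> is the present
  \<open>xi j (h j)\<close>.\<close>

lemma opC_sov:
  assumes "j < N" "h j = Suc m"
  shows "app (opC (xi j (h j))) (sov h) = (\<lambda>\<sigma>. - qdet q w N (xi j m) * sov (h(j := m)) \<sigma>)"
  using opC_opB[OF eigenvector_sov[of "h(j := m)"] assms(1)] opB_sov[OF assms(1), of "h(j := m)"]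
    xi_nonzero[OF assms(1)] assms by (simp add: xi_Suc fun_upd_idem)

end

section \<open>The separated basis\<close>

text \<open>An injective square matrix has a two-sided inverse. Both sides are used: the first
  identity expands functions in the separated basis, the second produces covectors with prescribed
  values on it.\<close>

lemma square_system_inverse:
  fixes K :: "'i \<Rightarrow> 'j \<Rightarrow> complex"
  assumes fin: "finite I" "finite J" "card I = card J"
    and inj: "\<And>c. (\<And>i. i \<in> I \<Longrightarrow> (\<Sum>j\<in>J. c j * K i j) = 0) \<Longrightarrow> (\<And>j. j \<in> J \<Longrightarrow> c j = 0)"
  obtains L where
    "\<And>i i'. i \<in> I \<Longrightarrow> i' \<in> I \<Longrightarrow> (\<Sum>j\<in>J. K i j * L j i') = (if i = i' then 1 else 0)"
    "\<And>j j'. j \<in> J \<Longrightarrow> j' \<in> J \<Longrightarrow> (\<Sum>i\<in>I. L j i * K i j') = (if j = j' then 1 else 0)"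
proof -
  define n where "n = card I"
  obtain f where f: "bij_betw f {0..<n} I"
    using ex_bij_betw_nat_finite[OF fin(1)] n_def by blast
  obtain g where g: "bij_betw g {0..<n} J"
    using ex_bij_betw_nat_finite[OF fin(2)] n_def fin(3) by metis
  define f' where "f' = inv_into {0..<n} f"
  define g' where "g' = inv_into {0..<n} g"
  have f': "i \<in> I \<Longrightarrow> f' i < n" "i \<in> I \<Longrightarrow> f (f' i) = i" "a < n \<Longrightarrow> f' (f a) = a" "a < n \<Longrightarrow> f a \<in> I" for i a
    using f bij_betw_inv_into[OF f] unfolding f'_def
    by (auto simp: bij_betw_inv_into_right bij_betw_inv_into_left dest: bij_betwE)
  have g': "j \<in> J \<Longrightarrow> g' j < n" "j \<in> J \<Longrightarrow> g (g' j) = j" "a < n \<Longrightarrow> g' (g a) = a" "a < n \<Longrightarrow> g a \<in> J" for j a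
    using g bij_betw_inv_into[OF g] unfolding g'_def
    by (auto simp: bij_betw_inv_into_right bij_betw_inv_into_left dest: bij_betwE)
  define A where "A = mat n n (\<lambda>(a, b). K (f a) (g b))"
  have A: "A \<in> carrier_mat n n" by (simp add: A_def)
  have "det A \<noteq> 0"
  proof
    assume "det A = 0"
    then obtain v where v: "v \<in> carrier_vec n" "v \<noteq> 0\<^sub>v n" "A *\<^sub>v v = 0\<^sub>v n"
      using det_0_iff_vec_prod_zero[OF A] by blast
    have "(\<Sum>j\<in>J. v $ g' j * K i j) = 0" if "i \<in> I" for i
    proof -
      have "(\<Sum>j\<in>J. v $ g' j * K i j) = (\<Sum>b\<in>{0..<n}. v $ b * K i (g b))"
        by (rule sum.reindex_bij_betw[OF g, symmetric, THEN trans]) (auto simp: g' intro!: sum.cong)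
      also have "\<dots> = (A *\<^sub>v v) $ f' i"
        using v(1) f'(1,2)[OF that] by (auto simp: A_def scalar_prod_def mult.commute intro!: sum.cong)
      finally show ?thesis using v f'(1)[OF that] by simp
    qed
    then have "v $ g' j = 0" if "j \<in> J" for j
      using inj[of "\<lambda>j. v $ g' j"] that by blast
    then have "v $ a = 0" if "a < n" for a
      using g'(3,4) that by metis
    then show False using v by (auto intro: eq_vecI)
  qed
  then obtain B where B: "B \<in> carrier_mat n n" "A * B = 1\<^sub>m n" "B * A = 1\<^sub>m n"
    using det_non_zero_imp_unit[OF A] by (auto simp: Units_def ring_mat_def)
  define L where "L j i = B $$ (g' j, f' i)" for j i
  show ?thesis
  proof (rule that[of L])
    fix i i' assume i: "i \<in> I" "i' \<in> I"
    have "(\<Sum>j\<in>J. K i j * L j i') = (\<Sum>b\<in>{0..<n}. K i (g b) * L (g b) i')"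
      by (rule sum.reindex_bij_betw[OF g, symmetric])
    also have "\<dots> = (A * B) $$ (f' i, f' i')"
      using i f' B(1) by (auto simp: A_def L_def g' scalar_prod_def intro!: sum.cong)
    also have "\<dots> = (if i = i' then 1 else 0)"
      using i f' unfolding B(2) by (metis index_one_mat(1))
    finally show "(\<Sum>j\<in>J. K i j * L j i') = (if i = i' then 1 else 0)" .
  next
    fix j j' assume j: "j \<in> J" "j' \<in> J"
    have "(\<Sum>i\<in>I. L j i * K i j') = (\<Sum>a\<in>{0..<n}. L j (f a) * K (f a) j')"
      by (rule sum.reindex_bij_betw[OF f, symmetric])
    also have "\<dots> = (B * A) $$ (g' j, g' j')"
      using j g' B(1) by (auto simp: A_def L_def f' scalar_prod_def intro!: sum.cong)
    also have "\<dots> = (if j = j' then 1 else 0)"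
      using j g' unfolding B(3) by (metis index_one_mat(1))
    finally show "(\<Sum>i\<in>I. L j i * K i j') = (if j = j' then 1 else 0)" .
  qed
qed

text \<open>Applying \<open>F z - d k z\<close> to a vanishing combination removes
  \<open>v k\<close> and multiplies the coefficient of \<open>v i\<close> by
  \<open>d i z - d k z\<close>. The separating \<open>z\<close> may depend on the pair, so the step
  is done for each \<open>i\<close> on its own.\<close>

lemma eigenvectors_independent:
  assumes "finite S"
    and eig: "\<And>i z. i \<in> S \<Longrightarrow> z \<in> Z \<Longrightarrow> app (F z) (v i) = (\<lambda>x. d i z * v i x)"
    and nz: "\<And>i. i \<in> S \<Longrightarrow> v i \<noteq> (\<lambda>_. 0)"
    and dist: "\<And>i j. i \<in> S \<Longrightarrow> j \<in> S \<Longrightarrow> i \<noteq> j \<Longrightarrow> \<exists>z\<in>Z. d i z \<noteq> d j z"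
    and zero: "\<And>x. (\<Sum>i\<in>S. c i * v i x) = 0"
    and "i \<in> S"
  shows "c i = 0"
  using assms
proof (induction S arbitrary: c i rule: finite_induct)
  case (insert k S)
  have fin: "finite S" and k: "k \<notin> S" by fact+
  have *: "c i = 0" if i: "i \<in> S" for i
  proof -
    obtain z where z: "z \<in> Z" "d i z \<noteq> d k z"
      using insert.prems(3)[of i k] i k by auto
    have "(\<Sum>i\<in>S. (c i * (d i z - d k z)) * v i x) = 0" for x
    proof -
      have "(\<Sum>i\<in>insert k S. c i * (d i z * v i x)) = app (F z) (\<lambda>x. \<Sum>i\<in>insert k S. c i * v i x) x"
        unfolding app_sum using insert.prems(1) z by (intro sum.cong) auto
      also have "\<dots> = 0" unfolding insert.prems(4) by (simp add: app_zero)
      finally have "(\<Sum>i\<in>insert k S. c i * (d i z * v i x)) - d k z * (\<Sum>i\<in>insert k S. c i * v i x) = 0"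
        using insert.prems(4) by simp
      then show ?thesis
        using fin k by (simp add: sum_subtractf sum_distrib_left algebra_simps)
    qed
    then have "c i * (d i z - d k z) = 0"
      using insert.prems i by (intro insert.IH[where c = "\<lambda>i. c i * (d i z - d k z)"]) auto
    then show ?thesis using z by simp
  qed
  have "c k * v k x = 0" for x
    using insert.prems(4)[of x] fin k * by simp
  moreover obtain x where "v k x \<noteq> 0" using insert.prems(2)[of k] by auto
  ultimately have "c k = 0" by (metis mult_eq_0_iff)
  then show ?case using * insert.prems(5) by auto
qed auto

section \<open>Functions of finitely many sites, and conservation of the magnetisation\<close>

definition depends_upto :: "nat \<Rightarrow> ((nat \<Rightarrow> spin) \<Rightarrow> complex) \<Rightarrow> bool" where
  "depends_upto N f \<longleftrightarrow> (\<forall>\<sigma> \<tau>. (\<forall>i<N. \<sigma> i = \<tau> i) \<longrightarrow> f \<sigma> = f \<tau>)"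

lemma depends_uptoD: "depends_upto N f \<Longrightarrow> (\<And>i. i < N \<Longrightarrow> \<sigma> i = \<tau> i) \<Longrightarrow> f \<sigma> = f \<tau>"
  unfolding depends_upto_def by blast

lemma depends_upto_sum: "(\<And>i. i \<in> I \<Longrightarrow> depends_upto N (f i)) \<Longrightarrow> depends_upto N (\<lambda>\<sigma>. \<Sum>i\<in>I. c i * f i \<sigma>)"
  by (auto simp: depends_upto_def intro!: sum.cong)

text \<open>The functions of the first \<open>N\<close> sites form a model of the tensor power, of
  dimension \<open>3^N\<close>; the operators preserve it.\<close>

lemma depends_upto_T: "n \<le> N \<Longrightarrow> depends_upto N f \<Longrightarrow> depends_upto N (app (T_op q r w z n a b) f)"
proof (induction n arbitrary: a b)
  case (Suc n)
  show ?case
    unfolding depends_upto_def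
  proof (intro allI impI)
    fix \<sigma> \<tau> :: "nat \<Rightarrow> spin"
    assume \<sigma>: "\<forall>i<N. \<sigma> i = \<tau> i"
    have "app (T_op q r w z n c b) f (\<sigma>(n := s)) = app (T_op q r w z n c b) f (\<tau>(n := s))" for c s
      using Suc \<sigma> by (intro depends_uptoD[of N]) auto
    moreover have "\<sigma> n = \<tau> n" using \<sigma> Suc.prems by simp
    ultimately show "app (T_op q r w z (Suc n) a b) f \<sigma> = app (T_op q r w z (Suc n) a b) f \<tau>"
      by (simp add: app_sum_left L_op_def app_site_op)
  qed
qed (auto simp: depends_upto_def)

text \<open>Only differences matter; the values 1 and 0 in place of 1/2 and -1/2 keep everything
  integral.\<close>

definition aux3 :: "aux \<Rightarrow> int" where
  "aux3 a = (case a of Aux_Up \<Rightarrow> 1 | Aux_Down \<Rightarrow> 0)"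

lemma R_mat_conserves: "R_mat q r z (a, s) (b, t) \<noteq> 0 \<Longrightarrow> aux3 a + spin3 s = aux3 b + spin3 t"
  by (cases a; cases b; cases s; cases t) (simp_all add: R_mat_def aux3_def doubleton_eq_iff)

text \<open>Each R-matrix conserves the total of auxiliary and site spin. For the entry
  \<open>Up, Down\<close> this says that \<open>B\<close> lowers the magnetisation by one.\<close>

lemma T_op_conserves:
  assumes f: "\<And>\<sigma>. f \<sigma> \<noteq> 0 \<Longrightarrow> (\<Sum>i<N. spin3 (\<sigma> i)) = m" and "n \<le> N"
    and "app (T_op q r w z n a b) f \<sigma> \<noteq> 0"
  shows "aux3 a + (\<Sum>i<N. spin3 (\<sigma> i)) = aux3 b + m"
  using assms(2,3)
proof (induction n arbitrary: a \<sigma>)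
  case 0
  then show ?case using f by (auto split: if_splits)
next
  case (Suc n)
  let ?G = "\<lambda>c s. R_mat q r (inverse q * z / w n) (a, \<sigma> n) (c, s) * app (T_op q r w z n c b) f (\<sigma>(n := s))"
  have "(\<Sum>c\<in>UNIV. \<Sum>s\<in>UNIV. ?G c s) \<noteq> 0"
    using Suc.prems(2) by (simp add: app_sum_left L_op_def app_site_op)
  then obtain c where "(\<Sum>s\<in>UNIV. ?G c s) \<noteq> 0"
    by (rule sum.not_neutral_contains_not_neutral)
  then obtain s where "?G c s \<noteq> 0"
    by (rule sum.not_neutral_contains_not_neutral)
  then have s: "R_mat q r (inverse q * z / w n) (a, \<sigma> n) (c, s) \<noteq> 0"
      "app (T_op q r w z n c b) f (\<sigma>(n := s)) \<noteq> 0"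
    by auto
  have "aux3 c + (\<Sum>i<N. spin3 ((\<sigma>(n := s)) i)) = aux3 b + m"
    using Suc.IH[OF _ s(2)] Suc.prems by simp
  moreover have "(\<Sum>i<N. spin3 ((\<sigma>(n := s)) i)) = spin3 s + (\<Sum>i\<in>{..<N} - {n}. spin3 (\<sigma> i))"
    using Suc.prems(1) by (subst sum.remove[of _ n]) (auto intro!: sum.cong)
  moreover have "(\<Sum>i<N. spin3 (\<sigma> i)) = spin3 (\<sigma> n) + (\<Sum>i\<in>{..<N} - {n}. spin3 (\<sigma> i))"
    using Suc.prems(1) by (subst sum.remove[of _ n]) auto
  ultimately show ?case using R_mat_conserves[OF s(1)] by simp
qed

text \<open>Padding by \<open>Spin_Up\<close> turns the all-up list into the constant configuration,
  at which vectors are normalised.\<close>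

definition cfg :: "nat \<Rightarrow> spin list \<Rightarrow> nat \<Rightarrow> spin" where
  "cfg N \<sigma> i = (if i < N then \<sigma> ! i else Spin_Up)"

lemma finite_configs: "finite (configs N)"
  using finite_lists_length_eq[of "UNIV :: spin set" N] by (simp add: configs_def)

lemma card_configs: "card (configs N) = 3 ^ N"
proof -
  have "card (UNIV :: spin set) = 3" by (simp add: UNIV_spin)
  then show ?thesis
    using card_lists_length_eq[of "UNIV :: spin set" N] by (simp add: configs_def)
qed

text \<open>The bound 3 is attained at the ends of the ladder: \<open>m = h + 1\<close> in
  \<open>opC_sov_0\<close> and \<open>m = h - 3\<close> in \<open>sov_overflow\<close>, with
  \<open>h \<le> 2\<close>. The pair \<open>j = k\<close>, \<open>m = 0\<close> is left out because
  \<open>[1] = 0\<close>.\<close>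

locale generic_chain = chain +
  assumes N: "0 < N"
    and generic: "\<And>j k m. j < N \<Longrightarrow> k < N \<Longrightarrow> \<bar>m\<bar> \<le> 3 \<Longrightarrow> j \<noteq> k \<or> m \<noteq> 0 \<Longrightarrow> br (q powi m * w j / w k) \<noteq> 0"
begin

definition levels :: "(nat \<Rightarrow> nat) set" where
  "levels = {..<N} \<rightarrow>\<^sub>E {..2}"

lemma finite_levels: "finite levels"
  by (simp add: levels_def finite_PiE)

lemma card_levels: "card levels = 3 ^ N"
  by (simp add: levels_def card_PiE)

lemma levels_le: "h \<in> levels \<Longrightarrow> k < N \<Longrightarrow> h k \<le> 2"
  by (auto simp: levels_def)

lemma xi_powi: "xi j m = q powi (1 - int m) * w j"
  using q by (simp add: xi_def power_int_diff)

lemma xi_ratio: "xi j a / xi k b = q powi (int b - int a) * w j / w k"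
  using q by (simp add: xi_powi power_int_diff field_simps)

lemma br_xi_ratio:
  assumes "j < N" "k < N" "a \<le> 3" "b \<le> 3" "j \<noteq> k \<or> a \<noteq> b"
  shows "br (xi j a / xi k b) \<noteq> 0"
  unfolding xi_ratio using assms by (intro generic) auto

lemma qdet_xi: "qdet q w N (xi j m) = (\<Prod>k<N. br (q powi (2 - int m) * w j / w k) * br (q powi (- 1 - int m) * w j / w k))"
proof -
  have "q powi (2 - int m) = q * q powi (1 - int m)" "q powi (1 - int m) = q\<^sup>2 * q powi (- 1 - int m)"
    using q power_int_add_1[of q "1 - int m"] power_int_diff[of q "1 - int m" 2] by (simp_all add: field_simps)
  then have "q * xi j m / w k = q powi (2 - int m) * w j / w k"
     "xi j m / (q\<^sup>2 * w k) = q powi (- 1 - int m) * w j / w k" for k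
    using q by (simp_all add: xi_powi)
  then show ?thesis by (simp only: qdet_def)
qed

lemma qdet_xi_nonzero: "j < N \<Longrightarrow> m \<le> 1 \<Longrightarrow> qdet q w N (xi j m) \<noteq> 0"
  unfolding qdet_xi using generic by simp

text \<open>Descending again with \<open>C\<close> returns the previous state times
  \<open>- qdet\<close>, which is non-zero as long as the level left behind is at most 1.\<close>

lemma sov_nonzero: "(\<And>k. k < N \<Longrightarrow> h k \<le> 2) \<Longrightarrow> sov h \<noteq> (\<lambda>_. 0)"
proof (induction h rule: level_induct)
  case (zero h)
  have "vac (\<lambda>_. Spin_Up) \<noteq> 0" by (simp add: vac_def)
  then show ?case using zero by (metis sov_zero)
next
  case (Suc h j)
  have h: "h k \<le> 2" if "k < N" for k
    using Suc.prems[of k] that by (auto split: if_splits)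
  have j: "h j \<le> 1" using Suc.prems[of j] Suc.hyps by simp
  from Suc.IH h obtain \<sigma> where \<sigma>: "sov h \<sigma> \<noteq> 0" by auto
  have "app (opC (xi j (Suc (h j)))) (sov (h(j := Suc (h j)))) \<sigma> = - qdet q w N (xi j (h j)) * sov h \<sigma>"
    using opC_sov[OF Suc.hyps, of "h(j := Suc (h j))"] by (simp add: fun_upd_idem)
  then show ?case using \<sigma> qdet_xi_nonzero[OF Suc.hyps j] by (auto simp: app_zero simp del: fun_upd_apply)
qed

lemma depends_upto_sov: "depends_upto N (sov h)"
proof (induction h rule: level_induct)
  case (zero h)
  then have "sov h = vac" by (rule sov_zero)
  then show ?case by (auto simp: depends_upto_def vac_def)
next
  case (Suc h j)
  show ?case unfolding opB_sov[OF Suc(1), symmetric] by (intro depends_upto_T order_refl Suc)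
qed

lemma magnetisation_sov:
  "sov h \<sigma> \<noteq> 0 \<Longrightarrow> (\<Sum>i<N. spin3 (\<sigma> i)) = int N - int (\<Sum>k<N. h k)"
proof (induction h arbitrary: \<sigma> rule: level_induct)
  case (zero h)
  then show ?case by (auto simp: sov_zero vac_def split: if_splits)
next
  case (Suc h j)
  have "aux3 Aux_Up + (\<Sum>i<N. spin3 (\<sigma> i)) = aux3 Aux_Down + (int N - int (\<Sum>k<N. h k))"
    using Suc by (intro T_op_conserves[of "sov h" N _ N q r w "xi j (h j)"]) (simp_all add: opB_sov del: fun_upd_apply)
  moreover have "(\<Sum>k<N. (h(j := Suc (h j))) k) = Suc (\<Sum>k<N. h k)"
    using Suc.hyps by (simp add: sum.remove[of "{..<N}" j])
  ultimately show ?case by (simp add: aux3_def)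
qed

lemma sov_independent:
  assumes "\<And>\<sigma>. (\<Sum>h\<in>levels. c h * sov h \<sigma>) = 0" "h \<in> levels"
  shows "c h = 0"
proof (rule eigenvectors_independent[OF finite_levels, where Z = "UNIV - {0}" and F = "\<lambda>z. opD z"
      and v = sov and d = "\<lambda>h z. \<Prod>k<N. br (z / xi k (h k))" and c = c and i = h])
  fix h h' assume h: "h \<in> levels" "h' \<in> levels" "h \<noteq> h'"
  then obtain j where j: "j < N" "h j \<noteq> h' j"
    unfolding levels_def by (metis PiE_ext lessThan_iff)
  \<comment> \<open>The point \<open>xi j (h j)\<close> is a zero of the eigenvalue of
    \<open>h\<close> but not of that of \<open>h'\<close>, so it separates the two.\<close>
  have "(\<Prod>k<N. br (xi j (h j) / xi k (h k))) = 0"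
    using j xi_nonzero[OF j(1)] by (intro prod_zero bexI[of _ j]) (auto simp: br_def)
  moreover have "br (xi j (h j) / xi k (h' k)) \<noteq> 0" if "k < N" for k
    using that j levels_le[OF h(1) j(1)] levels_le[OF h(2) that] by (intro br_xi_ratio) auto
  then have "(\<Prod>k<N. br (xi j (h j) / xi k (h' k))) \<noteq> 0" by simp
  ultimately have "(\<Prod>k<N. br (xi j (h j) / xi k (h k))) \<noteq> (\<Prod>k<N. br (xi j (h j) / xi k (h' k)))"
    by metis
  moreover have "xi j (h j) \<in> UNIV - {0}" using xi_nonzero[OF j(1)] by simp
  ultimately show "\<exists>z\<in>UNIV - {0}. (\<Prod>k<N. br (z / xi k (h k))) \<noteq> (\<Prod>k<N. br (z / xi k (h' k)))"
    by (rule bexI)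
qed (use assms eigenvector_sov sov_nonzero levels_le in \<open>auto simp: eigenvector_def\<close>)

lemma depends_upto_eqI:
  assumes "depends_upto N f" "depends_upto N g" "\<And>\<sigma>. \<sigma> \<in> configs N \<Longrightarrow> f (cfg N \<sigma>) = g (cfg N \<sigma>)"
  shows "f = g"
proof
  fix \<tau> :: "nat \<Rightarrow> spin"
  define \<sigma> where "\<sigma> = map \<tau> [0..<N]"
  have "f \<tau> = f (cfg N \<sigma>)" "g \<tau> = g (cfg N \<sigma>)"
    using assms(1,2) by (auto intro!: depends_uptoD[of N] simp: cfg_def \<sigma>_def)
  moreover have "\<sigma> \<in> configs N" by (simp add: configs_def \<sigma>_def)
  ultimately show "f \<tau> = g \<tau>" using assms(3) by simp
qed

text \<open>There are \<open>3^N\<close> independent separated states, exactly as many as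
  configurations, so the matrix of their components is square and injective.\<close>

lemma dual_basis:
  "\<exists>L. (\<forall>\<sigma>\<in>configs N. \<forall>\<sigma>'\<in>configs N.
        (\<Sum>h\<in>levels. sov h (cfg N \<sigma>) * L h \<sigma>') = (if \<sigma> = \<sigma>' then 1 else 0)) \<and>
    (\<forall>h\<in>levels. \<forall>h'\<in>levels.
        (\<Sum>\<sigma>\<in>configs N. L h \<sigma> * sov h' (cfg N \<sigma>)) = (if h = h' then 1 else 0))"
proof (rule square_system_inverse[of "configs N" levels "\<lambda>\<sigma> h. sov h (cfg N \<sigma>)"])
  fix c h assume *: "\<And>\<sigma>. \<sigma> \<in> configs N \<Longrightarrow> (\<Sum>h\<in>levels. c h * sov h (cfg N \<sigma>)) = 0" and h: "h \<in> levels"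
  have "(\<lambda>\<sigma>. \<Sum>h\<in>levels. c h * sov h \<sigma>) = (\<lambda>_. 0)"
    using * by (intro depends_upto_eqI depends_upto_sum depends_upto_sov) (auto simp: depends_upto_def)
  then have "(\<Sum>h\<in>levels. c h * sov h \<sigma>) = 0" for \<sigma>
    by (simp add: fun_eq_iff)
  then show "c h = 0" by (rule sov_independent[of c]) (rule h)
qed (blast | simp add: finite_configs card_configs finite_levels card_levels)+

lemma sov_expansion:
  assumes "depends_upto N f"
  obtains c where "f = (\<lambda>\<sigma>. \<Sum>h\<in>levels. c h * sov h \<sigma>)"
proof -
  obtain L where L: "\<forall>\<sigma>\<in>configs N. \<forall>\<sigma>'\<in>configs N.
      (\<Sum>h\<in>levels. sov h (cfg N \<sigma>) * L h \<sigma>') = (if \<sigma> = \<sigma>' then 1 else 0)"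
    using dual_basis by blast
  have "f = (\<lambda>\<sigma>. \<Sum>h\<in>levels. (\<Sum>\<sigma>'\<in>configs N. L h \<sigma>' * f (cfg N \<sigma>')) * sov h \<sigma>)"
  proof (rule depends_upto_eqI)
    fix \<sigma> assume \<sigma>: "\<sigma> \<in> configs N"
    have "(\<Sum>h\<in>levels. (\<Sum>\<sigma>'\<in>configs N. L h \<sigma>' * f (cfg N \<sigma>')) * sov h (cfg N \<sigma>))
        = (\<Sum>\<sigma>'\<in>configs N. (\<Sum>h\<in>levels. sov h (cfg N \<sigma>) * L h \<sigma>') * f (cfg N \<sigma>'))"
      by (simp add: sum_distrib_left sum_distrib_right mult_ac sum.swap[of _ levels])
    also have "\<dots> = (\<Sum>\<sigma>'\<in>configs N. (if \<sigma> = \<sigma>' then f (cfg N \<sigma>') else 0))"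
      using \<sigma> L by (intro sum.cong) auto
    also have "\<dots> = f (cfg N \<sigma>)" using \<sigma> by (simp add: finite_configs)
    finally show "f (cfg N \<sigma>) = (\<Sum>h\<in>levels. (\<Sum>\<sigma>'\<in>configs N. L h \<sigma>' * f (cfg N \<sigma>')) * sov h (cfg N \<sigma>))" ..
  qed (auto intro: assms depends_upto_sum depends_upto_sov)
  then show ?thesis by (rule that)
qed

text \<open>\<open>D(\<xi> j)\<close> annihilates \<open>f\<close>, yet multiplies every basis state
  by a non-zero number, so all coefficients of \<open>f\<close> are zero.\<close>

lemma eigenvector_vanish:
  assumes f: "depends_upto N f" and eig: "eigenvector \<xi> f" and j: "j < N" "\<xi> j \<noteq> 0"
    and nz: "\<And>h k. h \<in> levels \<Longrightarrow> k < N \<Longrightarrow> br (\<xi> j / xi k (h k)) \<noteq> 0"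
  shows "f = (\<lambda>_. 0)"
proof -
  obtain c where c: "f = (\<lambda>\<sigma>. \<Sum>h\<in>levels. c h * sov h \<sigma>)"
    using sov_expansion[OF f] .
  have "(\<Sum>h\<in>levels. (c h * (\<Prod>k<N. br (\<xi> j / xi k (h k)))) * sov h \<sigma>) = 0" for \<sigma>
  proof -
    have "0 = app (opD (\<xi> j)) f \<sigma>" using eigenvector_zero[OF eig j] by simp
    also have "\<dots> = (\<Sum>h\<in>levels. c h * app (opD (\<xi> j)) (sov h) \<sigma>)"
      unfolding c app_sum ..
    also have "\<dots> = (\<Sum>h\<in>levels. (c h * (\<Prod>k<N. br (\<xi> j / xi k (h k)))) * sov h \<sigma>)"
      using eigenvector_sov j(2) by (auto simp: eigenvector_def intro!: sum.cong)
    finally show ?thesis ..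
  qed
  then have "c h * (\<Prod>k<N. br (\<xi> j / xi k (h k))) = 0" if "h \<in> levels" for h
    using sov_independent[of "\<lambda>h. c h * (\<Prod>k<N. br (\<xi> j / xi k (h k)))"] that by blast
  moreover have "(\<Prod>k<N. br (\<xi> j / xi k (h k))) \<noteq> 0" if "h \<in> levels" for h
    using nz that by simp
  ultimately have "c h = 0" if "h \<in> levels" for h
    using that by (metis mult_eq_0_iff)
  then show ?thesis unfolding c by simp
qed

text \<open>Its eigenvalue would vanish at \<open>xi j 3 = q^(-2) w_j\<close>, where no basis
  eigenvalue does.\<close>

lemma sov_overflow:
  assumes "j < N" "h j = 3"
  shows "sov h = (\<lambda>_. 0)"
proof (rule eigenvector_vanish[OF depends_upto_sov eigenvector_sov assms(1)])
  fix h' k assume "h' \<in> levels" "k < N"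
  then show "br (xi j (h j) / xi k (h' k)) \<noteq> 0"
    using assms levels_le[of h' k] by (intro br_xi_ratio) auto
qed (use xi_nonzero assms in auto)

text \<open>Lowering from level 0 would create the zero \<open>q * xi j 0 = q^2 w_j\<close>, again
  shared by no basis state.\<close>

lemma opC_sov_0:
  assumes j: "j < N" "h j = 0"
  shows "app (opC (xi j (h j))) (sov h) = (\<lambda>_. 0)"
proof (rule eigenvector_vanish[OF _ eigenvector_opC[OF eigenvector_sov j(1) xi_nonzero] j(1)])
  fix h' k assume "h' \<in> levels" "k < N"
  then have h': "h' k \<le> 2" by (rule levels_le)
  have "q * xi j 0 / xi k (h' k) = q powi (int (h' k) + 1) * w j / w k"
  proof -
    have "q * xi j 0 / xi k (h' k) = q * (xi j 0 / xi k (h' k))" by simp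
    then show ?thesis unfolding xi_ratio using q by (simp add: power_int_add_1 mult_ac)
  qed
  moreover have "br (q powi (int (h' k) + 1) * w j / w k) \<noteq> 0"
    using h' \<open>k < N\<close> j by (intro generic) auto
  ultimately show "br (((\<lambda>k. xi k (h k))(j := q * xi j (h j))) j / xi k (h' k)) \<noteq> 0"
    using j by simp
qed (use j q xi_nonzero in \<open>auto intro!: depends_upto_T depends_upto_sov\<close>)

section \<open>Interpolation of the transfer matrix at the zeros attached to a separated
  state\<close>

definition lagrange :: "(nat \<Rightarrow> nat) \<Rightarrow> nat \<Rightarrow> complex \<Rightarrow> complex" where
  "lagrange h j z = (\<Prod>k\<in>{..<N} - {j}. br (z / xi k (h k)) / br (xi j (h j) / xi k (h k)))"

lemma lagrange_self:
  assumes "j < N" "\<And>k. k < N \<Longrightarrow> h k \<le> 2"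
  shows "lagrange h j (xi j (h j)) = 1"
proof -
  have "br (xi j (h j) / xi k (h k)) \<noteq> 0" if "k \<in> {..<N} - {j}" for k
    using assms that by (intro br_xi_ratio) (auto intro: order_trans[of _ 2])
  then show ?thesis unfolding lagrange_def by (auto intro!: prod.neutral)
qed

lemma lagrange_other:
  assumes "i < N" "i \<noteq> j"
  shows "lagrange h j (xi i (h i)) = 0"
  unfolding lagrange_def using assms xi_nonzero[of i]
  by (intro prod_zero bexI[of _ i]) (auto simp: br_def)

text \<open>As a function of \<open>z\<close> both sides have \<open>N\<close> coefficients, and
  they agree at the \<open>N\<close> nodes \<open>xi j (h j)\<close>, whose squares are distinct by
  genericity.\<close>

lemma opT_interpolation:
  assumes h: "\<And>k. k < N \<Longrightarrow> h k \<le> 2" and z: "z \<noteq> 0"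
  shows "app (opB z + opC z) f \<sigma> = (\<Sum>j<N. lagrange h j z * app (opB (xi j (h j)) + opC (xi j (h j))) f \<sigma>)"
proof -
  define a where "a j = app (opB (xi j (h j)) + opC (xi j (h j))) f \<sigma>" for j
  have "app (opB z + opC z) f \<sigma> - (\<Sum>j<N. a j * lagrange h j z) = 0"
  proof (rule laurent_eq_zero[where A = "(\<lambda>j. xi j (h j)) ` {..<N}" and n = "N - 1" and z = z])
    have "laurent (N - 1) (\<lambda>z. app (opB z + opC z) f \<sigma>)"
      using T_laurent(2)[OF q, of N w _ _ r f \<sigma>] w N by (auto intro!: laurent_add)
    moreover have "laurent (N - 1) (\<lambda>z. lagrange h j z)" if "j < N" for j
    proof -
      have "laurent (card ({..<N} - {j})) (\<lambda>z. \<Prod>k\<in>{..<N} - {j}. br (inverse (xi k (h k)) * z))"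
        using xi_nonzero by (intro laurent_prod_br) auto
      note laurent_scaled[OF this, of "inverse (\<Prod>k\<in>{..<N} - {j}. br (xi j (h j) / xi k (h k)))"]
      moreover have "lagrange h j z = inverse (\<Prod>k\<in>{..<N} - {j}. br (xi j (h j) / xi k (h k))) *
          (\<Prod>k\<in>{..<N} - {j}. br (inverse (xi k (h k)) * z))" for z
        unfolding lagrange_def prod_dividef by (simp add: divide_inverse mult.commute)
      ultimately show ?thesis using that by simp
    qed
    ultimately show "laurent (N - 1) (\<lambda>z. app (opB z + opC z) f \<sigma> - (\<Sum>j<N. a j * lagrange h j z))"
      by (intro laurent_diff laurent_sum laurent_scaled) auto
    have "inj_on (\<lambda>j. (xi j (h j))\<^sup>2) {..<N}"
    proof (rule inj_onI)
      fix i j assume ij: "i \<in> {..<N}" "j \<in> {..<N}" "(xi i (h i))\<^sup>2 = (xi j (h j))\<^sup>2"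
      then have "br (xi i (h i) / xi j (h j)) = 0"
        using xi_nonzero by (subst br_eq_0_iff) (auto simp: power_divide)
      then show "i = j"
        using br_xi_ratio[of i j "h i" "h j"] ij h[of i] h[of j] by auto
    qed
    then have "card ((\<lambda>z. z\<^sup>2) ` (\<lambda>j. xi j (h j)) ` {..<N}) = N"
      by (simp add: image_image card_image)
    then show "N - 1 < card ((\<lambda>z. z\<^sup>2) ` (\<lambda>j. xi j (h j)) ` {..<N}) \<or> infinite ((\<lambda>z. z\<^sup>2) ` (\<lambda>j. xi j (h j)) ` {..<N})"
      using N by simp
  next
    fix z assume "z \<in> (\<lambda>j. xi j (h j)) ` {..<N}"
    then obtain i where i: "i < N" "z = xi i (h i)" by auto
    have "(\<Sum>j<N. a j * lagrange h j z) = (\<Sum>j<N. if j = i then a i else 0)"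
      using i lagrange_self[of i h] lagrange_other[of i _ h] h by (intro sum.cong) auto
    also have "\<dots> = a i" using i by simp
    finally show "z \<noteq> 0 \<and> app (opB z + opC z) f \<sigma> - (\<Sum>j<N. a j * lagrange h j z) = 0"
      using i xi_nonzero by (simp add: a_def)
  qed (rule z)
  then show ?thesis by (simp add: a_def mult.commute)
qed

text \<open>\<open>up h j\<close> and \<open>down h j\<close> are the images of \<open>sov h\<close>
  under \<open>opB\<close> and under \<open>- opC\<close> at the node \<open>xi j (h j)\<close>,
  with the ends of the ladder built in.\<close>

definition up :: "(nat \<Rightarrow> nat) \<Rightarrow> nat \<Rightarrow> (nat \<Rightarrow> spin) \<Rightarrow> complex" where
  "up h j = (if h j < 2 then sov (h(j := Suc (h j))) else (\<lambda>_. 0))"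

definition down :: "(nat \<Rightarrow> nat) \<Rightarrow> nat \<Rightarrow> (nat \<Rightarrow> spin) \<Rightarrow> complex" where
  "down h j = (if 0 < h j then (\<lambda>\<sigma>. qdet q w N (xi j (h j - 1)) * sov (h(j := h j - 1)) \<sigma>) else (\<lambda>_. 0))"

lemma opT_sov:
  assumes h: "\<And>k. k < N \<Longrightarrow> h k \<le> 2" and z: "z \<noteq> 0"
  shows "app (opB z + opC z) (sov h) \<sigma> = (\<Sum>j<N. lagrange h j z * (up h j \<sigma> - down h j \<sigma>))"
proof -
  have "app (opB (xi j (h j))) (sov h) = up h j" if "j < N" for j
    using that h[OF that] sov_overflow[OF that, of "h(j := Suc (h j))"] by (auto simp: up_def opB_sov)
  moreover have "app (opC (xi j (h j))) (sov h) = (\<lambda>\<sigma>. - down h j \<sigma>)" if "j < N" for j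
    using that opC_sov_0[OF that] opC_sov[OF that, of h "h j - 1"] by (auto simp: down_def fun_eq_iff)
  ultimately show ?thesis
    using opT_interpolation[OF h z, where f = "sov h" and \<sigma> = \<sigma>] by simp
qed

end

section \<open>The special vectors in the separated basis\<close>

definition vandermonde_br :: "nat \<Rightarrow> (nat \<Rightarrow> complex) \<Rightarrow> complex" where
  "vandermonde_br n x = (\<Prod>k<n. \<Prod>i<k. br (x i / x k))"

text \<open>Each ordered pair is grouped with its reverse.\<close>

lemma prod_off_diagonal:
  fixes f :: "nat \<Rightarrow> nat \<Rightarrow> 'a::comm_monoid_mult"
  shows "(\<Prod>j<n. \<Prod>k\<in>{..<n} - {j}. f j k) = (\<Prod>k<n. \<Prod>i<k. f i k * f k i)"
proof (induction n)
  case (Suc n)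
  have "(\<Prod>k\<in>{..<Suc n} - {j}. f j k) = f j n * (\<Prod>k\<in>{..<n} - {j}. f j k)" if "j < n" for j
  proof -
    have "{..<Suc n} - {j} = insert n ({..<n} - {j})" using that by auto
    then show ?thesis by simp
  qed
  moreover have "{..<Suc n} - {n} = {..<n}" by auto
  ultimately show ?case using Suc by (simp add: prod.distrib mult_ac)
qed simp

text \<open>Pairs without \<open>j\<close> are the same on both sides. A pair with \<open>j\<close>
  may occur in reversed order, but this costs the same sign on both sides.\<close>

lemma vandermonde_br_update:
  assumes "j < n"
  shows "vandermonde_br n (x(j := b)) * (\<Prod>k\<in>{..<n} - {j}. br (x j / x k))
       = vandermonde_br n x * (\<Prod>k\<in>{..<n} - {j}. br (b / x k))"
proof -
  \<comment> \<open>The product over \<open>k \<noteq> j\<close> is spread over all pairs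
    \<open>i < k\<close>, those without \<open>j\<close> contributing 1, so that the claim can be
    compared pair by pair.\<close>
  have *: "(\<Prod>k\<in>{..<n} - {j}. br (c / x k))
      = (\<Prod>k<n. \<Prod>i<k. (if i = j then br (c / x k) else 1) * (if k = j then br (c / x i) else 1))" for c
  proof -
    have "(\<Prod>k\<in>{..<n} - {j}. br (c / x k))
        = (\<Prod>a<n. if a = j then \<Prod>k\<in>{..<n} - {j}. br (c / x k) else 1)"
      using assms by simp
    also have "\<dots> = (\<Prod>a<n. \<Prod>k\<in>{..<n} - {a}. if a = j then br (c / x k) else 1)"
      by (intro prod.cong) auto
    finally show ?thesis by (simp only: prod_off_diagonal)
  qed
  have flip: "br (u / v) = - br (v / u)" for u v :: complex
    by (simp add: br_def)
  have "br ((x(j := b)) i / (x(j := b)) k) * ((if i = j then br (x j / x k) else 1) * (if k = j then br (x j / x i) else 1))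
     = br (x i / x k) * ((if i = j then br (b / x k) else 1) * (if k = j then br (b / x i) else 1))"
    if "i < k" for i k
    using that flip[of "x i" "x j"] flip[of "x i" b] by auto
  then show ?thesis
    unfolding * vandermonde_br_def prod.distrib[symmetric] by (intro prod.cong) auto
qed

context generic_chain
begin

section \<open>The right special vector by its coefficients\<close>

abbreviation "opT z \<equiv> opB z + opC z"

lemma levels_upd: "h \<in> levels \<Longrightarrow> j < N \<Longrightarrow> m \<le> 2 \<Longrightarrow> h(j := m) \<in> levels"
  by (auto simp: levels_def PiE_iff extensional_def)

lemma levels_zero: "(\<lambda>k\<in>{..<N}. 0) \<in> levels"
  by (auto simp: levels_def)

lemma levels_eqI: "h \<in> levels \<Longrightarrow> h' \<in> levels \<Longrightarrow> (\<And>k. k < N \<Longrightarrow> h k = h' k) \<Longrightarrow> h = h'"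
  unfolding levels_def by (rule PiE_ext) auto

text \<open>Shaped after the recurrences: quantities at level 1 vanish by themselves, those at level
  2 come directly from level 0.\<close>

lemma levels_induct [consumes 1, case_names zero one two]:
  assumes "h \<in> levels" and zero: "P (\<lambda>k\<in>{..<N}. 0)"
    and one: "\<And>h j. h \<in> levels \<Longrightarrow> j < N \<Longrightarrow> h j = 0 \<Longrightarrow> P (h(j := 1))"
    and two: "\<And>h j. h \<in> levels \<Longrightarrow> j < N \<Longrightarrow> h j = 0 \<Longrightarrow> P h \<Longrightarrow> P (h(j := 2))"
  shows "P h"
  using assms(1)
proof (induction "\<Sum>k<N. h k" arbitrary: h rule: less_induct)
  case less
  show ?case
  proof (cases "\<forall>k<N. h k = 0")
    case True
    then have "h = (\<lambda>k\<in>{..<N}. 0)"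
      using less.prems levels_zero by (intro levels_eqI) auto
    then show ?thesis using zero by simp
  next
    case False
    then obtain j where j: "j < N" "h j \<noteq> 0" by blast
    define h' where "h' = h(j := 0)"
    have h': "h' \<in> levels" "h' j = 0" using less.prems j by (auto simp: h'_def intro: levels_upd)
    have "(\<Sum>k<N. h' k) < (\<Sum>k<N. h k)"
      using j by (simp add: h'_def sum.remove[of "{..<N}" j])
    then have "P h'" using less.hyps h' by blast
    moreover have "h j = 1 \<or> h j = 2" using j levels_le[OF less.prems j(1)] by auto
    moreover have "h = h'(j := h j)" by (simp add: h'_def)
    ultimately show ?thesis using one[OF h'(1) j(1) h'(2)] two[OF h'(1) j(1) h'(2)] by metis
  qed
qed

text \<open>Solution of the recurrence in \<open>kernel_recurrence\<close>, normalised to 1 at level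
  zero. Going from level 0 to 2 at site \<open>j\<close> divides by \<open>qdet\<close> at
  \<open>xi j 1\<close>; the ratio of the two \<open>lagrange\<close> denominators is absorbed by
  \<open>vandermonde_br\<close>.\<close>

definition psi_coeff :: "(nat \<Rightarrow> nat) \<Rightarrow> complex" where
  "psi_coeff h = (if \<exists>k<N. h k = 1 then 0 else
     (\<Prod>k<N. if h k = 2 then inverse (qdet q w N (xi k 1)) else 1)
     * (vandermonde_br N (\<lambda>k. xi k (h k)) / vandermonde_br N (\<lambda>k. xi k 0)))"

text \<open>Values of the left vector on the separated states. They solve
  \<open>pairing \<phi> (up h j) = pairing \<phi> (down h j)\<close>, which at
  \<open>h j = 1\<close> links level 2 to level 0 by \<open>qdet\<close> at
  \<open>xi j 0\<close>.\<close>

definition phi_value :: "(nat \<Rightarrow> nat) \<Rightarrow> complex" where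
  "phi_value h = (if \<exists>k<N. h k = 1 then 0 else \<Prod>k<N. if h k = 2 then qdet q w N (xi k 0) else 1)"

lemma vandermonde_br_xi_nonzero: "h \<in> levels \<Longrightarrow> vandermonde_br N (\<lambda>k. xi k (h k)) \<noteq> 0"
proof -
  assume h: "h \<in> levels"
  have "br (xi i (h i) / xi k (h k)) \<noteq> 0" if "i < k" "k < N" for i k
    using that levels_le[OF h, of i] levels_le[OF h, of k] by (intro br_xi_ratio) auto
  then show ?thesis by (simp add: vandermonde_br_def)
qed

lemma prod_if_upd:
  assumes "j < N"
  shows "(\<Prod>k<N. if (h(j := (2::nat))) k = 2 then f k else 1) = f j * (\<Prod>k\<in>{..<N} - {j}. if h k = 2 then f k else (1::complex))"
  using assms by (subst prod.remove[of _ j]) (auto intro!: prod.cong)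

lemma prod_if_remove:
  assumes "j < N" "h j = (0::nat)"
  shows "(\<Prod>k<N. if h k = 2 then f k else 1) = (\<Prod>k\<in>{..<N} - {j}. if h k = 2 then f k else (1::complex))"
  using assms by (subst prod.remove[of _ j]) auto

lemma no_level_one_upd: "h j = 0 \<Longrightarrow> (\<exists>k<N. (h(j := 2)) k = (1::nat)) \<longleftrightarrow> (\<exists>k<N. h k = 1)"
proof -
  assume "h j = 0"
  then have "(h(j := 2)) k = 1 \<longleftrightarrow> h k = 1" for k by auto
  then show ?thesis by simp
qed

lemma phi_value_zero: "phi_value (\<lambda>k\<in>{..<N}. 0) = 1"
  by (auto simp: phi_value_def intro!: prod.neutral)

lemma opT_levels:
  "h \<in> levels \<Longrightarrow> z \<noteq> 0 \<Longrightarrow> app (opT z) (sov h) \<sigma> = (\<Sum>j<N. lagrange h j z * (up h j \<sigma> - down h j \<sigma>))"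
  by (intro opT_sov levels_le)

lemma phi_value_upd:
  assumes "j < N" "h j = 0"
  shows "phi_value (h(j := 2)) = qdet q w N (xi j 0) * phi_value h"
proof -
  show ?thesis
    unfolding phi_value_def no_level_one_upd[of h, OF assms(2)] prod_if_upd[OF assms(1), of h]
      prod_if_remove[of j h, OF assms] by auto
qed

lemma lagrange_upd_nonzero:
  assumes h: "h \<in> levels" and j: "j < N" and m: "m \<le> 2"
  shows "lagrange h j (xi j m) \<noteq> 0"
proof -
  have "br (xi j m / xi k (h k)) \<noteq> 0" "br (xi j (h j) / xi k (h k)) \<noteq> 0" if "k < N" "k \<noteq> j" for k
    using that j m levels_le[OF h, of k] levels_le[OF h, of j] by (intro br_xi_ratio; simp)+
  then show ?thesis by (auto simp: lagrange_def)
qed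

text \<open>This holds for all \<open>z\<close>, not only at nodes: the numerators of the two
  Lagrange factors do not involve the level at \<open>j\<close>, and the denominators are matched by
  \<open>vandermonde_br_update\<close>.\<close>

lemma psi_coeff_upd:
  assumes h: "h \<in> levels" and j: "j < N" "h j = 0"
  shows "psi_coeff h * lagrange h j z = psi_coeff (h(j := 2)) * lagrange (h(j := 2)) j z * qdet q w N (xi j 1)"
proof (cases "\<exists>k<N. h k = 1")
  case True
  moreover have "\<exists>k<N. (h(j := 2)) k = 1"
    using True no_level_one_upd[of h, OF j(2)] by blast
  ultimately show ?thesis by (simp add: psi_coeff_def del: fun_upd_apply)
next
  case False
  then have F: "\<not> (\<exists>k<N. (h(j := 2)) k = 1)" by auto
  define A where "A m = (\<Prod>k\<in>{..<N} - {j}. br (xi j m / xi k (h k)))" for m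
  define Z where "Z = (\<Prod>k\<in>{..<N} - {j}. br (z / xi k (h k)))"
  define V where "V h = vandermonde_br N (\<lambda>k. xi k (h k))" for h
  define Q where "Q = (\<Prod>k\<in>{..<N} - {j}. if h k = 2 then inverse (qdet q w N (xi k 1)) else 1)"
  have A: "A m \<noteq> 0" if "m \<le> 2" for m
  proof -
    have "br (xi j m / xi k (h k)) \<noteq> 0" if "k \<in> {..<N} - {j}" for k
      using that \<open>m \<le> 2\<close> j levels_le[OF h, of k] by (intro br_xi_ratio) auto
    then show ?thesis by (simp add: A_def)
  qed
  have l0: "lagrange h j z = Z / A 0"
    unfolding lagrange_def A_def Z_def prod_dividef j ..
  have l2: "lagrange (h(j := 2)) j z = Z / A 2"
    unfolding lagrange_def A_def Z_def prod_dividef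
    by (intro arg_cong2[of _ _ _ _ "(/)"] prod.cong) auto
  have "V (h(j := 2)) * A 0 = V h * A 2"
  proof -
    have "(\<lambda>k. xi k ((h(j := 2)) k)) = (\<lambda>k. xi k (h k))(j := xi j 2)" by auto
    then show ?thesis
      using vandermonde_br_update[OF j(1), of "\<lambda>k. xi k (h k)" "xi j 2"] j by (simp add: V_def A_def)
  qed
  then have V: "V (h(j := 2)) / A 2 = V h / A 0"
    using A[of 0] A[of 2] by (simp add: frac_eq_eq)
  have c0: "psi_coeff h = Q * (V h / V (\<lambda>_. 0))"
    unfolding psi_coeff_def if_not_P[OF False] V_def Q_def prod_if_remove[of j h, OF j] ..
  have c2: "psi_coeff (h(j := 2)) = inverse (qdet q w N (xi j 1)) * Q * (V (h(j := 2)) / V (\<lambda>_. 0))"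
    unfolding psi_coeff_def if_not_P[OF F] V_def Q_def prod_if_upd[OF j(1), of h] ..
  have "psi_coeff (h(j := 2)) * lagrange (h(j := 2)) j z * qdet q w N (xi j 1)
      = Q * Z / V (\<lambda>_. 0) * (V (h(j := 2)) / A 2)"
    unfolding c2 l2 using qdet_xi_nonzero[OF j(1), of 1] by (simp add: field_simps)
  also have "\<dots> = psi_coeff h * lagrange h j z"
    unfolding V c0 l0 by simp
  finally show ?thesis ..
qed

definition psi_vec :: "(nat \<Rightarrow> spin) \<Rightarrow> complex" where
  "psi_vec \<sigma> = (\<Sum>h\<in>levels. psi_coeff h * sov h \<sigma>)"

lemma depends_upto_psi_vec: "depends_upto N psi_vec"
  unfolding psi_vec_def by (intro depends_upto_sum depends_upto_sov)

lemma opT_psi_vec: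
  assumes z: "z \<noteq> 0"
  shows "app (opT z) psi_vec \<sigma> = 0"
proof -
  \<comment> \<open>The sum vanishes for each \<open>j\<close> separately: only levels 0 and 2
    contribute, raising from 0 and lowering from 2 both lead to level 1, and the two contributions
    cancel.\<close>
  have inner: "(\<Sum>h\<in>levels. psi_coeff h * (lagrange h j z * (up h j \<sigma> - down h j \<sigma>))) = 0" if j: "j < N" for j
  proof -
    have "(\<Sum>h\<in>levels. psi_coeff h * (lagrange h j z * up h j \<sigma>))
        = (\<Sum>h\<in>{h \<in> levels. h j = 0}. psi_coeff h * (lagrange h j z * up h j \<sigma>))"
    proof (intro sum.mono_neutral_right finite_levels ballI)
      fix h assume "h \<in> levels - {h \<in> levels. h j = 0}"
      then have "h j = 1 \<or> h j = 2" using levels_le[of h j] j by auto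
      then show "psi_coeff h * (lagrange h j z * up h j \<sigma>) = 0"
        using j by (auto simp: psi_coeff_def up_def)
    qed auto
    also have "\<dots> = (\<Sum>h\<in>{h \<in> levels. h j = 2}. psi_coeff h * (lagrange h j z * down h j \<sigma>))"
    proof (rule sum.reindex_bij_witness[of _ "\<lambda>h. h(j := 0)" "\<lambda>h. h(j := 2)"])
      fix h assume h: "h \<in> {h \<in> levels. h j = 0}"
      have "psi_coeff (h(j := 2)) * (lagrange (h(j := 2)) j z * down (h(j := 2)) j \<sigma>)
          = psi_coeff (h(j := 2)) * lagrange (h(j := 2)) j z * qdet q w N (xi j 1) * sov (h(j := 1)) \<sigma>"
        by (simp add: down_def mult_ac)
      also have "\<dots> = psi_coeff h * lagrange h j z * sov (h(j := 1)) \<sigma>"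
        using psi_coeff_upd[of h j z] h j by simp
      also have "\<dots> = psi_coeff h * (lagrange h j z * up h j \<sigma>)"
        using h by (simp add: up_def)
      finally show "psi_coeff (h(j := 2)) * (lagrange (h(j := 2)) j z * down (h(j := 2)) j \<sigma>)
          = psi_coeff h * (lagrange h j z * up h j \<sigma>)" .
    qed (use j in \<open>auto intro: levels_upd\<close>)
    also have "\<dots> = (\<Sum>h\<in>levels. psi_coeff h * (lagrange h j z * down h j \<sigma>))"
    proof (intro sum.mono_neutral_left finite_levels ballI)
      fix h assume "h \<in> levels - {h \<in> levels. h j = 2}"
      then have "h j = 1 \<or> h j = 0" using levels_le[of h j] j by auto
      then show "psi_coeff h * (lagrange h j z * down h j \<sigma>) = 0"
        using j by (auto simp: psi_coeff_def down_def)
    qed auto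
    finally show ?thesis by (simp add: right_diff_distrib sum_subtractf)
  qed
  have "app (opT z) psi_vec \<sigma> = (\<Sum>h\<in>levels. psi_coeff h * app (opT z) (sov h) \<sigma>)"
    unfolding psi_vec_def app_sum ..
  also have "\<dots> = (\<Sum>h\<in>levels. \<Sum>j<N. psi_coeff h * (lagrange h j z * (up h j \<sigma> - down h j \<sigma>)))"
    by (intro sum.cong refl) (simp only: opT_levels[OF _ z] sum_distrib_left)
  also have "\<dots> = (\<Sum>j<N. \<Sum>h\<in>levels. psi_coeff h * (lagrange h j z * (up h j \<sigma> - down h j \<sigma>)))"
    by (rule sum.swap)
  also have "\<dots> = 0" using inner by simp
  finally show ?thesis .
qed

text \<open>The all-up configuration has magnetisation \<open>N\<close>, but \<open>sov h\<close>
  lives on magnetisation \<open>N\<close> minus the sum of the levels.\<close>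

lemma sov_all_up:
  assumes "h \<in> levels" "\<And>i. i < N \<Longrightarrow> \<sigma> i = Spin_Up"
  shows "sov h \<sigma> = (if h = (\<lambda>k\<in>{..<N}. 0) then 1 else 0)"
proof (cases "h = (\<lambda>k\<in>{..<N}. 0)")
  case True
  then have "sov h = vac" by (intro sov_zero) simp
  then show ?thesis using True assms by (simp add: vac_def)
next
  case False
  have "sov h \<sigma> = 0"
  proof (rule ccontr)
    assume "sov h \<sigma> \<noteq> 0"
    from magnetisation_sov[OF this] have "int (\<Sum>k<N. h k) = 0"
      using assms(2) by (simp del: of_nat_sum)
    then have "(\<Sum>k<N. h k) = 0" by (simp only: of_nat_0_eq_iff)
    then have "h = (\<lambda>k\<in>{..<N}. 0)"
      using assms(1) levels_zero by (intro levels_eqI) auto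
    then show False using False by simp
  qed
  then show ?thesis using False by simp
qed

lemma psi_vec_all_up:
  assumes "\<And>i. i < N \<Longrightarrow> \<sigma> i = Spin_Up"
  shows "psi_vec \<sigma> = 1"
proof -
  have "psi_vec \<sigma> = (\<Sum>h\<in>levels. if h = (\<lambda>k\<in>{..<N}. 0) then psi_coeff (\<lambda>k\<in>{..<N}. 0) else 0)"
    unfolding psi_vec_def using sov_all_up[OF _ assms] by (intro sum.cong) auto
  also have "\<dots> = psi_coeff (\<lambda>k\<in>{..<N}. 0)"
    using levels_zero finite_levels by simp
  also have "\<dots> = 1"
  proof -
    have "vandermonde_br N (\<lambda>k. xi k ((\<lambda>k\<in>{..<N}. 0) k)) = vandermonde_br N (\<lambda>k. xi k 0)"
      unfolding vandermonde_br_def by (intro prod.cong) auto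
    moreover have "vandermonde_br N (\<lambda>k. xi k ((\<lambda>k\<in>{..<N}. 0) k)) \<noteq> 0"
      by (rule vandermonde_br_xi_nonzero[OF levels_zero])
    ultimately show ?thesis by (simp add: psi_coeff_def)
  qed
  finally show ?thesis .
qed

text \<open>The coefficient of \<open>sov g\<close> in the kernel equation, read off at the node
  \<open>z = xi i (g i)\<close>, which isolates the moves at site \<open>i\<close>: raising from one
  level below and lowering from one level above.\<close>

lemma kernel_recurrence:
  assumes zero: "\<And>z \<sigma>. z \<noteq> 0 \<Longrightarrow> (\<Sum>h\<in>levels. c h * app (opT z) (sov h) \<sigma>) = 0"
    and g: "g \<in> levels" and i: "i < N"
  shows "(if 0 < g i then c (g(i := g i - 1)) * lagrange (g(i := g i - 1)) i (xi i (g i)) else 0)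
       = (if g i < 2 then c (g(i := Suc (g i))) * lagrange (g(i := Suc (g i))) i (xi i (g i)) * qdet q w N (xi i (g i)) else 0)"
proof -
  define z where "z = xi i (g i)"
  have z: "z \<noteq> 0" using xi_nonzero i by (simp add: z_def)
  \<comment> \<open>\<open>U\<close> and \<open>D\<close> are the components of
    \<open>up h j\<close> and \<open>down h j\<close> along \<open>sov g\<close>.\<close>
  define U where "U h j g = (if h j < 2 \<and> g = h(j := Suc (h j)) then 1 else 0 :: complex)" for h j and g :: "nat \<Rightarrow> nat"
  define D where "D h j g = (if 0 < h j \<and> g = h(j := h j - 1) then qdet q w N (xi j (h j - 1)) else 0)" for h j and g :: "nat \<Rightarrow> nat"
  have up: "up h j \<sigma> = (\<Sum>g\<in>levels. U h j g * sov g \<sigma>)" if "h \<in> levels" "j < N" for h j \<sigma>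
  proof (cases "h j < 2")
    case True
    then have "(\<Sum>g\<in>levels. U h j g * sov g \<sigma>) = (\<Sum>g\<in>levels. if g = h(j := Suc (h j)) then sov g \<sigma> else 0)"
      by (intro sum.cong) (auto simp: U_def)
    then show ?thesis using True that levels_upd[of h j "Suc (h j)"] finite_levels by (simp add: up_def)
  qed (simp add: U_def up_def)
  have down: "down h j \<sigma> = (\<Sum>g\<in>levels. D h j g * sov g \<sigma>)" if "h \<in> levels" "j < N" for h j \<sigma>
  proof (cases "0 < h j")
    case True
    then have "(\<Sum>g\<in>levels. D h j g * sov g \<sigma>)
        = (\<Sum>g\<in>levels. if g = h(j := h j - 1) then qdet q w N (xi j (h j - 1)) * sov g \<sigma> else 0)"
      by (intro sum.cong) (auto simp: D_def)
    then show ?thesis using True that levels_upd[of h j "h j - 1"] levels_le[of h j] finite_levels by (simp add: down_def)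
  qed (simp add: D_def down_def)
  have "(\<Sum>g\<in>levels. (\<Sum>h\<in>levels. \<Sum>j<N. c h * lagrange h j z * (U h j g - D h j g)) * sov g \<sigma>) = 0" for \<sigma>
  proof -
    have "0 = (\<Sum>h\<in>levels. c h * app (opT z) (sov h) \<sigma>)" using zero[OF z] by simp
    also have "\<dots> = (\<Sum>h\<in>levels. \<Sum>j<N. c h * (lagrange h j z * (up h j \<sigma> - down h j \<sigma>)))"
      by (intro sum.cong refl) (simp only: opT_levels[OF _ z] sum_distrib_left)
    also have "\<dots> = (\<Sum>h\<in>levels. \<Sum>j<N. \<Sum>g\<in>levels. c h * lagrange h j z * (U h j g - D h j g) * sov g \<sigma>)"
      by (intro sum.cong refl)
         (simp add: up down sum_subtractf[symmetric] left_diff_distrib[symmetric] sum_distrib_left mult.assoc)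
    also have "\<dots> = (\<Sum>g\<in>levels. (\<Sum>h\<in>levels. \<Sum>j<N. c h * lagrange h j z * (U h j g - D h j g)) * sov g \<sigma>)"
      unfolding sum_distrib_right
      by (subst sum.swap[of _ levels levels], subst sum.swap[of _ "{..<N}" levels]) (rule refl)
    finally show ?thesis by simp
  qed
  then have "(\<Sum>h\<in>levels. \<Sum>j<N. c h * lagrange h j z * (U h j g - D h j g)) = 0"
    by (rule sov_independent[where c = "\<lambda>g. \<Sum>h\<in>levels. \<Sum>j<N. c h * lagrange h j z * (U h j g - D h j g)"]) (rule g)
  moreover have "(\<Sum>j<N. c h * lagrange h j z * (U h j g - D h j g)) = c h * lagrange h i z * (U h i g - D h i g)" for h
  proof -
    \<comment> \<open>A move at \<open>j \<noteq> i\<close> keeps the level at \<open>i\<close>, so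
      \<open>z\<close> is a node of \<open>h\<close> other than its \<open>j\<close>-th one and the
      Lagrange factor vanishes there.\<close>
    have "c h * lagrange h j z * (U h j g - D h j g) = 0" if "j < N" "j \<noteq> i" for j
    proof (cases "g i = h i")
      case True
      then have "lagrange h j z = 0" using lagrange_other[of i j h] i that by (simp add: z_def)
      then show ?thesis by simp
    next
      case False
      then have "U h j g = 0" "D h j g = 0" using that by (auto simp: U_def D_def)
      then show ?thesis by simp
    qed
    then have "(\<Sum>j\<in>{..<N} - {i}. c h * lagrange h j z * (U h j g - D h j g)) = 0"
      by (intro sum.neutral) blast
    then show ?thesis using i by (subst sum.remove[of _ i]) auto
  qed
  ultimately have "(\<Sum>h\<in>levels. c h * lagrange h i z * (U h i g - D h i g)) = 0"
    by (simp only:)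
  then have "(\<Sum>h\<in>levels. c h * lagrange h i z * U h i g) = (\<Sum>h\<in>levels. c h * lagrange h i z * D h i g)"
    by (simp add: right_diff_distrib sum_subtractf)
  moreover have "(\<Sum>h\<in>levels. c h * lagrange h i z * U h i g)
      = (if 0 < g i then c (g(i := g i - 1)) * lagrange (g(i := g i - 1)) i z else 0)"
  proof (cases "0 < g i")
    case True
    have "h i < 2 \<and> g = h(i := Suc (h i)) \<longleftrightarrow> h = g(i := g i - 1)" for h
      using True levels_le[OF g i] by (auto simp: fun_upd_idem)
    then have "c h * lagrange h i z * U h i g = (if h = g(i := g i - 1) then c h * lagrange h i z else 0)" for h
      by (simp add: U_def)
    then show ?thesis
      using True levels_upd[OF g i, of "g i - 1"] levels_le[OF g i] finite_levels by simp
  next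
    case False
    then have "U h i g = 0" for h by (auto simp: U_def)
    then show ?thesis using False by simp
  qed
  moreover have "(\<Sum>h\<in>levels. c h * lagrange h i z * D h i g)
      = (if g i < 2 then c (g(i := Suc (g i))) * lagrange (g(i := Suc (g i))) i z * qdet q w N (xi i (g i)) else 0)"
  proof (cases "g i < 2")
    case True
    have "0 < h i \<and> g = h(i := h i - 1) \<longleftrightarrow> h = g(i := Suc (g i))" for h
      by (auto simp: fun_upd_idem)
    then have "c h * lagrange h i z * D h i g
        = (if h = g(i := Suc (g i)) then c h * lagrange h i z * qdet q w N (xi i (g i)) else 0)" for h
      by (simp add: D_def)
    then show ?thesis
      using True levels_upd[OF g i, of "Suc (g i)"] finite_levels by simp
  next
    case False
    have "D h i g = 0" if "h \<in> levels" for h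
      using False levels_le[OF that i] by (auto simp: D_def)
    then show ?thesis using False by simp
  qed
  ultimately show ?thesis by (simp only: z_def)
qed

lemma kernel_unique:
  assumes f: "depends_upto N f" and zero: "\<And>z \<sigma>. z \<noteq> 0 \<Longrightarrow> app (opT z) f \<sigma> = 0" and "f (\<lambda>_. Spin_Up) = 0"
  shows "f = (\<lambda>_. 0)"
proof -
  obtain c where c: "f = (\<lambda>\<sigma>. \<Sum>h\<in>levels. c h * sov h \<sigma>)"
    using sov_expansion[OF f] .
  have zero': "(\<Sum>h\<in>levels. c h * app (opT z) (sov h) \<sigma>) = 0" if "z \<noteq> 0" for z \<sigma>
    using zero[OF that, of \<sigma>] unfolding c app_sum .
  note rec = kernel_recurrence[OF zero']
  have "c h = 0" if "h \<in> levels" for h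
    using that
  proof (induction h rule: levels_induct)
    case zero
    have "0 = (\<Sum>h\<in>levels. c h * (if h = (\<lambda>k\<in>{..<N}. 0) then 1 else 0))"
      using assms(3) unfolding c by (simp add: sov_all_up)
    also have "\<dots> = (\<Sum>h\<in>levels. if h = (\<lambda>k\<in>{..<N}. 0) then c (\<lambda>k\<in>{..<N}. 0) else 0)"
      by (intro sum.cong) auto
    finally have "c (\<lambda>k\<in>{..<N}. 0) = 0" using levels_zero finite_levels by simp
    then show ?case .
  next
    case (one h j)
    have "h(j := 1) \<in> levels" using one by (intro levels_upd) auto
    \<comment> \<open>The recurrence at \<open>g = h\<close>, where level 0 at \<open>j\<close>
      receives nothing from below.\<close>
    then have "c (h(j := 1)) = 0"
      using rec[OF _ one(1,2)] one(3) lagrange_upd_nonzero[of "h(j := 1)" j 0] qdet_xi_nonzero[OF one(2), of 0] one(2)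
      by simp
    then show ?case .
  next
    case (two h j)
    have 1: "h(j := 1) \<in> levels" and 2: "h(j := 2) \<in> levels" using two by (auto intro!: levels_upd)
    have "(h(j := 1))(j := 0) = h" using two(3) by auto
    \<comment> \<open>The recurrence at \<open>g = h(j := 1)\<close>, which ties level 2 to the
      vanishing coefficient at level 0.\<close>
    then have "c (h(j := 2)) = 0"
      using rec[OF _ 1 two(2)] lagrange_upd_nonzero[OF 2 two(2), of 1] qdet_xi_nonzero[OF two(2), of 1] two(4)
      by (simp add: numeral_2_eq_2)
    then show ?case .
  qed
  then show ?thesis unfolding c by simp
qed

section \<open>The left special vector by its values on the separated states\<close>

definition pairing :: "(spin list \<Rightarrow> complex) \<Rightarrow> ((nat \<Rightarrow> spin) \<Rightarrow> complex) \<Rightarrow> complex" where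
  "pairing \<phi> f = (\<Sum>\<sigma>\<in>configs N. \<phi> \<sigma> * f (cfg N \<sigma>))"

lemma pairing_sum: "pairing \<phi> (\<lambda>\<sigma>. \<Sum>i\<in>I. c i * f i \<sigma>) = (\<Sum>i\<in>I. c i * pairing \<phi> (f i))"
  unfolding pairing_def sum_distrib_left by (subst sum.swap) (simp add: mult_ac)

lemma pairing_vac: "pairing \<phi> vac = \<phi> (replicate N Spin_Up)"
proof -
  have "vac (cfg N \<sigma>) = (if \<sigma> = replicate N Spin_Up then 1 else 0)" if "\<sigma> \<in> configs N" for \<sigma>
    using that by (auto simp: vac_def cfg_def configs_def list_eq_iff_nth_eq)
  then have "pairing \<phi> vac = (\<Sum>\<sigma>\<in>configs N. if \<sigma> = replicate N Spin_Up then \<phi> \<sigma> else 0)"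
    unfolding pairing_def by (intro sum.cong) auto
  also have "\<dots> = \<phi> (replicate N Spin_Up)" using finite_configs by (simp add: configs_def)
  finally show ?thesis .
qed

lemma pairing_opT_sov:
  assumes h: "h \<in> levels" and z: "z \<noteq> 0"
  shows "pairing \<phi> (app (opT z) (sov h)) = (\<Sum>j<N. lagrange h j z * (pairing \<phi> (up h j) - pairing \<phi> (down h j)))"
proof -
  have "app (opT z) (sov h) = (\<lambda>\<sigma>. \<Sum>j<N. lagrange h j z * (up h j \<sigma> - down h j \<sigma>))"
    using opT_sov[OF levels_le[OF h] z] by (intro ext)
  moreover have "pairing \<phi> (\<lambda>\<sigma>. f \<sigma> - g \<sigma>) = pairing \<phi> f - pairing \<phi> g" for f g
    by (simp add: pairing_def right_diff_distrib sum_subtractf)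
  ultimately show ?thesis by (simp add: pairing_sum)
qed

lemma pairing_up: "pairing \<phi> (up h j) = (if h j < 2 then pairing \<phi> (sov (h(j := Suc (h j)))) else 0)"
  by (simp add: up_def pairing_def)

lemma pairing_down:
  "pairing \<phi> (down h j) = (if 0 < h j then qdet q w N (xi j (h j - 1)) * pairing \<phi> (sov (h(j := h j - 1))) else 0)"
  by (simp add: down_def pairing_def sum_distrib_left mult_ac)

text \<open>On a basis state the Lagrange factor multiplies the difference of the pairings with
  \<open>up\<close> and \<open>down\<close>, so it suffices that these agree. At levels 0 and 2 both
  sides vanish because level 1 has value 0; at level 1 this is the defining relation of
  \<open>phi_value\<close>.\<close>

lemma left_kernel_exists:
  assumes vals: "\<And>h. h \<in> levels \<Longrightarrow> pairing \<phi> (sov h) = phi_value h" and f: "depends_upto N f" and z: "z \<noteq> 0"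
  shows "pairing \<phi> (app (opT z) f) = 0"
proof -
  have *: "pairing \<phi> (up h j) = pairing \<phi> (down h j)" if h: "h \<in> levels" and j: "j < N" for h j
  proof -
    consider "h j = 0" | "h j = 1" | "h j = 2" using levels_le[OF h j] by linarith
    then show ?thesis
    proof cases
      case 1
      have "phi_value (h(j := 1)) = 0" using j by (auto simp: phi_value_def)
      then show ?thesis
        using 1 vals[OF levels_upd[OF h j, of 1]] by (simp add: pairing_up pairing_down)
    next
      case 2
      have "phi_value (h(j := 2)) = qdet q w N (xi j 0) * phi_value (h(j := 0))"
        using phi_value_upd[OF j, of "h(j := 0)"] by simp
      then show ?thesis
        using 2 vals[OF levels_upd[OF h j, of 0]] vals[OF levels_upd[OF h j, of 2]]
        by (simp add: pairing_up pairing_down numeral_2_eq_2)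
    next
      case 3
      have "phi_value (h(j := 1)) = 0" using j by (auto simp: phi_value_def)
      then show ?thesis
        using 3 vals[OF levels_upd[OF h j, of 1]] by (simp add: pairing_up pairing_down)
    qed
  qed
  obtain c where c: "f = (\<lambda>\<sigma>. \<Sum>h\<in>levels. c h * sov h \<sigma>)"
    using sov_expansion[OF f] .
  show ?thesis
    unfolding c app_sum pairing_sum by (intro sum.neutral) (simp add: pairing_opT_sov[OF _ z] * del: app_simps)
qed

text \<open>At \<open>z = xi j (h j)\<close> only the \<open>j\<close>-th summand survives, so
  annihilation for all \<open>z\<close> already forces the local relations, and these determine all
  values from the one at \<open>vac\<close>.\<close>

lemma left_kernel_values:
  assumes zero: "\<And>z h. z \<noteq> 0 \<Longrightarrow> h \<in> levels \<Longrightarrow> pairing \<phi> (app (opT z) (sov h)) = 0"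
    and norm: "\<phi> (replicate N Spin_Up) = 1" and "h \<in> levels"
  shows "pairing \<phi> (sov h) = phi_value h"
proof -
  have *: "pairing \<phi> (up h j) = pairing \<phi> (down h j)" if h: "h \<in> levels" and j: "j < N" for h j
  proof -
    have self: "lagrange h j (xi j (h j)) = 1"
      using levels_le[OF h] by (intro lagrange_self[OF j])
    have "0 = (\<Sum>i<N. lagrange h i (xi j (h j)) * (pairing \<phi> (up h i) - pairing \<phi> (down h i)))"
      using zero[OF xi_nonzero[OF j] h] pairing_opT_sov[OF h xi_nonzero[OF j]] by simp
    also have "\<dots> = (\<Sum>i<N. if i = j then pairing \<phi> (up h j) - pairing \<phi> (down h j) else 0)"
      using j self lagrange_other[OF j, of _ h] by (intro sum.cong) auto
    finally show ?thesis using j by simp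
  qed
  show ?thesis
    using assms(3)
  proof (induction h rule: levels_induct)
    case zero
    have "sov (\<lambda>k\<in>{..<N}. 0) = vac" by (rule sov_zero) simp
    then have "pairing \<phi> (sov (\<lambda>k\<in>{..<N}. 0)) = phi_value (\<lambda>k\<in>{..<N}. 0)"
      using norm by (simp only: pairing_vac phi_value_zero)
    then show ?case .
  next
    case (one h j)
    have "phi_value (h(j := 1)) = 0" using one by (auto simp: phi_value_def)
    then have "pairing \<phi> (sov (h(j := 1))) = phi_value (h(j := 1))"
      using *[OF one(1,2)] one(3) by (simp add: pairing_up pairing_down)
    then show ?case .
  next
    case (two h j)
    have 1: "h(j := 1) \<in> levels" using two by (intro levels_upd) auto
    have "(h(j := 1))(j := 0) = h" using two(3) by auto
    then have "pairing \<phi> (sov (h(j := 2))) = phi_value (h(j := 2))"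
      using *[OF 1 two(2)] phi_value_upd[OF two(2), of h] two(3,4)
      by (simp add: pairing_up pairing_down numeral_2_eq_2)
    then show ?case .
  qed
qed

text \<open>The component at \<open>\<sigma>\<close> is the pairing with the indicator of
  \<open>\<sigma>\<close>, which is a combination of separated states.\<close>

lemma pairing_determines:
  assumes "\<And>h. h \<in> levels \<Longrightarrow> pairing \<phi> (sov h) = pairing \<phi>' (sov h)" and \<sigma>: "\<sigma> \<in> configs N"
  shows "\<phi> \<sigma> = \<phi>' \<sigma>"
proof -
  define \<delta> where "\<delta> \<tau> = (if \<forall>i<N. \<tau> i = \<sigma> ! i then 1 else 0 :: complex)" for \<tau>
  have "depends_upto N \<delta>"
    by (auto simp: depends_upto_def \<delta>_def)
  then obtain c where c: "\<delta> = (\<lambda>\<tau>. \<Sum>h\<in>levels. c h * sov h \<tau>)"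
    by (rule sov_expansion)
  have e: "\<psi> \<sigma> = pairing \<psi> \<delta>" for \<psi>
  proof -
    have "\<delta> (cfg N \<tau>) = (if \<tau> = \<sigma> then 1 else 0)" if "\<tau> \<in> configs N" for \<tau>
      using that \<sigma> by (auto simp: \<delta>_def cfg_def configs_def list_eq_iff_nth_eq)
    then have "pairing \<psi> \<delta> = (\<Sum>\<tau>\<in>configs N. if \<tau> = \<sigma> then \<psi> \<sigma> else 0)"
      unfolding pairing_def by (intro sum.cong) auto
    then show ?thesis using \<sigma> finite_configs by simp
  qed
  show ?thesis
    unfolding e[of \<phi>] e[of \<phi>'] c pairing_sum using assms(1) by (intro sum.cong) auto
qed

text \<open>Only its values on the separated states are ever used. Existence comes from the dual
  basis in \<open>pairing_phi_vec\<close>; on \<open>configs N\<close> it is unique by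
  \<open>pairing_determines\<close>.\<close>

definition phi_vec :: "spin list \<Rightarrow> complex" where
  "phi_vec = (SOME \<phi>. \<forall>h\<in>levels. pairing \<phi> (sov h) = phi_value h)"

lemma pairing_phi_vec: "h \<in> levels \<Longrightarrow> pairing phi_vec (sov h) = phi_value h"
proof -
  obtain L where L: "\<forall>h\<in>levels. \<forall>h'\<in>levels.
      (\<Sum>\<sigma>\<in>configs N. L h \<sigma> * sov h' (cfg N \<sigma>)) = (if h = h' then 1 else 0)"
    using dual_basis by blast
  have "pairing (\<lambda>\<sigma>. \<Sum>h\<in>levels. phi_value h * L h \<sigma>) (sov h') = phi_value h'" if "h' \<in> levels" for h'
  proof -
    have "pairing (\<lambda>\<sigma>. \<Sum>h\<in>levels. phi_value h * L h \<sigma>) (sov h')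
        = (\<Sum>h\<in>levels. phi_value h * (\<Sum>\<sigma>\<in>configs N. L h \<sigma> * sov h' (cfg N \<sigma>)))"
      unfolding pairing_def sum_distrib_left sum_distrib_right by (subst sum.swap) (simp add: mult_ac)
    also have "\<dots> = (\<Sum>h\<in>levels. if h = h' then phi_value h' else 0)"
      using L that by (intro sum.cong) auto
    finally show ?thesis using that finite_levels by simp
  qed
  then have "\<forall>h\<in>levels. pairing phi_vec (sov h) = phi_value h"
    unfolding phi_vec_def by (intro someI[of "\<lambda>\<phi>. \<forall>h\<in>levels. pairing \<phi> (sov h) = phi_value h"]) blast
  then show "h \<in> levels \<Longrightarrow> pairing phi_vec (sov h) = phi_value h" by blast
qed

lemma phi_vec_all_up: "phi_vec (replicate N Spin_Up) = 1"
proof -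
  have "sov (\<lambda>k\<in>{..<N}. 0) = vac" by (rule sov_zero) simp
  then show ?thesis
    using pairing_phi_vec[OF levels_zero] by (simp only: pairing_vac phi_value_zero)
qed

text \<open>The diagonal weight acts on each separated state as a number, since that state has
  definite magnetisation.\<close>

lemma weighted_pairing:
  "(\<Sum>\<sigma>\<in>configs N. \<phi> \<sigma> * y powi (\<Sum>i<N. spin3 (\<sigma> ! i)) * psi_vec (cfg N \<sigma>))
      = (\<Sum>h\<in>levels. psi_coeff h * y powi (int N - int (\<Sum>k<N. h k)) * pairing \<phi> (sov h))"
proof -
  have *: "y powi (\<Sum>i<N. spin3 (\<sigma> ! i)) * sov h (cfg N \<sigma>) = y powi (int N - int (\<Sum>k<N. h k)) * sov h (cfg N \<sigma>)" for h \<sigma>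
  proof (cases "sov h (cfg N \<sigma>) = 0")
    case False
    then show ?thesis using magnetisation_sov[OF False] by (simp add: cfg_def)
  qed simp
  have "(\<Sum>\<sigma>\<in>configs N. \<phi> \<sigma> * y powi (\<Sum>i<N. spin3 (\<sigma> ! i)) * psi_vec (cfg N \<sigma>))
      = (\<Sum>\<sigma>\<in>configs N. \<Sum>h\<in>levels. \<phi> \<sigma> * psi_coeff h * (y powi (\<Sum>i<N. spin3 (\<sigma> ! i)) * sov h (cfg N \<sigma>)))"
    unfolding psi_vec_def sum_distrib_left by (intro sum.cong refl) (simp add: mult_ac)
  also have "\<dots> = (\<Sum>h\<in>levels. psi_coeff h * y powi (int N - int (\<Sum>k<N. h k)) * pairing \<phi> (sov h))"
    unfolding * pairing_def sum_distrib_left by (subst sum.swap) (intro sum.cong refl, simp add: mult_ac)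
  finally show ?thesis .
qed

end

section \<open>Cauchy determinant and partition function\<close>

lemma det_mat_leibniz:
  "det (mat n n (\<lambda>(i, j). m i j)) = (\<Sum>p\<in>{p. p permutes {0..<n}}. signof p * (\<Prod>i\<in>{0..<n}. m i (p i)))"
  by (subst det_def'[of _ n]) (auto intro!: sum.cong arg_cong2[of _ _ _ _ "(*)"] prod.cong simp: permutes_in_image)

text \<open>Multilinearity in the rows: \<open>S\<close> collects the rows in which the first
  summand is chosen.\<close>

lemma det_mat_rows_add:
  fixes a b :: "nat \<Rightarrow> nat \<Rightarrow> 'a::comm_ring_1"
  shows "det (mat n n (\<lambda>(i, j). a i j + b i j))
       = (\<Sum>S\<in>Pow {0..<n}. det (mat n n (\<lambda>(i, j). if i \<in> S then a i j else b i j)))"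
proof -
  have "(\<Prod>i\<in>{0..<n}. a i (p i) + b i (p i))
      = (\<Sum>S\<in>Pow {0..<n}. \<Prod>i\<in>{0..<n}. if i \<in> S then a i (p i) else b i (p i))" for p
  proof -
    have "(\<Prod>i\<in>S. a i (p i)) * (\<Prod>i\<in>{0..<n} - S. b i (p i))
        = (\<Prod>i\<in>{0..<n}. if i \<in> S then a i (p i) else b i (p i))" if "S \<in> Pow {0..<n}" for S
      using that by (subst prod.If_cases) (auto intro!: arg_cong2[of _ _ _ _ "(*)"] prod.cong)
    then show ?thesis by (simp add: prod_add)
  qed
  then show ?thesis
    unfolding det_mat_leibniz by (simp add: sum_distrib_left sum.swap[of _ "Pow _"])
qed

lemma det_mat_scale_rows:
  fixes c :: "nat \<Rightarrow> 'a::comm_ring_1"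
  shows "det (mat n n (\<lambda>(i, j). c i * m i j)) = (\<Prod>i<n. c i) * det (mat n n (\<lambda>(i, j). m i j))"
  unfolding det_mat_leibniz sum_distrib_left
  by (intro sum.cong refl) (simp add: prod.distrib atLeast0LessThan mult_ac)

lemma br_flip: "br (u / v) = - br (v / u)"
  by (simp add: br_def)

lemma square_neq_if_br: "u \<noteq> 0 \<Longrightarrow> v \<noteq> 0 \<Longrightarrow> br (u / v) \<noteq> 0 \<Longrightarrow> u\<^sup>2 \<noteq> v\<^sup>2"
  by (auto simp: br_def field_simps power2_eq_square)

text \<open>Let the last row variable \<open>z\<close> vary. The determinant with its poles cleared
  has degree \<open>n\<close> as a Laurent polynomial and vanishes at \<open>x i\<close> for
  \<open>i < n\<close>, where two rows coincide. It is therefore a multiple of the product of the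
  \<open>[z / x i]\<close>, and the multiple is found at \<open>z = y n\<close>.\<close>

lemma cauchy_det_step:
  assumes x: "\<And>i. i < Suc n \<Longrightarrow> x i \<noteq> 0" and y: "\<And>j. j < Suc n \<Longrightarrow> y j \<noteq> 0"
    and xy: "\<And>i j. i < Suc n \<Longrightarrow> j < Suc n \<Longrightarrow> br (x i / y j) \<noteq> 0"
    and xx: "\<And>i k. i < k \<Longrightarrow> k < n \<Longrightarrow> br (x i / x k) \<noteq> 0"
  shows "det (mat (Suc n) (Suc n) (\<lambda>(i, j). inverse (br (x i / y j)))) * (\<Prod>j<Suc n. br (x n / y j)) * (\<Prod>i<n. br (x i / y n))
       = det (mat n n (\<lambda>(i, j). inverse (br (x i / y j)))) * (\<Prod>k<n. br (x k / x n) * br (y n / y k))"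
proof -
  define M where "M z = mat (Suc n) (Suc n) (\<lambda>(i, j). inverse (br ((if i = n then z else x i) / y j)))" for z
  define c where "c j = (- 1) ^ (n + j) * det (mat n n (\<lambda>(i, l). inverse (br (x i / y (if l < j then l else Suc l)))))" for j
  \<comment> \<open>Cleared determinant, written by cofactors of the last row so that it also makes
    sense at \<open>z = y n\<close>, where an entry of \<open>M z\<close> has a pole.\<close>
  define F where "F z = (\<Sum>j<Suc n. c j * (\<Prod>k\<in>{..<Suc n} - {j}. br (z / y k)))" for z
  have cof: "cofactor (M z) n j = c j" if "j < Suc n" for j z
  proof -
    have "mat_delete (M z) n j = mat n n (\<lambda>(i, l). inverse (br (x i / y (if l < j then l else Suc l))))"
      using that by (intro eq_matI) (auto simp: mat_delete_def M_def)
    then show ?thesis by (simp add: cofactor_def c_def)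
  qed
  have F: "F z = det (M z) * (\<Prod>k<Suc n. br (z / y k))" if "\<And>k. k < Suc n \<Longrightarrow> br (z / y k) \<noteq> 0" for z
  proof -
    have "det (M z) = (\<Sum>j<Suc n. M z $$ (n, j) * cofactor (M z) n j)"
      by (rule laplace_expansion_row) (auto simp: M_def)
    also have "\<dots> = (\<Sum>j<Suc n. inverse (br (z / y j)) * c j)"
      by (intro sum.cong refl) (simp add: cof, simp add: M_def)
    finally have "det (M z) * (\<Prod>k<Suc n. br (z / y k))
        = (\<Sum>j<Suc n. inverse (br (z / y j)) * c j) * (\<Prod>k<Suc n. br (z / y k))"
      by (simp only:)
    also have "\<dots> = (\<Sum>j<Suc n. c j * (inverse (br (z / y j)) * (\<Prod>k<Suc n. br (z / y k))))"
      unfolding sum_distrib_right by (intro sum.cong refl) (simp only: mult_ac)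
    also have "\<dots> = F z"
      unfolding F_def
    proof (intro sum.cong refl arg_cong2[of _ _ _ _ "(*)"])
      fix j assume "j \<in> {..<Suc n}"
      then show "inverse (br (z / y j)) * (\<Prod>k<Suc n. br (z / y k)) = (\<Prod>k\<in>{..<Suc n} - {j}. br (z / y k))"
        using that by (subst prod.remove[of _ j]) auto
    qed
    finally show ?thesis ..
  qed
  have F_zero: "F (x i) = 0" if "i < n" for i
  proof -
    have "det (M (x i)) = 0"
      using that by (intro det_identical_rows[of _ "Suc n" i n]) (auto simp: M_def intro!: eq_vecI)
    then show ?thesis using F[of "x i"] xy that by simp
  qed
  have F_y: "F (y n) = c n * (\<Prod>k<n. br (y n / y k))"
  proof -
    have z0: "(\<Prod>k\<in>{..<Suc n} - {j}. br (y n / y k)) = 0" if "j < n" for j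
      using that by (intro prod_zero bexI[of _ n]) (auto simp: br_def)
    have "(\<Sum>j<n. c j * (\<Prod>k\<in>{..<Suc n} - {j}. br (y n / y k))) = 0"
      by (intro sum.neutral ballI) (simp only: z0 lessThan_iff mult_zero_right)
    moreover have "{..<Suc n} - {n} = {..<n}" by auto
    ultimately show ?thesis by (simp add: F_def)
  qed
  \<comment> \<open>The constant that makes both Laurent polynomials agree at \<open>y n\<close>;
    with the \<open>n\<close> zeros this gives the \<open>n + 1\<close> points needed.\<close>
  define K where "K = F (y n) / (\<Prod>i<n. br (y n / x i))"
  have yx: "br (y n / x i) \<noteq> 0" if "i < n" for i
    using xy[of i n] that br_flip[of "y n" "x i"] by simp
  have "F (x n) - K * (\<Prod>i<n. br (inverse (x i) * x n)) = 0"
  proof (rule laurent_eq_zero[where n = n and A = "insert (y n) (x ` {..<n})" and z = "x n"])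
    have "laurent n (\<lambda>z. \<Prod>k\<in>{..<Suc n} - {j}. br (inverse (y k) * z))" if "j < Suc n" for j
      using laurent_prod_br[of "{..<Suc n} - {j}" "\<lambda>k. inverse (y k)"] that y by simp
    then have "laurent n F"
      unfolding F_def by (intro laurent_sum laurent_scaled) (simp add: divide_inverse mult.commute)
    moreover have "laurent n (\<lambda>z. \<Prod>i<n. br (inverse (x i) * z))"
      using laurent_prod_br[of "{..<n}" "\<lambda>k. inverse (x k)"] x by simp
    ultimately show "laurent n (\<lambda>z. F z - K * (\<Prod>i<n. br (inverse (x i) * z)))"
      by (intro laurent_diff laurent_scaled)
    have "(\<lambda>z. z\<^sup>2) ` insert (y n) (x ` {..<n}) = (\<lambda>i. (if i = n then y n else x i)\<^sup>2) ` {..<Suc n}"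
      by (force simp: less_Suc_eq)
    moreover have "inj_on (\<lambda>i. (if i = n then y n else x i)\<^sup>2) {..<Suc n}"
    proof (rule linorder_inj_onI)
      fix i k assume ik: "i < k" "i \<in> {..<Suc n}" "k \<in> {..<Suc n}"
      have "(x i)\<^sup>2 \<noteq> (if k = n then y n else x k)\<^sup>2"
      proof (cases "k = n")
        case True
        then show ?thesis
          using square_neq_if_br[of "x i" "y n"] ik x[of i] y[of n] xy[of i n] by simp
      next
        case False
        then show ?thesis
          using square_neq_if_br[of "x i" "x k"] ik x[of i] x[of k] xx[of i k] by simp
      qed
      then show "(if i = n then y n else x i)\<^sup>2 \<noteq> (if k = n then y n else x k)\<^sup>2"
        using ik by simp
    qed auto
    ultimately show "n < card ((\<lambda>z. z\<^sup>2) ` insert (y n) (x ` {..<n})) \<or> infinite ((\<lambda>z. z\<^sup>2) ` insert (y n) (x ` {..<n}))"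
      by (simp add: card_image)
  next
    fix z assume "z \<in> insert (y n) (x ` {..<n})"
    then consider "z = y n" | i where "i < n" "z = x i" by auto
    then show "z \<noteq> 0 \<and> F z - K * (\<Prod>i<n. br (inverse (x i) * z)) = 0"
    proof cases
      case 1
      have "K * (\<Prod>i<n. br (y n / x i)) = F (y n)" using yx by (simp add: K_def)
      then show ?thesis using 1 y[of n] by (simp add: divide_inverse mult.commute)
    next
      case 2
      have "(\<Prod>i<n. br (inverse (x i) * z)) = 0"
        using 2 x[of i] by (intro prod_zero bexI[of _ i]) (auto simp: br_def)
      then show ?thesis using 2 x[of i] F_zero by simp
    qed
  qed (use x in simp)
  then have Fx: "F (x n) = K * (\<Prod>i<n. br (x n / x i))"
    by (simp add: divide_inverse mult.commute)
  have flip: "(\<Prod>i<n. br (u / v i)) = (- 1) ^ n * (\<Prod>i<n. br (v i / u))" for u and v :: "nat \<Rightarrow> complex"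
  proof -
    have "(\<Prod>i<n. br (u / v i)) = (\<Prod>i<n. - 1 * br (v i / u))"
      by (intro prod.cong refl) (simp add: br_flip[of u])
    then show ?thesis by (simp only: prod.distrib prod_constant card_lessThan)
  qed
  have "M (x n) = mat (Suc n) (Suc n) (\<lambda>(i, j). inverse (br (x i / y j)))"
    unfolding M_def by (intro eq_matI) auto
  then have "det (mat (Suc n) (Suc n) (\<lambda>(i, j). inverse (br (x i / y j)))) * (\<Prod>j<Suc n. br (x n / y j)) = F (x n)"
    using F[of "x n"] xy[of n] by simp
  then have "det (mat (Suc n) (Suc n) (\<lambda>(i, j). inverse (br (x i / y j)))) * (\<Prod>j<Suc n. br (x n / y j)) * (\<Prod>i<n. br (y n / x i))
      = F (y n) * (\<Prod>i<n. br (x n / x i))"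
    unfolding Fx K_def using yx by simp
  moreover have "c n = det (mat n n (\<lambda>(i, j). inverse (br (x i / y j))))"
  proof -
    have "mat n n (\<lambda>(i, l). inverse (br (x i / y (if l < n then l else Suc l))))
        = mat n n (\<lambda>(i, j). inverse (br (x i / y j)))"
      by (intro eq_matI) auto
    then show ?thesis by (simp add: c_def mult_2[symmetric])
  qed
  ultimately show ?thesis
    unfolding flip[of "y n" x] flip[of "x n" x] F_y prod.distrib by (simp add: mult_ac)
qed

lemma cauchy_det:
  assumes "\<And>i. i < n \<Longrightarrow> x i \<noteq> 0" "\<And>j. j < n \<Longrightarrow> y j \<noteq> 0"
    and "\<And>i j. i < n \<Longrightarrow> j < n \<Longrightarrow> br (x i / y j) \<noteq> 0"
    and "\<And>i k. i < k \<Longrightarrow> k < n \<Longrightarrow> br (x i / x k) \<noteq> 0"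
  shows "det (mat n n (\<lambda>(i, j). inverse (br (x i / y j)))) * (\<Prod>i<n. \<Prod>j<n. br (x i / y j))
       = (\<Prod>k<n. \<Prod>i<k. br (x i / x k) * br (y k / y i))"
  using assms
proof (induction n)
  case (Suc n)
  let ?d = "\<lambda>n. det (mat n n (\<lambda>(i, j). inverse (br (x i / y j))))"
  have "?d (Suc n) * (\<Prod>i<Suc n. \<Prod>j<Suc n. br (x i / y j))
      = ?d (Suc n) * (\<Prod>j<Suc n. br (x n / y j)) * (\<Prod>i<n. br (x i / y n)) * (\<Prod>i<n. \<Prod>j<n. br (x i / y j))"
    by (simp add: prod.distrib mult_ac)
  also have "\<dots> = ?d n * (\<Prod>i<n. \<Prod>j<n. br (x i / y j)) * (\<Prod>k<n. br (x k / x n) * br (y n / y k))"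
    using cauchy_det_step[of n x y] Suc.prems by (simp add: mult_ac del: prod.lessThan_Suc)
  also have "\<dots> = (\<Prod>k<Suc n. \<Prod>i<k. br (x i / x k) * br (y k / y i))"
    using Suc by simp
  finally show ?case .
qed simp

section \<open>The sum over subsets of sites\<close>

context generic_chain
begin

definition dbl :: "nat set \<Rightarrow> nat \<Rightarrow> nat" where
  "dbl S = (\<lambda>k\<in>{..<N}. if k \<in> S then 2 else 0)"

text \<open>A pair contributes only if exactly one of its sites lies in \<open>S\<close>. Both cases
  are the same expression in (site inside, site outside): in the second the arguments are inverted,
  and the four signs cancel. The order \<open>i < k\<close> makes factorwise comparison
  possible.\<close>

definition weight :: "nat set \<Rightarrow> complex" where
  "weight S = (\<Prod>k<N. \<Prod>i<k.
     if i \<in> S \<and> k \<notin> S then br (q powi 2 * w i / w k) * br (q powi (- 1) * w i / w k) / (br (q powi 1 * w i / w k) * br (q powi 0 * w i / w k))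
     else if i \<notin> S \<and> k \<in> S then br (q powi 1 * w i / w k) * br (q powi (- 2) * w i / w k) / (br (q powi (- 1) * w i / w k) * br (q powi 0 * w i / w k))
     else 1)"

lemma br_powi_flip: "j < N \<Longrightarrow> k < N \<Longrightarrow> br (q powi m * w k / w j) = - br (q powi (- m) * w j / w k)"
  using br_flip[of "q powi m * w k" "w j"] q w by (simp add: power_int_minus field_simps)

lemma sov_weight:
  assumes S: "S \<subseteq> {..<N}"
  shows "psi_coeff (dbl S) * phi_value (dbl S) = weight S"
proof -
  define a where "a m i k = br (q powi m * w i / w k)" for m i k
  have a: "a m i k \<noteq> 0" if "i < k" "k < N" "\<bar>m\<bar> \<le> 3" for m i k
    unfolding a_def using that by (intro generic) auto
  have flip: "a m k i = - a (- m) i k" if "i < k" "k < N" for m i k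
    unfolding a_def using that by (intro br_powi_flip) auto
  define f where "f j k = (if j \<in> S then a 2 j k * a (- 1) j k / (a 1 j k * a (- 2) j k) else 1)" for j k
  have no1: "\<not> (\<exists>k<N. dbl S k = 1)" by (auto simp: dbl_def)
  have ratio: "(if dbl S j = 2 then inverse (qdet q w N (xi j 1)) else 1) * (if dbl S j = 2 then qdet q w N (xi j 0) else 1)
      = (\<Prod>k\<in>{..<N} - {j}. f j k)" if j: "j < N" for j
  proof (cases "j \<in> S")
    case True
    have *: "qdet q w N (xi j 0) = a 2 j j * a (- 1) j j * (\<Prod>k\<in>{..<N} - {j}. a 2 j k * a (- 1) j k)"
      "qdet q w N (xi j 1) = a 1 j j * a (- 2) j j * (\<Prod>k\<in>{..<N} - {j}. a 1 j k * a (- 2) j k)"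
      unfolding qdet_xi a_def[symmetric] using j
      by (auto simp: prod.remove[of "{..<N}" j] a_def)
    have "a m j j = - a (- m) j j" for m
      unfolding a_def using j by (intro br_powi_flip)
    \<comment> \<open>In the quotient of the two quantum determinants, the factors with
      \<open>k = j\<close> cancel.\<close>
    then have d: "a 2 j j * a (- 1) j j = a 1 j j * a (- 2) j j"
      by (metis add.inverse_inverse mult.commute mult_minus_left mult_minus_right)
    have "a 1 j j * a (- 2) j j \<noteq> 0"
      unfolding a_def using generic[OF j j, of 1] generic[OF j j, of "- 2"] by simp
    then show ?thesis
      unfolding * d using True j
      by (simp add: dbl_def f_def prod_dividef prod.distrib divide_inverse prod_inversef[symmetric] mult_ac)
  next
    case False
    then show ?thesis using j by (simp add: dbl_def f_def)
  qed
  have xi: "br (xi i (dbl S i) / xi k (dbl S k)) = a (int (dbl S k) - int (dbl S i)) i k" for i k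
    unfolding a_def xi_ratio ..
  have xi0: "br (xi i 0 / xi k 0) = a 0 i k" for i k
    unfolding a_def xi_ratio by simp
  have "psi_coeff (dbl S) * phi_value (dbl S)
      = (\<Prod>j<N. \<Prod>k\<in>{..<N} - {j}. f j k)
        * (vandermonde_br N (\<lambda>k. xi k (dbl S k)) / vandermonde_br N (\<lambda>k. xi k 0))"
    unfolding psi_coeff_def phi_value_def if_not_P[OF no1]
    using ratio by (simp add: prod.distrib[symmetric] mult.commute mult.left_commute)
  also have "\<dots> = (\<Prod>k<N. \<Prod>i<k. f i k * f k i * (a (int (dbl S k) - int (dbl S i)) i k / a 0 i k))"
    unfolding prod_off_diagonal vandermonde_br_def xi xi0 prod_dividef[symmetric] prod.distrib[symmetric] ..
  also have "\<dots> = weight S"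
    unfolding weight_def a_def[symmetric]
  proof (intro prod.cong refl)
    fix k i assume "k \<in> {..<N}" "i \<in> {..<k}"
    then have ik: "i < k" "k < N" by auto
    note nz = a[OF ik, of 0] a[OF ik, of 1] a[OF ik, of 2] a[OF ik, of "- 1"] a[OF ik, of "- 2"]
    show "f i k * f k i * (a (int (dbl S k) - int (dbl S i)) i k / a 0 i k)
      = (if i \<in> S \<and> k \<notin> S then a 2 i k * a (- 1) i k / (a 1 i k * a 0 i k)
         else if i \<notin> S \<and> k \<in> S then a 1 i k * a (- 2) i k / (a (- 1) i k * a 0 i k) else 1)"
      using ik nz by (auto simp: f_def dbl_def flip[OF ik])
  qed
  finally show ?thesis .
qed

text \<open>The choice of \<open>S\<close> is a choice of \<open>x i = q w_i\<close> or
  \<open>x i = w_i / q\<close> in each row; since \<open>[q w_j / w_i] = - [w_i / (q w_j)]\<close>,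
  the result is a Cauchy matrix in \<open>x\<close> and \<open>w\<close>, up to row factors
  \<open>1/y\<close> and \<open>-y\<close>.\<close>

lemma det_weight:
  assumes S: "S \<subseteq> {..<N}" and y: "y \<noteq> 0"
  shows "(\<Prod>i<N. \<Prod>j<N. br (q * w i / w j)) / (\<Prod>j<N. \<Prod>i<j. br (w i / w j) * br (w j / w i))
      * det (mat N N (\<lambda>(i, j). if i \<in> S then inverse y / br (q * w i / w j) else y / br (q * w j / w i)))
    = y powi (int N - 2 * int (card S)) * weight S"
proof -
  define a where "a m i k = br (q powi m * w i / w k)" for m i k
  have a: "a m i k \<noteq> 0" if "i < N" "k < N" "\<bar>m\<bar> \<le> 3" "i \<noteq> k \<or> m \<noteq> 0" for m i k
    unfolding a_def using that by (intro generic) auto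
  have flip: "a m k i = - a (- m) i k" if "i < N" "k < N" for m i k
    unfolding a_def using that by (intro br_powi_flip) auto
  define e where "e i = (if i \<in> S then 1 else - 1 :: int)" for i
  define x where "x i = q powi e i * w i" for i
  have ratio: "br (x i / w j) = a (e i) i j" "br (x i / x k) = a (e i - e k) i k" for i j k
    using q by (simp_all add: x_def a_def power_int_diff)
  have "mat N N (\<lambda>(i, j). if i \<in> S then inverse y / br (q * w i / w j) else y / br (q * w j / w i))
      = mat N N (\<lambda>(i, j). (if i \<in> S then inverse y else - y) * inverse (br (x i / w j)))"
  proof (intro eq_matI)
    fix i j assume "i < dim_row (mat N N (\<lambda>(i, j). (if i \<in> S then inverse y else - y) * inverse (br (x i / w j))))"
      "j < dim_col (mat N N (\<lambda>(i, j). (if i \<in> S then inverse y else - y) * inverse (br (x i / w j))))"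
    then have ij: "i < N" "j < N" by auto
    then show "mat N N (\<lambda>(i, j). if i \<in> S then inverse y / br (q * w i / w j) else y / br (q * w j / w i)) $$ (i, j)
       = mat N N (\<lambda>(i, j). (if i \<in> S then inverse y else - y) * inverse (br (x i / w j))) $$ (i, j)"
      using flip[OF ij, of 1] by (simp add: x_def e_def a_def divide_inverse)
  qed auto
  then have det: "det (mat N N (\<lambda>(i, j). if i \<in> S then inverse y / br (q * w i / w j) else y / br (q * w j / w i)))
      = (\<Prod>i<N. if i \<in> S then inverse y else - y) * det (mat N N (\<lambda>(i, j). inverse (br (x i / w j))))"
    by (simp only: det_mat_scale_rows)
  have "det (mat N N (\<lambda>(i, j). inverse (br (x i / w j)))) * (\<Prod>i<N. \<Prod>j<N. br (x i / w j))
      = (\<Prod>k<N. \<Prod>i<k. br (x i / x k) * br (w k / w i))"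
  proof (rule cauchy_det)
    show "br (x i / w j) \<noteq> 0" if "i < N" "j < N" for i j
      unfolding ratio using that by (intro a) (auto simp: e_def)
    show "br (x i / x k) \<noteq> 0" if "i < k" "k < N" for i k
      unfolding ratio using that by (intro a) (auto simp: e_def)
  qed (use q w in \<open>auto simp: x_def\<close>)
  moreover have nz: "(\<Prod>i<N. \<Prod>j<N. br (x i / w j)) \<noteq> 0"
    unfolding ratio using a by (auto simp: e_def)
  ultimately have cauchy: "det (mat N N (\<lambda>(i, j). inverse (br (x i / w j))))
      = (\<Prod>k<N. \<Prod>i<k. br (x i / x k) * br (w k / w i)) / (\<Prod>i<N. \<Prod>j<N. br (x i / w j))"
    by (simp add: nonzero_eq_divide_eq)
  define g where "g i k = (if i \<in> S then 1 else a 1 i k / a (- 1) i k)" for i k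
  have rows: "(if i \<in> S then inverse y else - y) * ((\<Prod>j<N. br (q * w i / w j)) / (\<Prod>j<N. br (x i / w j)))
      = (if i \<in> S then inverse y else y) * (\<Prod>j\<in>{..<N} - {i}. g i j)" if i: "i < N" for i
  proof (cases "i \<in> S")
    case True
    have "(\<Prod>j<N. br (q * w i / w j)) = (\<Prod>j<N. br (x i / w j))"
      unfolding ratio using True by (simp add: e_def a_def)
    moreover have "(\<Prod>j<N. br (x i / w j)) \<noteq> 0"
      unfolding ratio using a i by (auto simp: e_def)
    ultimately show ?thesis using True by (simp add: g_def)
  next
    case False
    have "(\<Prod>j<N. br (q * w i / w j)) / (\<Prod>j<N. br (x i / w j)) = (\<Prod>j<N. a 1 i j / a (- 1) i j)"
      unfolding ratio prod_dividef using False by (simp add: e_def a_def)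
    also have "\<dots> = a 1 i i / a (- 1) i i * (\<Prod>j\<in>{..<N} - {i}. g i j)"
      using i False by (subst prod.remove[of _ i]) (auto simp: g_def)
    \<comment> \<open>This diagonal factor compensates the sign in the row factor
      \<open>-y\<close>.\<close>
    also have "a 1 i i / a (- 1) i i = - 1"
      using flip[OF i i, of 1] a[OF i i, of "- 1"] by simp
    finally show ?thesis using False by simp
  qed
  have ypow: "(\<Prod>i<N. if i \<in> S then inverse y else y) = y powi (int N - 2 * int (card S))"
  proof -
    have "(\<Prod>i<N. if i \<in> S then inverse y else y) = inverse y ^ card S * y ^ (N - card S)"
      using S by (simp add: prod.If_cases Int_absorb1 Int_absorb2 Diff_eq[symmetric] card_Diff_subset finite_subset)
    also have "\<dots> = y powi (- int (card S)) * y powi int (N - card S)"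
      by (simp add: power_int_minus power_inverse)
    also have "\<dots> = y powi (int N - 2 * int (card S))"
      using y card_mono[OF _ S] by (subst power_int_add[symmetric]) (auto simp: of_nat_diff)
    finally show ?thesis .
  qed
  have "(\<Prod>i<N. \<Prod>j<N. br (q * w i / w j)) / (\<Prod>j<N. \<Prod>i<j. br (w i / w j) * br (w j / w i))
      * det (mat N N (\<lambda>(i, j). if i \<in> S then inverse y / br (q * w i / w j) else y / br (q * w j / w i)))
     = (\<Prod>i<N. (if i \<in> S then inverse y else - y) * ((\<Prod>j<N. br (q * w i / w j)) / (\<Prod>j<N. br (x i / w j))))
      * (\<Prod>k<N. \<Prod>i<k. br (x i / x k) * br (w k / w i) / (br (w i / w k) * br (w k / w i)))"
    unfolding det cauchy prod.distrib prod_dividef by (simp only: divide_inverse inverse_mult_distrib mult_ac)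
  also have "(\<Prod>i<N. (if i \<in> S then inverse y else - y) * ((\<Prod>j<N. br (q * w i / w j)) / (\<Prod>j<N. br (x i / w j))))
      = y powi (int N - 2 * int (card S)) * (\<Prod>k<N. \<Prod>i<k. g i k * g k i)"
    using rows by (simp add: prod.distrib ypow prod_off_diagonal)
  also have "y powi (int N - 2 * int (card S)) * (\<Prod>k<N. \<Prod>i<k. g i k * g k i)
      * (\<Prod>k<N. \<Prod>i<k. br (x i / x k) * br (w k / w i) / (br (w i / w k) * br (w k / w i)))
      = y powi (int N - 2 * int (card S)) * (\<Prod>k<N. \<Prod>i<k. g i k * g k i *
          (br (x i / x k) * br (w k / w i) / (br (w i / w k) * br (w k / w i))))"
    by (simp add: prod.distrib mult.assoc)
  also have "(\<Prod>k<N. \<Prod>i<k. g i k * g k i * (br (x i / x k) * br (w k / w i) / (br (w i / w k) * br (w k / w i)))) = weight S"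
    unfolding weight_def a_def[symmetric]
  proof (intro prod.cong refl)
    fix k i assume "k \<in> {..<N}" "i \<in> {..<k}"
    then have ik: "i < N" "k < N" "i \<noteq> k" by auto
    note nz = a[OF ik(1,2), of 0] a[OF ik(1,2), of 1] a[OF ik(1,2), of 2] a[OF ik(1,2), of "- 1"] a[OF ik(1,2), of "- 2"]
    have w0: "br (w i / w k) = a 0 i k" "br (w k / w i) = - a 0 i k"
      using flip[OF ik(1,2), of 0] by (simp_all add: a_def)
    show "g i k * g k i * (br (x i / x k) * br (w k / w i) / (br (w i / w k) * br (w k / w i)))
      = (if i \<in> S \<and> k \<notin> S then a 2 i k * a (- 1) i k / (a 1 i k * a 0 i k)
         else if i \<notin> S \<and> k \<in> S then a 1 i k * a (- 2) i k / (a (- 1) i k * a 0 i k) else 1)"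
      unfolding ratio w0 using ik nz by (auto simp: g_def e_def flip[OF ik(1,2)])
  qed
  finally show ?thesis .
qed

lemma sum_levels_dbl:
  "(\<Sum>h\<in>levels. psi_coeff h * y powi (int N - int (\<Sum>k<N. h k)) * phi_value h)
     = (\<Sum>S\<in>Pow {0..<N}. y powi (int N - 2 * int (card S)) * weight S)"
proof -
  have "(\<Sum>h\<in>levels. psi_coeff h * y powi (int N - int (\<Sum>k<N. h k)) * phi_value h)
      = (\<Sum>h\<in>{h \<in> levels. \<forall>k<N. h k \<noteq> 1}. psi_coeff h * y powi (int N - int (\<Sum>k<N. h k)) * phi_value h)"
    by (intro sum.mono_neutral_right finite_levels) (auto simp: psi_coeff_def)
  also have "\<dots> = (\<Sum>S\<in>Pow {0..<N}. psi_coeff (dbl S) * y powi (int N - int (\<Sum>k<N. dbl S k)) * phi_value (dbl S))"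
  proof (rule sum.reindex_bij_witness[of _ dbl "\<lambda>h. {k. k < N \<and> h k = 2}"])
    fix h assume h: "h \<in> {h \<in> levels. \<forall>k<N. h k \<noteq> 1}"
    have "h k = 0 \<or> h k = 2" if "k < N" for k
      using h levels_le[of h k] that by (cases "h k = 0") auto
    then show "dbl {k. k < N \<and> h k = 2} = h"
      using h by (intro levels_eqI) (auto simp: dbl_def levels_def)
    then show "psi_coeff (dbl {k. k < N \<and> h k = 2}) * y powi (int N - int (\<Sum>k<N. dbl {k. k < N \<and> h k = 2} k)) *
        phi_value (dbl {k. k < N \<and> h k = 2}) = psi_coeff h * y powi (int N - int (\<Sum>k<N. h k)) * phi_value h"
      by simp
  qed (auto simp: dbl_def levels_def)
  also have "\<dots> = (\<Sum>S\<in>Pow {0..<N}. y powi (int N - 2 * int (card S)) * weight S)"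
  proof (intro sum.cong refl)
    fix S assume "S \<in> Pow {0..<N}"
    then have S: "S \<subseteq> {..<N}" by auto
    have "(\<Sum>k<N. dbl S k) = (\<Sum>k<N. if k \<in> S then 2 else 0)"
      by (intro sum.cong) (auto simp: dbl_def)
    also have "\<dots> = 2 * card S"
      using S by (simp add: sum.If_cases Int_absorb1 Int_absorb2)
    finally have "int N - int (\<Sum>k<N. dbl S k) = int N - 2 * int (card S)" by simp
    then show "psi_coeff (dbl S) * y powi (int N - int (\<Sum>k<N. dbl S k)) * phi_value (dbl S)
        = y powi (int N - 2 * int (card S)) * weight S"
      using sov_weight[OF S] by (simp add: mult_ac del: of_nat_sum)
  qed
  finally show ?thesis .
qed

lemma partition_function:
  assumes y: "y \<noteq> 0"
  shows "(\<Sum>h\<in>levels. psi_coeff h * y powi (int N - int (\<Sum>k<N. h k)) * phi_value h)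
    = (\<Prod>i<N. \<Prod>j<N. br (q * w i / w j)) / (\<Prod>j<N. \<Prod>i<j. br (w i / w j) * br (w j / w i))
      * det (mat N N (\<lambda>(i, j). inverse y / br (q * w i / w j) + y / br (q * w j / w i)))"
proof -
  have "(\<Prod>i<N. \<Prod>j<N. br (q * w i / w j)) / (\<Prod>j<N. \<Prod>i<j. br (w i / w j) * br (w j / w i))
      * det (mat N N (\<lambda>(i, j). if i \<in> S then inverse y / br (q * w i / w j) else y / br (q * w j / w i)))
    = y powi (int N - 2 * int (card S)) * weight S" if "S \<in> Pow {0..<N}" for S
    using that y by (intro det_weight) auto
  then show ?thesis
    unfolding sum_levels_dbl det_mat_rows_add sum_distrib_left by simp
qed

end

section \<open>Components and generic parameters\<close>

lemma cfg_update: "\<sigma> \<in> configs N \<Longrightarrow> n < N \<Longrightarrow> cfg N (\<sigma>[n := s]) = (cfg N \<sigma>)(n := s)"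
  by (auto simp: cfg_def configs_def fun_eq_iff nth_list_update)

lemma map_cfg: "\<sigma> \<in> configs N \<Longrightarrow> map (cfg N \<sigma>) [0..<N] = \<sigma>"
  by (auto simp: cfg_def configs_def list_eq_iff_nth_eq)

lemma cfg_map: "i < N \<Longrightarrow> cfg N (map s [0..<N]) i = s i"
  by (simp add: cfg_def)

text \<open>Away from site \<open>n\<close> the operator is the identity, so only the three lists
  differing from \<open>\<sigma>\<close> at most there contribute.\<close>

lemma sum_R_site:
  assumes \<sigma>: "\<sigma> \<in> configs N" and n: "n < N"
  shows "(\<Sum>\<rho>\<in>configs N. R_site N q r n z (a, \<sigma>) (c, \<rho>) * G \<rho>)
       = (\<Sum>s\<in>UNIV. R_mat q r z (a, \<sigma> ! n) (c, s) * G (\<sigma>[n := s]))"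
proof -
  have len: "length \<sigma> = N" using \<sigma> by (simp add: configs_def)
  have "(\<Sum>\<rho>\<in>configs N. R_site N q r n z (a, \<sigma>) (c, \<rho>) * G \<rho>)
      = (\<Sum>\<rho>\<in>(\<lambda>s. \<sigma>[n := s]) ` UNIV. R_site N q r n z (a, \<sigma>) (c, \<rho>) * G \<rho>)"
  proof (intro sum.mono_neutral_right finite_configs ballI)
    show "(\<lambda>s. \<sigma>[n := s]) ` UNIV \<subseteq> configs N" using len by (auto simp: configs_def)
    fix \<rho> assume \<rho>: "\<rho> \<in> configs N - (\<lambda>s. \<sigma>[n := s]) ` UNIV"
    have "\<not> (\<forall>k<N. k \<noteq> n \<longrightarrow> \<sigma> ! k = \<rho> ! k)"
    proof
      assume "\<forall>k<N. k \<noteq> n \<longrightarrow> \<sigma> ! k = \<rho> ! k"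
      then have "\<rho> = \<sigma>[n := \<rho> ! n]"
        using \<rho> len n by (intro nth_equalityI) (auto simp: configs_def nth_list_update)
      then show False using \<rho> by blast
    qed
    then show "R_site N q r n z (a, \<sigma>) (c, \<rho>) * G \<rho> = 0" by (auto simp: R_site_def)
  qed
  also have "\<dots> = (\<Sum>s\<in>UNIV. R_site N q r n z (a, \<sigma>) (c, \<sigma>[n := s]) * G (\<sigma>[n := s]))"
  proof (rule sum.reindex_cong[OF _ refl refl])
    show "inj (\<lambda>s. \<sigma>[n := s])"
      using len n by (intro injI) (metis nth_list_update_eq)
  qed
  also have "\<dots> = (\<Sum>s\<in>UNIV. R_mat q r z (a, \<sigma> ! n) (c, s) * G (\<sigma>[n := s]))"
    using len n by (intro sum.cong) (auto simp: R_site_def)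
  finally show ?thesis .
qed

text \<open>Both recursions put the newest site leftmost. Applying the matrix to a vector
  \<open>\<psi>\<close> avoids comparing the two sides as matrices.\<close>

lemma monodromy_T_op:
  assumes "n \<le> N" "\<sigma> \<in> configs N"
  shows "(\<Sum>\<tau>\<in>configs N. monodromy_upto N q r w z n (a, \<sigma>) (b, \<tau>) * \<psi> \<tau>)
       = app (T_op q r w z n a b) (\<lambda>s. \<psi> (map s [0..<N])) (cfg N \<sigma>)"
  using assms
proof (induction n arbitrary: a \<sigma>)
  case 0
  have "(\<Sum>\<tau>\<in>configs N. monodromy_upto N q r w z 0 (a, \<sigma>) (b, \<tau>) * \<psi> \<tau>)
      = (\<Sum>\<tau>\<in>configs N. if \<tau> = \<sigma> then (if a = b then \<psi> \<sigma> else 0) else 0)"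
    by (intro sum.cong) auto
  then show ?case using 0 by (simp add: finite_configs map_cfg)
next
  case (Suc n)
  define f where "f = (\<lambda>s. \<psi> (map s [0..<N]))"
  define x where "x = inverse q * z / w n"
  have "(\<Sum>\<tau>\<in>configs N. monodromy_upto N q r w z (Suc n) (a, \<sigma>) (b, \<tau>) * \<psi> \<tau>)
      = (\<Sum>u\<in>UNIV \<times> configs N. R_site N q r n x (a, \<sigma>) u *
          (\<Sum>\<tau>\<in>configs N. monodromy_upto N q r w z n u (b, \<tau>) * \<psi> \<tau>))"
    by (simp add: sum_distrib_left sum_distrib_right mult.assoc x_def) (rule sum.swap)
  also have "\<dots> = (\<Sum>c\<in>UNIV. \<Sum>\<rho>\<in>configs N. R_site N q r n x (a, \<sigma>) (c, \<rho>) *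
          (\<Sum>\<tau>\<in>configs N. monodromy_upto N q r w z n (c, \<rho>) (b, \<tau>) * \<psi> \<tau>))"
    by (simp add: sum.cartesian_product split_def)
  also have "\<dots> = (\<Sum>c\<in>UNIV. \<Sum>\<rho>\<in>configs N. R_site N q r n x (a, \<sigma>) (c, \<rho>) * app (T_op q r w z n c b) f (cfg N \<rho>))"
    using Suc by (intro sum.cong refl) (simp add: f_def)
  also have "\<dots> = (\<Sum>c\<in>UNIV. \<Sum>s\<in>UNIV. R_mat q r x (a, cfg N \<sigma> n) (c, s) * app (T_op q r w z n c b) f ((cfg N \<sigma>)(n := s)))"
    using Suc.prems by (simp add: sum_R_site cfg_update) (simp add: cfg_def)
  also have "\<dots> = app (T_op q r w z (Suc n) a b) f (cfg N \<sigma>)"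
    by (simp add: app_sum_left L_op_def app_site_op x_def)
  finally show ?case by (simp only: f_def)
qed

lemma depends_upto_add_scaled:
  "depends_upto N f \<Longrightarrow> depends_upto N g \<Longrightarrow> depends_upto N (\<lambda>\<sigma>. f \<sigma> + c * g \<sigma>)"
  unfolding depends_upto_def by metis

lemma depends_upto_map: "depends_upto N (\<lambda>s. \<psi> (map s [0..<N]))"
  unfolding depends_upto_def
proof (intro allI impI)
  fix \<sigma> \<tau> :: "nat \<Rightarrow> spin"
  assume "\<forall>i<N. \<sigma> i = \<tau> i"
  then have "map \<sigma> [0..<N] = map \<tau> [0..<N]" by simp
  then show "\<psi> (map \<sigma> [0..<N]) = \<psi> (map \<tau> [0..<N])" by (rule arg_cong)
qed

context generic_chain
begin

lemma transfer_opT: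
  assumes "\<sigma> \<in> configs N"
  shows "(\<Sum>\<tau>\<in>configs N. transfer N q r w z \<sigma> \<tau> * \<psi> \<tau>)
       = \<i> * app (opT z) (\<lambda>s. \<psi> (map s [0..<N])) (cfg N \<sigma>)"
proof -
  have "(\<Sum>\<tau>\<in>configs N. transfer N q r w z \<sigma> \<tau> * \<psi> \<tau>)
      = \<i> * ((\<Sum>\<tau>\<in>configs N. monodromy_upto N q r w z N (Aux_Up, \<sigma>) (Aux_Down, \<tau>) * \<psi> \<tau>)
        + (\<Sum>\<tau>\<in>configs N. monodromy_upto N q r w z N (Aux_Down, \<sigma>) (Aux_Up, \<tau>) * \<psi> \<tau>))"
    by (simp add: transfer_def op_B_def op_C_def sum_distrib_left sum.distrib[symmetric] algebra_simps)
  then show ?thesis by (simp add: monodromy_T_op assms)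
qed

lemma depends_upto_opT: "depends_upto N f \<Longrightarrow> depends_upto N (app (opT z) f)"
proof -
  assume "depends_upto N f"
  then have "depends_upto N (\<lambda>\<sigma>. app (opB z) f \<sigma> + 1 * app (opC z) f \<sigma>)"
    by (intro depends_upto_add_scaled depends_upto_T order_refl)
  moreover have "app (opT z) f = (\<lambda>\<sigma>. app (opB z) f \<sigma> + 1 * app (opC z) f \<sigma>)"
    by (simp add: fun_eq_iff)
  ultimately show ?thesis by (simp only:)
qed

definition psi_comp :: "spin list \<Rightarrow> complex" where
  "psi_comp \<sigma> = (if \<sigma> \<in> configs N then psi_vec (cfg N \<sigma>) else 0)"

lemma cfg_all_up: "cfg N (replicate N Spin_Up) = (\<lambda>_. Spin_Up)"
  by (auto simp: cfg_def fun_eq_iff)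

lemma psi_comp_map: "(\<lambda>s. psi_comp (map s [0..<N])) = psi_vec"
proof (rule depends_upto_eqI[OF depends_upto_map depends_upto_psi_vec])
  fix \<sigma> assume "\<sigma> \<in> configs N"
  then show "psi_comp (map (cfg N \<sigma>) [0..<N]) = psi_vec (cfg N \<sigma>)"
    by (simp add: map_cfg psi_comp_def)
qed

text \<open>The equivalence yields existence, uniqueness and the value of the description operator
  at once.\<close>

lemma is_psi_right_iff: "is_psi_right N q r w \<psi> \<longleftrightarrow> \<psi> = psi_comp"
proof
  assume "\<psi> = psi_comp"
  moreover have "psi_comp (replicate N Spin_Up) = 1"
    using psi_vec_all_up[of "\<lambda>_. Spin_Up"] by (simp add: psi_comp_def configs_def cfg_all_up)
  ultimately show "is_psi_right N q r w \<psi>"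
    unfolding is_psi_right_def
    by (simp add: transfer_opT psi_comp_map opT_psi_vec del: app_simps) (simp add: psi_comp_def)
next
  assume \<psi>: "is_psi_right N q r w \<psi>"
  define f where "f = (\<lambda>s. \<psi> (map s [0..<N]))"
  have f: "depends_upto N f" unfolding f_def by (rule depends_upto_map)
  have zero: "app (opT z) f \<sigma> = 0" if z: "z \<noteq> 0" for z \<sigma>
  proof -
    have "app (opT z) f = (\<lambda>_. 0)"
    proof (rule depends_upto_eqI[OF depends_upto_opT[OF f]])
      fix \<tau> assume \<tau>: "\<tau> \<in> configs N"
      then have "(\<Sum>\<rho>\<in>configs N. transfer N q r w z \<tau> \<rho> * \<psi> \<rho>) = 0"
        using \<psi> z unfolding is_psi_right_def by blast
      then show "app (opT z) f (cfg N \<tau>) = 0"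
        using transfer_opT[OF \<tau>, of z \<psi>] by (simp add: f_def del: app_simps)
    qed (simp add: depends_upto_def)
    then show ?thesis by (rule fun_cong)
  qed
  have "f (\<lambda>_. Spin_Up) = 1"
    using \<psi> by (simp add: f_def is_psi_right_def map_replicate_const)
  then have "(\<lambda>\<sigma>. f \<sigma> + - 1 * psi_vec \<sigma>) = (\<lambda>_. 0)"
    using psi_vec_all_up[of "\<lambda>_. Spin_Up"]
    by (intro kernel_unique depends_upto_add_scaled f depends_upto_psi_vec, unfold app_add_scaled)
       (simp_all add: zero opT_psi_vec del: app_simps)
  then have "f \<sigma> + - 1 * psi_vec \<sigma> = 0" for \<sigma>
    by (rule fun_cong)
  then have eq: "f \<sigma> = psi_vec \<sigma>" for \<sigma>
    by simp
  show "\<psi> = psi_comp"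
  proof
    fix \<sigma>
    show "\<psi> \<sigma> = psi_comp \<sigma>"
    proof (cases "\<sigma> \<in> configs N")
      case True
      then show ?thesis using eq[of "cfg N \<sigma>"] by (simp add: f_def map_cfg psi_comp_def)
    next
      case False
      then show ?thesis using \<psi> by (simp add: is_psi_right_def psi_comp_def)
    qed
  qed
qed

lemma pairing_opT:
  assumes f: "depends_upto N f"
  shows "\<i> * pairing \<phi> (app (opT z) f) = (\<Sum>\<tau>\<in>configs N. (\<Sum>\<sigma>\<in>configs N. \<phi> \<sigma> * transfer N q r w z \<sigma> \<tau>) * f (cfg N \<tau>))"
proof -
  have "(\<lambda>s. f (cfg N (map s [0..<N]))) = f"
    using f by (intro ext) (auto intro!: depends_uptoD simp: cfg_map)
  then have *: "\<i> * app (opT z) f (cfg N \<sigma>) = (\<Sum>\<tau>\<in>configs N. transfer N q r w z \<sigma> \<tau> * f (cfg N \<tau>))"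
    if "\<sigma> \<in> configs N" for \<sigma>
    using transfer_opT[OF that, of z "\<lambda>\<tau>. f (cfg N \<tau>)"] by simp
  have "\<i> * pairing \<phi> (app (opT z) f) = (\<Sum>\<sigma>\<in>configs N. \<phi> \<sigma> * (\<i> * app (opT z) f (cfg N \<sigma>)))"
    unfolding pairing_def sum_distrib_left by (simp only: mult.left_commute)
  also have "\<dots> = (\<Sum>\<sigma>\<in>configs N. \<phi> \<sigma> * (\<Sum>\<tau>\<in>configs N. transfer N q r w z \<sigma> \<tau> * f (cfg N \<tau>)))"
    by (intro sum.cong refl) (simp only: *)
  also have "\<dots> = (\<Sum>\<tau>\<in>configs N. (\<Sum>\<sigma>\<in>configs N. \<phi> \<sigma> * transfer N q r w z \<sigma> \<tau>) * f (cfg N \<tau>))"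
    unfolding sum_distrib_left sum_distrib_right by (subst sum.swap) (simp add: mult_ac)
  finally show ?thesis .
qed

definition phi_comp :: "spin list \<Rightarrow> complex" where
  "phi_comp \<sigma> = (if \<sigma> \<in> configs N then phi_vec \<sigma> else 0)"

lemma pairing_phi_comp: "pairing phi_comp f = pairing phi_vec f"
  by (simp add: pairing_def phi_comp_def)

lemma is_psi_left_iff: "is_psi_left N q r w \<phi> \<longleftrightarrow> \<phi> = phi_comp"
proof
  assume \<phi>: "\<phi> = phi_comp"
  have "(\<Sum>\<sigma>\<in>configs N. \<phi> \<sigma> * transfer N q r w z \<sigma> \<tau>) = 0" if z: "z \<noteq> 0" and \<tau>: "\<tau> \<in> configs N" for z \<tau>
  proof -
    \<comment> \<open>Testing against the indicator of \<open>\<tau>\<close> extracts the component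
      at \<open>\<tau>\<close>.\<close>
    define f where "f s = (if map s [0..<N] = \<tau> then 1 else 0 :: complex)" for s
    have f: "depends_upto N f" unfolding f_def by (rule depends_upto_map)
    have "f (cfg N \<rho>) = (if \<rho> = \<tau> then 1 else 0)" if "\<rho> \<in> configs N" for \<rho>
      using that by (simp add: f_def map_cfg)
    then have "(\<Sum>\<rho>\<in>configs N. (\<Sum>\<sigma>\<in>configs N. \<phi> \<sigma> * transfer N q r w z \<sigma> \<rho>) * f (cfg N \<rho>))
        = (\<Sum>\<rho>\<in>configs N. if \<rho> = \<tau> then \<Sum>\<sigma>\<in>configs N. \<phi> \<sigma> * transfer N q r w z \<sigma> \<tau> else 0)"
      by (intro sum.cong) auto
    also have "\<dots> = (\<Sum>\<sigma>\<in>configs N. \<phi> \<sigma> * transfer N q r w z \<sigma> \<tau>)"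
      using \<tau> finite_configs by simp
    moreover have "pairing \<phi> (app (opT z) f) = 0"
      unfolding \<phi> pairing_phi_comp by (rule left_kernel_exists[OF pairing_phi_vec f z])
    ultimately show ?thesis using pairing_opT[OF f, of \<phi> z] by simp
  qed
  then show "is_psi_left N q r w \<phi>"
    unfolding is_psi_left_def using phi_vec_all_up by (simp add: \<phi>) (simp add: phi_comp_def configs_def)
next
  assume \<phi>: "is_psi_left N q r w \<phi>"
  have zero: "pairing \<phi> (app (opT z) (sov h)) = 0" if z: "z \<noteq> 0" for z h
  proof -
    have "(\<Sum>\<sigma>\<in>configs N. \<phi> \<sigma> * transfer N q r w z \<sigma> \<tau>) = 0" if "\<tau> \<in> configs N" for \<tau>
      using \<phi> z that unfolding is_psi_left_def by blast
    then have "\<i> * pairing \<phi> (app (opT z) (sov h)) = 0"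
      unfolding pairing_opT[OF depends_upto_sov] by simp
    then show ?thesis by simp
  qed
  have vals: "pairing \<phi> (sov h) = phi_value h" if "h \<in> levels" for h
    using \<phi> zero that by (intro left_kernel_values) (auto simp: is_psi_left_def)
  show "\<phi> = phi_comp"
  proof
    fix \<sigma>
    show "\<phi> \<sigma> = phi_comp \<sigma>"
    proof (cases "\<sigma> \<in> configs N")
      case True
      then show ?thesis
        using pairing_determines[of \<phi> phi_comp \<sigma>] vals by (simp add: pairing_phi_comp pairing_phi_vec)
    next
      case False
      then show ?thesis using \<phi> by (simp add: is_psi_left_def phi_comp_def)
    qed
  qed
qed

lemma magnetisation_nth: "\<sigma> \<in> configs N \<Longrightarrow> magnetisation \<sigma> = (\<Sum>i<N. spin3 (\<sigma> ! i))"
  by (simp add: magnetisation_def sum_list_sum_nth configs_def atLeast0LessThan)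

theorem Z_AD_formula:
  assumes y: "y \<noteq> 0"
  shows "Z_AD N q r w y = (\<Prod>i<N. \<Prod>j<N. br (q * w i / w j)) / (\<Prod>j<N. \<Prod>i<j. br (w i / w j) * br (w j / w i))
      * det (mat N N (\<lambda>(i, j). inverse y / br (q * w i / w j) + y / br (q * w j / w i)))"
proof -
  have "psi_right N q r w = psi_comp" "psi_left N q r w = phi_comp"
    unfolding psi_right_def psi_left_def is_psi_right_iff is_psi_left_iff by simp_all
  then have "Z_AD N q r w y = (\<Sum>\<sigma>\<in>configs N. phi_vec \<sigma> * y powi (\<Sum>i<N. spin3 (\<sigma> ! i)) * psi_vec (cfg N \<sigma>))"
    unfolding Z_AD_def by (intro sum.cong) (auto simp: psi_comp_def phi_comp_def magnetisation_nth)
  also have "\<dots> = (\<Sum>h\<in>levels. psi_coeff h * y powi (int N - int (\<Sum>k<N. h k)) * phi_value h)"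
    unfolding weighted_pairing by (intro sum.cong) (auto simp: pairing_phi_vec)
  finally show ?thesis unfolding partition_function[OF y] .
qed

end

section \<open>The excluded set of parameters as the zero locus of one polynomial\<close>

lemma poly_fun_power: "poly_fun N f \<Longrightarrow> poly_fun N (\<lambda>x. f x ^ n)"
  by (induction n) (auto intro: poly_fun.intros)

lemma poly_fun_prod: "(\<And>i. i \<in> I \<Longrightarrow> poly_fun N (f i)) \<Longrightarrow> poly_fun N (\<lambda>x. \<Prod>i\<in>I. f i x)"
  by (induction I rule: infinite_finite_induct) (auto intro: poly_fun.intros)

lemma poly_fun_diff: "poly_fun N f \<Longrightarrow> poly_fun N g \<Longrightarrow> poly_fun N (\<lambda>x. f x - g x)"
  using poly_fun_add[of N f "\<lambda>x. (- 1) * g x"] poly_fun_mult[OF poly_fun_const[of N "- 1"], of g] by simp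

text \<open>The factor with index \<open>(j, k, e)\<close> vanishes iff \<open>[q\<^bsup>e - 3\<^esup> w\<^sub>j / w\<^sub>k] = 0\<close>.\<close>

definition degeneracy_index :: "nat \<Rightarrow> (nat \<times> nat \<times> nat) set" where
  "degeneracy_index N = {(j, k, e). j < N \<and> k < N \<and> e \<le> 6 \<and> (j \<noteq> k \<or> e \<noteq> 3)}"

definition degeneracy :: "nat \<Rightarrow> complex \<times> (nat \<Rightarrow> complex) \<Rightarrow> complex" where
  "degeneracy N x = (\<Prod>(j, k, e)\<in>degeneracy_index N. (fst x ^ e * snd x j)\<^sup>2 - (fst x ^ 3 * snd x k)\<^sup>2)"

lemma finite_degeneracy_index: "finite (degeneracy_index N)"
  by (rule finite_subset[of _ "{..<N} \<times> {..<N} \<times> {..6}"]) (auto simp: degeneracy_index_def)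

lemma poly_fun_degeneracy: "poly_fun N (degeneracy N)"
proof -
  have "poly_fun N (\<lambda>x. \<Prod>i\<in>degeneracy_index N. (case i of (j, k, e) \<Rightarrow> (fst x ^ e * snd x j)\<^sup>2 - (fst x ^ 3 * snd x k)\<^sup>2))"
  proof (rule poly_fun_prod)
    fix i assume "i \<in> degeneracy_index N"
    then obtain j k e where "i = (j, k, e)" "j < N" "k < N" by (auto simp: degeneracy_index_def)
    then show "poly_fun N (\<lambda>x. case i of (j, k, e) \<Rightarrow> (fst x ^ e * snd x j)\<^sup>2 - (fst x ^ 3 * snd x k)\<^sup>2)"
      by (auto intro!: poly_fun_diff poly_fun_power poly_fun_mult poly_fun_q poly_fun_w)
  qed
  then show ?thesis by (simp add: degeneracy_def[abs_def])
qed

text \<open>At \<open>q = 2\<close>, \<open>w_i = 2^(10 i)\<close> each factor compares powers of 2.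
  Its vanishing means \<open>e + 10 j = 3 + 10 k\<close>, which for \<open>e \<le> 6\<close> forces
  \<open>j = k\<close> and \<open>e = 3\<close>, the index left out.\<close>

lemma degeneracy_nonzero_point:
  fixes N :: nat
  defines "x \<equiv> (2, \<lambda>i\<in>{..<N}. 2 ^ (10 * i))"
  shows "x \<in> param_space N" "degeneracy N x \<noteq> 0"
proof -
  show "x \<in> param_space N" by (auto simp: x_def param_space_def)
  have inj: "(2 :: complex) ^ a = 2 ^ b \<Longrightarrow> a = b" for a b
    by (metis of_nat_eq_iff of_nat_numeral of_nat_power one_less_numeral_iff power_inject_exp semiring_norm(76))
  have "(fst x ^ e * snd x j)\<^sup>2 - (fst x ^ 3 * snd x k)\<^sup>2 \<noteq> 0" if "(j, k, e) \<in> degeneracy_index N" for j k e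
  proof
    assume "(fst x ^ e * snd x j)\<^sup>2 - (fst x ^ 3 * snd x k)\<^sup>2 = 0"
    then have "((2 :: complex) ^ e * 2 ^ (10 * j))\<^sup>2 = (2 ^ 3 * 2 ^ (10 * k))\<^sup>2"
      using that by (simp add: x_def degeneracy_index_def del: power_mult_distrib)
    then have "(2 :: complex) ^ ((e + 10 * j) * 2) = 2 ^ ((3 + 10 * k) * 2)"
      by (simp only: power_add[symmetric] power_mult[symmetric])
    then have "(e + 10 * j) * 2 = (3 + 10 * k) * 2" by (rule inj)
    then show False using that by (simp add: degeneracy_index_def)
  qed
  then have "(case i of (j, k, e) \<Rightarrow> (fst x ^ e * snd x j)\<^sup>2 - (fst x ^ 3 * snd x k)\<^sup>2) \<noteq> 0"
    if "i \<in> degeneracy_index N" for i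
    using that by (cases i) (simp only: prod.case simp_thms)
  then show "degeneracy N x \<noteq> 0"
    using finite_degeneracy_index[of N] by (simp only: degeneracy_def prod_zero_iff) blast
qed

lemma generic_chain_if_nondegenerate:
  assumes N: "1 \<le> N" and x: "(q, w) \<in> param_space N" and nz: "degeneracy N (q, w) \<noteq> 0"
    and r: "r\<^sup>2 = br q * br (q\<^sup>2)"
  shows "generic_chain N q r w"
proof -
  have q: "q \<noteq> 0" and w: "w i \<noteq> 0" if "i < N" for i
    using x that N by (auto simp: param_space_def)
  have q: "q \<noteq> 0" using q[of 0] N by simp
  have gen: "br (q powi m * w j / w k) \<noteq> 0" if jk: "j < N" "k < N" "\<bar>m\<bar> \<le> 3" "j \<noteq> k \<or> m \<noteq> 0" for j k m
  proof
    assume 0: "br (q powi m * w j / w k) = 0"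
    have "(j, k, nat (m + 3)) \<in> degeneracy_index N"
      using jk by (auto simp: degeneracy_index_def)
    then have "(q ^ nat (m + 3) * w j)\<^sup>2 - (q ^ 3 * w k)\<^sup>2 \<noteq> 0"
      using nz finite_degeneracy_index[of N] by (fastforce simp: degeneracy_def)
    moreover have "q ^ nat (m + 3) = q powi m * q ^ 3"
    proof -
      have "q ^ nat (m + 3) = q powi (m + 3)" using jk by (simp add: power_int_def)
      then show ?thesis using q by (simp add: power_int_add)
    qed
    moreover have "(q powi m * w j)\<^sup>2 = (w k)\<^sup>2"
    proof (rule ccontr)
      assume "(q powi m * w j)\<^sup>2 \<noteq> (w k)\<^sup>2"
      then show False
        using 0 w[OF jk(1)] w[OF jk(2)] q by (simp add: br_def field_simps power2_eq_square)
    qed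
    ultimately show False by (simp add: power_mult_distrib mult_ac)
  qed
  show ?thesis
  proof
    show "br (q\<^sup>2) \<noteq> 0" using gen[of 0 0 2] N w[of 0] by simp
  qed (use q w r gen N in auto)
qed

theorem proposition4p1:
  fixes N :: nat
  assumes "1 \<le> N"
  shows "for_generic_params N (\<lambda>q w. \<forall>r. r\<^sup>2 = br q * br (q\<^sup>2) \<longrightarrow>
    (\<exists>!\<psi>. is_psi_right N q r w \<psi>) \<and>
    (\<exists>!\<phi>. is_psi_left N q r w \<phi>) \<and>
    (\<forall>y. y \<noteq> 0 \<longrightarrow>
      Z_AD N q r w y =
        (\<Prod>i<N. \<Prod>j<N. br (q * w i / w j))
        / (\<Prod>j<N. \<Prod>i<j. br (w i / w j) * br (w j / w i))
        * det (mat N N (\<lambda>(i, j).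
            inverse y / br (q * w i / w j) + y / br (q * w j / w i)))))"
proof -
  let ?V = "{x \<in> param_space N. degeneracy N x = 0}"
  have "zariski_closed N ?V"
    unfolding zariski_closed_def by (rule exI[of _ "{degeneracy N}"]) (simp add: poly_fun_degeneracy)
  moreover have "?V \<subset> param_space N"
    using degeneracy_nonzero_point[of N] by auto
  moreover have "(\<exists>!\<psi>. is_psi_right N q r w \<psi>) \<and> (\<exists>!\<phi>. is_psi_left N q r w \<phi>) \<and>
      (\<forall>y. y \<noteq> 0 \<longrightarrow> Z_AD N q r w y =
        (\<Prod>i<N. \<Prod>j<N. br (q * w i / w j)) / (\<Prod>j<N. \<Prod>i<j. br (w i / w j) * br (w j / w i))
        * det (mat N N (\<lambda>(i, j). inverse y / br (q * w i / w j) + y / br (q * w j / w i))))"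
    if "(q, w) \<in> param_space N - ?V" "r\<^sup>2 = br q * br (q\<^sup>2)" for q r w
  proof -
    have "generic_chain N q r w"
    proof (rule generic_chain_if_nondegenerate[OF assms _ _ that(2)])
      show "(q, w) \<in> param_space N" "degeneracy N (q, w) \<noteq> 0" using that(1) by simp_all
    qed
    then show ?thesis
      by (simp add: generic_chain.is_psi_right_iff generic_chain.is_psi_left_iff generic_chain.Z_AD_formula)
  qed
  ultimately show ?thesis
    unfolding for_generic_params_def by (intro exI[of _ ?V] conjI) blast+
qed

end
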